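(* For $\ell\ge 1$, let $c(\mathcal S_\ell)$ be the central arrangement in $\mathbb C^{\ell+1}$ (coordinates $x_0,x_1,\dots,x_\ell$) consisting of the hyperplanes $\{x_0=0\}$, $\{x_i-x_j=0\}$ and $\{x_i-x_j-x_0=0\}$ for $1\le i<j\le\ell$ (the cone of the Shi arrangement). Then its Falk invariant is $$\phi_3(c(\mathcal S_\ell))=\frac{\ell(\ell-1)(2\ell^2+\ell-4)}{6}.$$
   Context: Falk invariant: for a central arrangement with hyperplanes $H_0,\dots,H_n$, $H_i=\alpha_i^{-1}(0)$, let $E$ be the exterior algebra over $\mathbb C$ on $e_0,\dots,e_n$ with degree-$p$ part $E^p$, and $\partial$ the degree $-1$ derivation with $\partial e_i=1$. A subset $S$ is dependent if $\{\alpha_i:i\in S\}$ is linearly dependent. The Orlik–Solomon ideal $I$ is generated by $\partial e_S$ for $S$ dependent ($e_S$ the ordered wedge of $e_i$, $i\in S$), $I^p=I\cap E^p$, and $\phi_3=\dim\ker(E^1\otimes I^2\to E^3,\ a\otimes b\mapsto a\wedge b)$. *)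

theory Defs
  imports Complex_Main "HOL-Library.Function_Algebras" "HOL.Hull"
begin

section \<open>Complex vector spaces of functions\<close>

definition cscale :: "complex \<Rightarrow> ('a \<Rightarrow> complex) \<Rightarrow> 'a \<Rightarrow> complex" where
  "cscale c f = (\<lambda>x. c * f x)"

global_interpretation cfun: vector_space "cscale :: complex \<Rightarrow> ('a \<Rightarrow> complex) \<Rightarrow> 'a \<Rightarrow> complex"
  by unfold_locales (auto simp: cscale_def fun_eq_iff algebra_simps)

section \<open>The exterior algebra on \<open>e\<^sub>0, \<dots>, e\<^sub>n\<close>\<close>

text \<open>
  An element of the exterior algebra is given by its coordinates with respect to the basis of
  ordered wedges \<open>e\<^sub>S\<close>, \<open>S \<subseteq> {0, \<dots>, n}\<close>.
\<close>

definition ext_alg :: "nat \<Rightarrow> (nat set \<Rightarrow> complex) set" where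
  "ext_alg n = {f. \<forall>S. f S \<noteq> 0 \<longrightarrow> S \<subseteq> {..n}}"

definition ext_deg :: "nat \<Rightarrow> nat \<Rightarrow> (nat set \<Rightarrow> complex) set" where
  "ext_deg n p = {f \<in> ext_alg n. \<forall>S. f S \<noteq> 0 \<longrightarrow> card S = p}"

definition ebasis :: "nat set \<Rightarrow> nat set \<Rightarrow> complex" where
  "ebasis S = (\<lambda>T. if T = S then 1 else 0)"

text \<open>
  For disjoint \<open>S\<close> and \<open>T\<close> one has \<open>e\<^sub>S \<and> e\<^sub>T = ext_sign S T \<cdot> e\<^bsub>S \<union> T\<^esub>\<close>: the sign is that of the
  permutation sorting the concatenation of \<open>S\<close> and \<open>T\<close>.
\<close>

definition ext_sign :: "nat set \<Rightarrow> nat set \<Rightarrow> complex" where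
  "ext_sign S T = (-1) ^ card {(s, t). s \<in> S \<and> t \<in> T \<and> t < s}"

definition wedge :: "(nat set \<Rightarrow> complex) \<Rightarrow> (nat set \<Rightarrow> complex) \<Rightarrow> nat set \<Rightarrow> complex"
  where "wedge f g = (\<lambda>U. \<Sum>S\<in>Pow U. ext_sign S (U - S) * f S * g (U - S))"

text \<open>
  In coordinates, \<open>\<partial> e\<^sub>U = (\<Sum>s\<in>U. (-1) ^ card {t \<in> U. t < s} e\<^bsub>U - {s}\<^esub>)\<close>. That this is the
  derivation of degree \<open>-1\<close> with \<open>\<partial> e\<^sub>i = 1\<close> is confirmed by \<open>ext_boundary_generator\<close>
  and \<open>ext_boundary_wedge\<close> below.
\<close>

definition ext_boundary :: "nat \<Rightarrow> (nat set \<Rightarrow> complex) \<Rightarrow> nat set \<Rightarrow> complex" where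
  "ext_boundary n f = (\<lambda>T. \<Sum>s\<in>{..n} - T. (-1) ^ card {t \<in> T. t < s} * f (insert s T))"

lemma wedge_generator:
  assumes "finite U"
  shows "wedge (ebasis {i}) f U =
    (if i \<in> U then (-1) ^ card {t \<in> U - {i}. t < i} * f (U - {i}) else 0)"
proof -
  have "wedge (ebasis {i}) f U =
      (\<Sum>S\<in>Pow U. if S = {i} then ext_sign {i} (U - {i}) * f (U - {i}) else 0)"
    unfolding wedge_def ebasis_def by (intro sum.cong) auto
  also have "\<dots> = (if i \<in> U then ext_sign {i} (U - {i}) * f (U - {i}) else 0)"
    using assms by (simp add: sum.delta')
  also have "{(s, t). s \<in> {i} \<and> t \<in> U - {i} \<and> t < s} = Pair i ` {t \<in> U - {i}. t < i}"
    by auto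
  then have "ext_sign {i} (U - {i}) = (-1) ^ card {t \<in> U - {i}. t < i}"
    by (simp add: ext_sign_def card_image inj_on_def)
  finally show ?thesis by simp
qed

lemma wedge_infinite: "infinite U \<Longrightarrow> wedge f g U = 0"
  by (simp add: wedge_def)

lemma ebasis_insert_Min:
  assumes "finite S" and "\<forall>t\<in>S. i < t"
  shows "wedge (ebasis {i}) (ebasis S) = ebasis (insert i S)"
proof
  fix U show "wedge (ebasis {i}) (ebasis S) U = ebasis (insert i S) U"
  proof (cases "finite U")
    case True
    have e: "{t \<in> U - {i}. t < i} = {}" if "U - {i} = S"
      unfolding that using assms(2) by fastforce
    have "i \<notin> S" using assms by auto
    then have iff: "U = insert i S \<longleftrightarrow> i \<in> U \<and> U - {i} = S" by auto
    have "ebasis (insert i S) U = (if i \<in> U \<and> U - {i} = S then 1 else 0)"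
      unfolding ebasis_def iff ..
    then show ?thesis
      unfolding wedge_generator[OF True] using e by (simp add: ebasis_def del: Collect_empty_eq)
  next
    case False
    then have "U \<noteq> insert i S" using assms(1) by auto
    then have "ebasis (insert i S) U = 0" by (simp add: ebasis_def)
    then show ?thesis using False by (simp add: wedge_infinite)
  qed
qed

lemma wedge_assoc: "wedge (wedge f g) h = wedge f (wedge g h)"
proof
  fix U show "wedge (wedge f g) h U = wedge f (wedge g h) U"
  proof (cases "finite U")
    case True
    have sgn_un_left: "ext_sign (P \<union> Q) R = ext_sign P R * ext_sign Q R"
      if "P \<subseteq> U" "Q \<subseteq> U" "R \<subseteq> U" "P \<inter> Q = {}" for P Q R
    proof -
      have "{(s, t). s \<in> P \<union> Q \<and> t \<in> R \<and> t < s} =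
        {(s, t). s \<in> P \<and> t \<in> R \<and> t < s} \<union> {(s, t). s \<in> Q \<and> t \<in> R \<and> t < s}" by auto
      moreover have "finite {(s, t). s \<in> P \<and> t \<in> R \<and> t < s}" "finite {(s, t). s \<in> Q \<and> t \<in> R \<and> t < s}"
        by (rule finite_subset[of _ "U \<times> U"]; use that True in auto)+
      moreover have "{(s, t). s \<in> P \<and> t \<in> R \<and> t < s} \<inter> {(s, t). s \<in> Q \<and> t \<in> R \<and> t < s} = {}"
        using that by auto
      ultimately show ?thesis unfolding ext_sign_def by (simp add: card_Un_disjoint power_add)
    qed
    have sgn_un_right: "ext_sign R (P \<union> Q) = ext_sign R P * ext_sign R Q"
      if "P \<subseteq> U" "Q \<subseteq> U" "R \<subseteq> U" "P \<inter> Q = {}" for P Q R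
    proof -
      have "{(s, t). s \<in> R \<and> t \<in> P \<union> Q \<and> t < s} =
        {(s, t). s \<in> R \<and> t \<in> P \<and> t < s} \<union> {(s, t). s \<in> R \<and> t \<in> Q \<and> t < s}" by auto
      moreover have "finite {(s, t). s \<in> R \<and> t \<in> P \<and> t < s}" "finite {(s, t). s \<in> R \<and> t \<in> Q \<and> t < s}"
        by (rule finite_subset[of _ "U \<times> U"]; use that True in auto)+
      moreover have "{(s, t). s \<in> R \<and> t \<in> P \<and> t < s} \<inter> {(s, t). s \<in> R \<and> t \<in> Q \<and> t < s} = {}"
        using that by auto
      ultimately show ?thesis unfolding ext_sign_def by (simp add: card_Un_disjoint power_add)
    qed
    have "wedge (wedge f g) h U = (\<Sum>(S, P)\<in>Sigma (Pow U) Pow.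
        ext_sign S (U - S) * (ext_sign P (S - P) * f P * g (S - P)) * h (U - S))"
      using True by (subst sum.Sigma[symmetric])
        (auto simp: wedge_def sum_distrib_left sum_distrib_right finite_subset)
    also have "\<dots> = (\<Sum>(P, Q)\<in>(SIGMA P:Pow U. Pow (U - P)).
        ext_sign P (U - P) * f P * (ext_sign Q (U - P - Q) * g Q * h (U - P - Q)))"
    proof (rule sum.reindex_bij_witness[where i = "\<lambda>(P, Q). (P \<union> Q, P)" and j = "\<lambda>(S, P). (P, S - P)"],
        goal_cases)
      case (5 a)
      obtain S P where a: "a = (S, P)" "S \<subseteq> U" "P \<subseteq> S" using 5 by auto
      have d: "U - P - (S - P) = U - S" "P \<union> (S - P) = S" "U - P = (S - P) \<union> (U - S)"
        using a by auto
      have "ext_sign S (U - S) = ext_sign P (U - S) * ext_sign (S - P) (U - S)"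
        using sgn_un_left[of P "S - P" "U - S"] a d by auto
      moreover have "ext_sign P (U - P) = ext_sign P (S - P) * ext_sign P (U - S)"
        using sgn_un_right[of "S - P" "U - S" P] a d by auto
      ultimately show ?case using a d(1) by simp
    qed auto
    also have "\<dots> = wedge f (wedge g h) U"
      using True by (subst sum.Sigma[symmetric])
        (auto simp: wedge_def sum_distrib_left sum_distrib_right)
    finally show ?thesis .
  qed (simp add: wedge_infinite)
qed

lemma wedge_generators_anticomm:
  "wedge (ebasis {i}) (ebasis {j}) = - wedge (ebasis {j}) (ebasis {i})"
proof
  fix U show "wedge (ebasis {i}) (ebasis {j}) U = (- wedge (ebasis {j}) (ebasis {i})) U"
  proof (cases "finite U")
    case True
    show ?thesis
    proof (cases "i \<noteq> j \<and> U = {i, j}")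
      case True
      then have "U - {i} = {j}" "U - {j} = {i}" by auto
      moreover have "i \<in> U" "j \<in> U" using True by auto
      moreover have "{t \<in> {j}. t < i} = (if j < i then {j} else {})"
        "{t \<in> {i}. t < j} = (if i < j then {i} else {})" by auto
      moreover have "i < j \<or> j < i" using True by auto
      ultimately show ?thesis
        unfolding fun_Compl_def wedge_generator[OF \<open>finite U\<close>] by (auto simp: ebasis_def)
    next
      case False
      then have "\<not> (i \<in> U \<and> U - {i} = {j})" "\<not> (j \<in> U \<and> U - {j} = {i})" by auto
      then show ?thesis
        unfolding fun_Compl_def wedge_generator[OF \<open>finite U\<close>] by (simp add: ebasis_def)
    qed
  qed (simp add: wedge_infinite)
qed

lemma ext_boundary_generator: "i \<le> n \<Longrightarrow> ext_boundary n (ebasis {i}) = ebasis {}"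
proof
  fix T assume "i \<le> n"
  have eq: "insert s T = {i} \<longleftrightarrow> s = i \<and> T = {}" if "s \<notin> T" for s using that by auto
  have "ext_boundary n (ebasis {i}) T =
      (\<Sum>s\<in>{..n} - T. if s = i then (if T = {} then 1 else 0) else 0)"
    unfolding ext_boundary_def by (intro sum.cong) (auto simp: ebasis_def eq)
  also have "\<dots> = ebasis {} T" using \<open>i \<le> n\<close> by (auto simp: ebasis_def sum.delta')
  finally show "ext_boundary n (ebasis {i}) T = ebasis {} T" .
qed

lemma ext_boundary_wedge:
  assumes "i \<le> n" and "f \<in> ext_alg n"
  shows "ext_boundary n (wedge (ebasis {i}) f) = f - wedge (ebasis {i}) (ext_boundary n f)"
proof
  fix T
  let ?L = "ext_boundary n (wedge (ebasis {i}) f) T"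
  show "?L = (f - wedge (ebasis {i}) (ext_boundary n f)) T"
  proof (cases "finite T")
    case False
    then have "f T = 0" using assms(2) finite_subset[of T "{..n}"] by (auto simp: ext_alg_def)
    then show ?thesis using False by (simp add: ext_boundary_def wedge_infinite)
  next
    case fin: True
    show ?thesis
    proof (cases "i \<in> T")
      case False
      have "?L = (\<Sum>s\<in>{..n} - T. if s = i then f T else 0)"
        unfolding ext_boundary_def
      proof (rule sum.cong[OF refl])
        fix s assume s: "s \<in> {..n} - T"
        have "(-1::complex) ^ k * ((-1) ^ k * x) = x" for k x
          by (simp add: mult.assoc[symmetric] power_add[symmetric])
        moreover have "insert i T - {i} = T" using False by auto
        ultimately show "(-1) ^ card {t \<in> T. t < s} * wedge (ebasis {i}) f (insert s T) =
          (if s = i then f T else 0)"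
          using False fin s by (auto simp: wedge_generator)
      qed
      then show ?thesis using False fin assms(1) by (simp add: wedge_generator)
    next
      case True
      let ?T = "T - {i}"
      have "?L = (\<Sum>s\<in>{..n} - T. - ((-1) ^ card {t \<in> ?T. t < i} *
          ((-1) ^ card {t \<in> ?T. t < s} * f (insert s ?T))))"
        unfolding ext_boundary_def
      proof (rule sum.cong[OF refl])
        fix s assume s: "s \<in> {..n} - T"
        then have ne: "s \<noteq> i" using True by auto
        have "{t \<in> T. t < s} = (if i < s then insert i {t \<in> ?T. t < s} else {t \<in> ?T. t < s})"
          using True by auto
        then have c1: "card {t \<in> T. t < s} = card {t \<in> ?T. t < s} + (if i < s then 1 else 0)"
          using fin by auto
        have d: "insert s T - {i} = insert s ?T" using ne by auto
        have "{t \<in> insert s ?T. t < i} = (if s < i then insert s {t \<in> ?T. t < i} else {t \<in> ?T. t < i})"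
          by auto
        then have c2: "card {t \<in> insert s ?T. t < i} = card {t \<in> ?T. t < i} + (if s < i then 1 else 0)"
          using fin s by auto
        have "wedge (ebasis {i}) f (insert s T) =
            (-1) ^ card {t \<in> insert s ?T. t < i} * f (insert s ?T)"
          using True fin d by (simp add: wedge_generator)
        then show "(-1) ^ card {t \<in> T. t < s} * wedge (ebasis {i}) f (insert s T) =
            - ((-1) ^ card {t \<in> ?T. t < i} * ((-1) ^ card {t \<in> ?T. t < s} * f (insert s ?T)))"
          unfolding c1 c2 using ne by (cases "i < s") (auto simp: power_add)
      qed
      moreover have "{..n} - ?T = insert i ({..n} - T)" using True assms(1) by auto
      moreover have "insert i ?T = T" using True by auto
      moreover have "(-1::complex) ^ k * ((-1) ^ k * x) = x" for k x
        by (simp add: mult.assoc[symmetric] power_add[symmetric])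
      ultimately show ?thesis using True fin
        by (simp add: wedge_generator ext_boundary_def sum_negf sum_distrib_left distrib_left)
    qed
  qed
qed

section \<open>The Orlik--Solomon ideal and the Falk invariant\<close>

definition ext_ideal :: "nat \<Rightarrow> (nat set \<Rightarrow> complex) set \<Rightarrow> bool" where
  "ext_ideal n J \<longleftrightarrow> J \<subseteq> ext_alg n \<and> cfun.subspace J \<and>
     (\<forall>a\<in>ext_alg n. \<forall>x\<in>J. wedge a x \<in> J \<and> wedge x a \<in> J)"

text \<open>
  A linear form on \<open>\<complex>\<^bsup>\<ell>+1\<^esup>\<close> is represented by its coefficient vector; \<open>\<alpha> i\<close> for \<open>i \<le> n\<close> is the form
  defining the hyperplane \<open>H\<^sub>i\<close>.
\<close>

definition os_ideal :: "nat \<Rightarrow> (nat \<Rightarrow> nat \<Rightarrow> complex) \<Rightarrow> (nat set \<Rightarrow> complex) set" where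
  "os_ideal n \<alpha> = ext_ideal n hull
     {ext_boundary n (ebasis S) | S. S \<subseteq> {..n} \<and> cfun.dependent (\<alpha> ` S)}"

text \<open>
  For function spaces \<open>A\<close> and \<open>B\<close>, the tensor product \<open>A \<otimes> B\<close> is realised as the space of functions
  of two variables spanned by the products \<open>a(x) b(y)\<close>.
\<close>

definition tensor :: "('a \<Rightarrow> complex) \<Rightarrow> ('b \<Rightarrow> complex) \<Rightarrow> 'a \<times> 'b \<Rightarrow> complex" where
  "tensor a b = (\<lambda>(x, y). a x * b y)"

definition tensor_space ::
    "('a \<Rightarrow> complex) set \<Rightarrow> ('b \<Rightarrow> complex) set \<Rightarrow> ('a \<times> 'b \<Rightarrow> complex) set" where
  "tensor_space A B = cfun.span {tensor a b | a b. a \<in> A \<and> b \<in> B}"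

definition wedge_map :: "(nat set \<times> nat set \<Rightarrow> complex) \<Rightarrow> nat set \<Rightarrow> complex" where
  "wedge_map t = (\<lambda>U. \<Sum>S\<in>Pow U. ext_sign S (U - S) * t (S, U - S))"

lemma wedge_map_tensor: "wedge_map (tensor a b) = wedge a b"
  by (simp add: wedge_map_def wedge_def tensor_def mult.assoc)

lemma linear_wedge_map: "Vector_Spaces.linear cscale cscale wedge_map"
  by unfold_locales
    (auto simp: wedge_map_def cscale_def fun_eq_iff algebra_simps sum.distrib sum_distrib_left)

definition falk_invariant :: "nat \<Rightarrow> (nat \<Rightarrow> nat \<Rightarrow> complex) \<Rightarrow> nat" where
  "falk_invariant n \<alpha> =
     cfun.dim {t \<in> tensor_space (ext_deg n 1) (os_ideal n \<alpha> \<inter> ext_deg n 2). wedge_map t = 0}"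

section \<open>The cone of the Shi arrangement\<close>

text \<open>The space \<open>\<complex>\<^bsup>\<ell>+1\<^esup>\<close> with coordinates \<open>x\<^sub>0, \<dots>, x\<^sub>\<ell>\<close>.\<close>

definition coord_space :: "nat \<Rightarrow> (nat \<Rightarrow> complex) set" where
  "coord_space l = {x. \<forall>k>l. x k = 0}"

definition hyperplane :: "nat \<Rightarrow> (nat \<Rightarrow> complex) \<Rightarrow> (nat \<Rightarrow> complex) set" where
  "hyperplane l a = {x \<in> coord_space l. (\<Sum>k\<le>l. a k * x k) = 0}"

definition shi_cone :: "nat \<Rightarrow> (nat \<Rightarrow> complex) set set" where
  "shi_cone l =
     {{x \<in> coord_space l. x 0 = 0}} \<union>
     {{x \<in> coord_space l. x i - x j = 0} | i j. 1 \<le> i \<and> i < j \<and> j \<le> l} \<union>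
     {{x \<in> coord_space l. x i - x j - x 0 = 0} | i j. 1 \<le> i \<and> i < j \<and> j \<le> l}"

definition defining_forms :: "nat \<Rightarrow> (nat \<Rightarrow> complex) set set \<Rightarrow> nat \<Rightarrow> (nat \<Rightarrow> nat \<Rightarrow> complex) \<Rightarrow> bool"
  where "defining_forms l A n \<alpha> \<longleftrightarrow>
    (\<forall>i\<le>n. \<alpha> i \<in> coord_space l) \<and> bij_betw (\<lambda>i. hyperplane l (\<alpha> i)) {..n} A"

lemma shi_cone_has_defining_forms: "\<exists>n \<alpha>. defining_forms l (shi_cone l) n \<alpha>"
proof -
  let ?I = "{(i, j). 1 \<le> i \<and> i < j \<and> j \<le> l}"
  have "finite ?I" by (rule finite_subset[of _ "{..l} \<times> {..l}"]) auto
  moreover have "shi_cone l = {{x \<in> coord_space l. x 0 = 0}} \<union>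
     (\<lambda>(i, j). {x \<in> coord_space l. x i - x j = 0}) ` ?I \<union>
     (\<lambda>(i, j). {x \<in> coord_space l. x i - x j - x 0 = 0}) ` ?I"
    unfolding shi_cone_def by (auto simp: image_def)
  ultimately have fin: "finite (shi_cone l)" by simp
  have "shi_cone l \<noteq> {}" by (simp add: shi_cone_def)
  then obtain n where n: "card (shi_cone l) = Suc n" using fin by (cases "card (shi_cone l)") auto
  obtain h where h: "bij_betw h {..n} (shi_cone l)"
    using finite_same_card_bij[of "{..n}" "shi_cone l"] fin n by auto
  have "\<exists>a \<in> coord_space l. hyperplane l a = H" if "H \<in> shi_cone l" for H
  proof -
    let ?d = "\<lambda>m k. if k = m then 1 else 0 :: complex"
    have s: "(\<Sum>k\<le>l. ?d m k * x k) = x m" if "m \<le> l" for m x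
      using that by (simp add: if_distrib[of "\<lambda>c. c * _"] cong: if_cong)
    consider "H = {x \<in> coord_space l. x 0 = 0}"
      | i j where "H = {x \<in> coord_space l. x i - x j = 0}" "i < j" "j \<le> l"
      | i j where "H = {x \<in> coord_space l. x i - x j - x 0 = 0}" "1 \<le> i" "i < j" "j \<le> l"
      using \<open>H \<in> shi_cone l\<close> unfolding shi_cone_def by auto
    then show ?thesis
    proof cases
      case 1
      then show ?thesis using s[of 0]
        by (intro bexI[of _ "?d 0"]) (auto simp: hyperplane_def coord_space_def)
    next
      case 2
      have "(\<Sum>k\<le>l. (?d i k - ?d j k) * x k) = x i - x j" for x
        using s[of i x] s[of j x] 2 by (simp only: left_diff_distrib sum_subtractf)
      then show ?thesis using 2
        by (intro bexI[of _ "\<lambda>k. ?d i k - ?d j k"]) (auto simp: hyperplane_def coord_space_def)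
    next
      case 3
      have "(\<Sum>k\<le>l. (?d i k - ?d j k - ?d 0 k) * x k) = x i - x j - x 0" for x
        using s[of i x] s[of j x] s[of 0 x] 3 by (simp only: left_diff_distrib sum_subtractf)
      then show ?thesis using 3
        by (intro bexI[of _ "\<lambda>k. ?d i k - ?d j k - ?d 0 k"]) (auto simp: hyperplane_def coord_space_def)
    qed
  qed
  then obtain a where a: "\<And>H. H \<in> shi_cone l \<Longrightarrow> a H \<in> coord_space l \<and> hyperplane l (a H) = H"
    by metis
  have mem: "h i \<in> shi_cone l" if "i \<le> n" for i using h that by (auto simp: bij_betw_def)
  have "bij_betw (\<lambda>i. hyperplane l (a (h i))) {..n} (shi_cone l)"
    using h by (rule bij_betw_cong[THEN iffD1, rotated]) (use a mem in auto)
  then have "defining_forms l (shi_cone l) n (\<lambda>i. a (h i))"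
    unfolding defining_forms_def using a mem by auto
  then show ?thesis by blast
qed

end

theory Submission
  imports Defs
begin

text \<open>
  All lines (dependent triples) of the cone are pairwise disjoint or meet in one point, so the degree 2 part of
  the ideal has the basis \<open>\<partial> e\<^sub>T\<close>, \<open>T\<close> a line, and the kernel is the space of functions \<open>f (h, p, q)\<close>, antisymmetric
  in \<open>p, q\<close>, vanishing unless \<open>p, q\<close> lie on a line, cyclically invariant along lines in \<open>p, q\<close>, and with
  vanishing cyclic sum. The equations only relate triples that span the same flat, and the solutions come from three
  kinds of flats: each of the \<open>C(l,2) + 3 C(l,3)\<close> lines contributes 2 dimensions, each of the \<open>C(l,3)\<close> non-Fano
  configurations on three indices contributes 5, and each of the \<open>4 C(l,4)\<close> balanced complete graphs on four
  indices contributes 2. All other flats of rank three contribute nothing, because there some hyperplane is on no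
  common line with two points of a given line. The total is \<open>2 C(l,2) + 11 C(l,3) + 8 C(l,4)\<close>.
\<close>

section \<open>Dual bases and cocycles\<close>

text \<open>The kernel is never split as a direct sum over flats. Instead the cocycles
  \<open>basis s\<close> and the positions \<open>coord s\<close> are dual to each other, and a
  cocycle that is zero at every \<open>coord s\<close> is zero; the dimension is then the number of
  indices. Lines share at most one point because a parallel class together with \<open>Z\<close> has
  only three members, the gains being 0 and 1, and a balanced triangle has three edges. Hence a
  slice of a cocycle is one scalar per line, and the whole computation concerns scalars attached to
  pairs of a hyperplane h and a line T. The cyclic sums are three-term relations between these
  scalars. A balanced complete graph has one scalar for each of its three matchings and one Bianchi
  relation, which explains the 2; the factor 4 counts the gains of three consecutive edges, whose
  sum is at most 1. The arrangement enters only through its dependent triples, so the choice and the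
  order of the defining forms are absorbed by a transport along a bijection.\<close>

lemma sum_cscale_apply: "(\<Sum>s\<in>S. cscale (c s) (b s)) x = (\<Sum>s\<in>S. c s * b s x)"
  by (induction S rule: infinite_finite_induct) (auto simp: cscale_def)

text \<open>Evaluating a combination at \<open>x t\<close> returns its coefficient at t, which gives
  independence. For spanning, v minus the combination with coefficients \<open>v (x s)\<close>
  vanishes at every \<open>x t\<close>, so \<open>sep\<close> makes it zero.\<close>

lemma dual_basis:
  assumes V: "cfun.subspace V" and fin: "finite S"
    and b: "\<And>s. s \<in> S \<Longrightarrow> b s \<in> V"
    and dual: "\<And>s t. s \<in> S \<Longrightarrow> t \<in> S \<Longrightarrow> b s (x t) = (if s = t then 1 else 0)"
    and sep: "\<And>v. v \<in> V \<Longrightarrow> (\<And>s. s \<in> S \<Longrightarrow> v (x s) = 0) \<Longrightarrow> v = 0"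
  shows "inj_on b S" "cfun.independent (b ` S)" "cfun.span (b ` S) = V"
proof -
  show inj: "inj_on b S"
    by (intro inj_onI) (metis dual zero_neq_one)
  show "cfun.independent (b ` S)"
  proof (rule cfun.independent_if_scalars_zero)
    fix c v assume "(\<Sum>w\<in>b ` S. cscale (c w) w) = 0" and "v \<in> b ` S"
    then obtain t where t: "t \<in> S" "v = b t" and "(\<Sum>s\<in>S. cscale (c (b s)) (b s)) = 0"
      using inj by (auto simp: sum.reindex)
    then have "(\<Sum>s\<in>S. c (b s) * b s (x t)) = 0"
      by (metis sum_cscale_apply zero_fun_apply)
    also have "(\<Sum>s\<in>S. c (b s) * b s (x t)) = (\<Sum>s\<in>S. if s = t then c (b s) else 0)"
      using t by (intro sum.cong) (auto simp: dual)
    finally show "c v = 0" using t fin by simp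
  qed (use fin in simp)
  show "cfun.span (b ` S) = V"
  proof
    show "cfun.span (b ` S) \<subseteq> V" using b V by (intro cfun.span_minimal) auto
    show "V \<subseteq> cfun.span (b ` S)"
    proof
      fix v assume v: "v \<in> V"
      let ?w = "\<Sum>s\<in>S. cscale (v (x s)) (b s)"
      have "?w \<in> V" using V b by (intro cfun.subspace_sum cfun.subspace_scale) auto
      then have "v - ?w \<in> V" using V v by (intro cfun.subspace_diff)
      moreover have "(v - ?w) (x t) = 0" if "t \<in> S" for t
      proof -
        have "?w (x t) = (\<Sum>s\<in>S. if s = t then v (x s) else 0)"
          unfolding sum_cscale_apply using that by (intro sum.cong) (auto simp: dual)
        then show ?thesis using that fin by simp
      qed
      ultimately have "v = ?w" using sep[of "v - ?w"] by simp
      moreover have "?w \<in> cfun.span (b ` S)"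
        by (intro cfun.span_sum cfun.span_scale cfun.span_base) auto
      ultimately show "v \<in> cfun.span (b ` S)" by simp
    qed
  qed
qed

text \<open>The dimension is stated for an injective image because the kernel of
  \<open>wedge_map\<close> consists of tensors over sets of numbers, while the dual basis is built
  on abstract points.\<close>

lemma dim_image_dual_basis:
  assumes "Vector_Spaces.linear cscale cscale F" and "inj_on F V"
    and "cfun.subspace V" and "finite S"
    and "\<And>s. s \<in> S \<Longrightarrow> b s \<in> V"
    and "\<And>s t. s \<in> S \<Longrightarrow> t \<in> S \<Longrightarrow> b s (x t) = (if s = t then 1 else 0)"
    and "\<And>v. v \<in> V \<Longrightarrow> (\<And>s. s \<in> S \<Longrightarrow> v (x s) = 0) \<Longrightarrow> v = 0"
  shows "cfun.dim (F ` V) = card S"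
proof -
  interpret F: Vector_Spaces.linear cscale cscale F by fact
  have B: "inj_on b S" "cfun.independent (b ` S)" "cfun.span (b ` S) = V"
    by (rule dual_basis[of V S b x]; fact)+
  have ind: "cfun.independent (F ` b ` S)"
    by (rule F.independent_injective_image[OF B(2)]) (simp only: B(3) assms(2))
  have sp: "cfun.span (F ` b ` S) = F ` V" by (simp only: F.span_image B(3))
  have "b ` S \<subseteq> V" using assms(5) by blast
  then have "inj_on F (b ` S)" by (rule inj_on_subset[OF assms(2)])
  then have c: "card (F ` b ` S) = card S" using B(1) by (simp add: card_image)
  have "cfun.dim (F ` V) = cfun.dim (F ` b ` S)" by (simp only: cfun.dim_span flip: sp)
  also have "\<dots> = card S" by (simp only: cfun.dim_eq_card_independent[OF ind] c)
  finally show ?thesis .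
qed

text \<open>
  The value \<open>f (h, p, q)\<close> is the coefficient of \<open>e\<^sub>h \<otimes> (e\<^sub>p \<and> e\<^sub>q)\<close>. The last two conditions say that each slice
  \<open>f (h, \<cdot>, \<cdot>)\<close> is a combination of the elements \<open>\<partial> e\<^sub>T\<close>, \<open>T \<in> L\<close>; the cyclic sum in \<open>cocycles\<close> is the
  coefficient of \<open>e\<^sub>h \<and> e\<^sub>p \<and> e\<^sub>q\<close> in the image under multiplication.
\<close>

definition precocycles :: "'a set \<Rightarrow> 'a set set \<Rightarrow> ('a \<times> 'a \<times> 'a \<Rightarrow> complex) set" where
  "precocycles A L = {f.
     (\<forall>h p q. f (h, p, q) \<noteq> 0 \<longrightarrow> h \<in> A \<and> p \<in> A \<and> q \<in> A) \<and>
     (\<forall>h p q. f (h, q, p) = - f (h, p, q)) \<and>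
     (\<forall>h p q. (\<forall>T\<in>L. \<not> {p, q} \<subseteq> T) \<longrightarrow> f (h, p, q) = 0) \<and>
     (\<forall>h p q r. {p, q, r} \<in> L \<longrightarrow> f (h, p, q) = f (h, q, r))}"

definition cocycles :: "'a set \<Rightarrow> 'a set set \<Rightarrow> ('a \<times> 'a \<times> 'a \<Rightarrow> complex) set" where
  "cocycles A L =
     {f \<in> precocycles A L. \<forall>h p q. f (h, p, q) + f (p, q, h) + f (q, h, p) = 0}"

lemma precocyclesI:
  assumes "\<And>h p q. f (h, p, q) \<noteq> 0 \<Longrightarrow> h \<in> A \<and> p \<in> A \<and> q \<in> A"
    and "\<And>h p q. f (h, q, p) = - f (h, p, q)"
    and "\<And>h p q. \<forall>T\<in>L. \<not> {p, q} \<subseteq> T \<Longrightarrow> f (h, p, q) = 0"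
    and "\<And>h p q r. {p, q, r} \<in> L \<Longrightarrow> f (h, p, q) = f (h, q, r)"
  shows "f \<in> precocycles A L"
  unfolding precocycles_def mem_Collect_eq
proof (intro conjI)
  show "\<forall>h p q. f (h, p, q) \<noteq> 0 \<longrightarrow> h \<in> A \<and> p \<in> A \<and> q \<in> A" using assms(1) by simp
  show "\<forall>h p q. f (h, q, p) = - f (h, p, q)" using assms(2) by (intro allI)
  show "\<forall>h p q. (\<forall>T\<in>L. \<not> {p, q} \<subseteq> T) \<longrightarrow> f (h, p, q) = 0" using assms(3) by (intro allI impI)
  show "\<forall>h p q r. {p, q, r} \<in> L \<longrightarrow> f (h, p, q) = f (h, q, r)" using assms(4) by (intro allI impI)
qed

lemma precocyclesD:
  assumes "f \<in> precocycles A L"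
  shows "f (h, p, q) \<noteq> 0 \<Longrightarrow> h \<in> A \<and> p \<in> A \<and> q \<in> A"
    and "f (h, q, p) = - f (h, p, q)"
    and "\<forall>T\<in>L. \<not> {p, q} \<subseteq> T \<Longrightarrow> f (h, p, q) = 0"
    and "{p, q, r} \<in> L \<Longrightarrow> f (h, p, q) = f (h, q, r)"
proof -
  note * = assms[unfolded precocycles_def mem_Collect_eq]
  show "f (h, p, q) \<noteq> 0 \<Longrightarrow> h \<in> A \<and> p \<in> A \<and> q \<in> A" by (rule *[THEN conjunct1, rule_format])
  show "f (h, q, p) = - f (h, p, q)" by (rule *[THEN conjunct2, THEN conjunct1, rule_format])
  show "\<forall>T\<in>L. \<not> {p, q} \<subseteq> T \<Longrightarrow> f (h, p, q) = 0"
    using *[THEN conjunct2, THEN conjunct2, THEN conjunct1] by blast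
  show "{p, q, r} \<in> L \<Longrightarrow> f (h, p, q) = f (h, q, r)"
    by (rule *[THEN conjunct2, THEN conjunct2, THEN conjunct2, rule_format])
qed

lemma subspace_precocycles: "cfun.subspace (precocycles A L)"
proof (unfold cfun.subspace_def, intro conjI ballI allI)
  show "0 \<in> precocycles A L" by (rule precocyclesI) simp_all
next
  fix f g assume f: "f \<in> precocycles A L" and g: "g \<in> precocycles A L"
  show "f + g \<in> precocycles A L"
  proof (rule precocyclesI)
    fix h p q assume "(f + g) (h, p, q) \<noteq> 0"
    then have "f (h, p, q) \<noteq> 0 \<or> g (h, p, q) \<noteq> 0" by auto
    then show "h \<in> A \<and> p \<in> A \<and> q \<in> A" using precocyclesD(1)[OF f] precocyclesD(1)[OF g] by blast
  next
    fix h p q show "(f + g) (h, q, p) = - (f + g) (h, p, q)"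
      using precocyclesD(2)[OF f, of h q p] precocyclesD(2)[OF g, of h q p] by simp
  next
    fix h p q assume "\<forall>T\<in>L. \<not> {p, q} \<subseteq> T"
    then show "(f + g) (h, p, q) = 0" using precocyclesD(3)[OF f] precocyclesD(3)[OF g] by simp
  next
    fix h p q r assume "{p, q, r} \<in> L"
    then show "(f + g) (h, p, q) = (f + g) (h, q, r)"
      using precocyclesD(4)[OF f, of p q r] precocyclesD(4)[OF g, of p q r] by simp
  qed
next
  fix c f assume f: "f \<in> precocycles A L"
  show "cscale c f \<in> precocycles A L"
  proof (rule precocyclesI)
    fix h p q assume "cscale c f (h, p, q) \<noteq> 0"
    then show "h \<in> A \<and> p \<in> A \<and> q \<in> A" using precocyclesD(1)[OF f, of h p q] by (simp add: cscale_def)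
  next
    fix h p q show "cscale c f (h, q, p) = - cscale c f (h, p, q)"
      using precocyclesD(2)[OF f, of h q p] by (simp add: cscale_def)
  next
    fix h p q assume "\<forall>T\<in>L. \<not> {p, q} \<subseteq> T"
    then show "cscale c f (h, p, q) = 0" using precocyclesD(3)[OF f] by (simp add: cscale_def)
  next
    fix h p q r assume "{p, q, r} \<in> L"
    then show "cscale c f (h, p, q) = cscale c f (h, q, r)"
      using precocyclesD(4)[OF f, of p q r] by (simp add: cscale_def)
  qed
qed

lemma subspace_cocycles: "cfun.subspace (cocycles A L)"
proof -
  have "cfun.subspace {f :: 'a \<times> 'a \<times> 'a \<Rightarrow> complex. \<forall>h p q. f (h, p, q) + f (p, q, h) + f (q, h, p) = 0}"
    (is "cfun.subspace ?Z")
  proof (unfold cfun.subspace_def, intro conjI ballI allI)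
    show "0 \<in> ?Z" by simp
  next
    fix f g assume fg: "f \<in> ?Z" "g \<in> ?Z"
    have "(f + g) (h, p, q) + (f + g) (p, q, h) + (f + g) (q, h, p) =
        (f (h, p, q) + f (p, q, h) + f (q, h, p)) + (g (h, p, q) + g (p, q, h) + g (q, h, p))" for h p q
      by simp
    then show "f + g \<in> ?Z" using fg by (simp del: plus_fun_apply)
  next
    fix c f assume "f \<in> ?Z"
    then show "cscale c f \<in> ?Z" by (simp add: cscale_def distrib_left[symmetric])
  qed
  then have "cfun.subspace (precocycles A L \<inter> {f. \<forall>h p q. f (h, p, q) + f (p, q, h) + f (q, h, p) = 0})"
    by (intro cfun.subspace_inter subspace_precocycles)
  then show ?thesis unfolding cocycles_def by (simp add: Int_def)
qed

text \<open>
  The tensor \<open>e\<^bsub>h0\<^esub> \<otimes> \<partial> (e\<^sub>x \<and> e\<^sub>y \<and> e\<^sub>z)\<close>.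
\<close>

definition elem :: "'a \<Rightarrow> 'a \<Rightarrow> 'a \<Rightarrow> 'a \<Rightarrow> 'a \<times> 'a \<times> 'a \<Rightarrow> complex" where
  "elem x y z h0 = (\<lambda>(h, p, q). if h = h0
     then of_bool ((p, q) \<in> {(x, y), (y, z), (z, x)}) - of_bool ((q, p) \<in> {(x, y), (y, z), (z, x)})
     else 0)"

lemma elem_eq_0:
  assumes "h \<noteq> h0 \<or> \<not> {p, q} \<subseteq> {x, y, z}"
  shows "elem x y z h0 (h, p, q) = 0"
proof (cases "h = h0")
  case True
  then have "(p, q) \<notin> {(x, y), (y, z), (z, x)}" "(q, p) \<notin> {(x, y), (y, z), (z, x)}"
    using assms by blast+
  then show ?thesis by (simp only: elem_def prod.case of_bool_eq if_cancel diff_self)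
qed (simp add: elem_def)

lemma elem_swap: "elem x y z h0 (h, q, p) = - elem x y z h0 (h, p, q)"
  by (simp only: elem_def prod.case) simp

locale line_space =
  fixes A :: "'a set" and L :: "'a set set"
  assumes line_subset: "T \<in> L \<Longrightarrow> T \<subseteq> A"
    and card_line: "T \<in> L \<Longrightarrow> card T = 3"
    and line_unique: "T \<in> L \<Longrightarrow> T' \<in> L \<Longrightarrow> p \<noteq> q \<Longrightarrow> {p, q} \<subseteq> T \<Longrightarrow> {p, q} \<subseteq> T' \<Longrightarrow> T = T'"
begin

lemma line_distinct: "{x, y, z} \<in> L \<Longrightarrow> x \<noteq> y \<and> y \<noteq> z \<and> x \<noteq> z"
  using card_line[of "{x, y, z}"] by (auto simp: card_insert_if split: if_splits)

lemma elem_precocycle: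
  assumes T: "{x, y, z} \<in> L" and h: "h0 \<in> A"
  shows "elem x y z h0 \<in> precocycles A L"
proof -
  note d = line_distinct[OF T]
  have A: "x \<in> A" "y \<in> A" "z \<in> A" using line_subset[OF T] by auto
  have "elem x y z h0 (h, p, q) = elem x y z h0 (h, q, r)" if "{p, q, r} \<in> L" for h p q r
  proof (cases "{p, q, r} = {x, y, z}")
    case True
    note e = line_distinct[OF that]
    have "p \<in> {x, y, z}" "q \<in> {x, y, z}" "r \<in> {x, y, z}" using True by blast+
    then consider "p = x" "q = y" "r = z" | "p = x" "q = z" "r = y" | "p = y" "q = x" "r = z"
      | "p = y" "q = z" "r = x" | "p = z" "q = x" "r = y" | "p = z" "q = y" "r = x"
      using e by auto
    then show ?thesis using d by cases (auto simp: elem_def)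
  next
    case False
    \<comment> \<open>Distinct lines share at most one point, so no pair from {p, q, r} lies in {x,
      y, z} and both values are 0.\<close>
    have *: "\<not> {u, v} \<subseteq> {x, y, z}" if "u \<noteq> v" "{u, v} \<subseteq> {p, q, r}" for u v
      using line_unique[OF T \<open>{p, q, r} \<in> L\<close> that(1)] that False by auto
    note e = line_distinct[OF that]
    have "\<not> {p, q} \<subseteq> {x, y, z}" "\<not> {q, r} \<subseteq> {x, y, z}" using * e by auto
    then have "elem x y z h0 (h, p, q) = 0" "elem x y z h0 (h, q, r) = 0" by (simp_all add: elem_eq_0 del: insert_subset)
    then show ?thesis by simp
  qed
  moreover have "elem x y z h0 (h, p, q) = 0" if "\<forall>T\<in>L. \<not> {p, q} \<subseteq> T" for h p q
  proof -
    have "\<not> {p, q} \<subseteq> {x, y, z}" using that T by blast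
    then show ?thesis by (simp add: elem_eq_0 del: insert_subset)
  qed
  moreover have "elem x y z h0 (h, q, p) = - elem x y z h0 (h, p, q)" for h p q
    by (rule elem_swap)
  moreover have "h \<in> A \<and> p \<in> A \<and> q \<in> A" if "elem x y z h0 (h, p, q) \<noteq> 0" for h p q
  proof -
    have "h = h0" "p \<in> {x, y, z}" "q \<in> {x, y, z}" 
      using that elem_eq_0[of h h0 p q x y z] by (simp_all only: insert_subset) blast+
    then show ?thesis using A h by blast
  qed
  ultimately show ?thesis by (intro precocyclesI)
qed

text \<open>The boundary of e_x e_y e_z factors as (e_x - e_y)(e_y - e_z), so multiplication by e_x
  - e_z or by e_y - e_z kills it.\<close>

lemma local_cocycle:
  assumes T: "{x, y, z} \<in> L"
  shows "elem x y z x - elem x y z z \<in> cocycles A L" "elem x y z y - elem x y z z \<in> cocycles A L"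
proof -
  have A: "x \<in> A" "y \<in> A" "z \<in> A" using line_subset[OF T] by auto
  note d = line_distinct[OF T]
  have "elem x y z x - elem x y z z \<in> precocycles A L" "elem x y z y - elem x y z z \<in> precocycles A L"
    using A T by (auto intro!: cfun.subspace_diff subspace_precocycles elem_precocycle)
  moreover have "(elem x y z w - elem x y z z) (h, p, q) + (elem x y z w - elem x y z z) (p, q, h)
      + (elem x y z w - elem x y z z) (q, h, p) = 0" if w: "w = x \<or> w = y" for h p q w
  proof (cases "h \<in> {x, y, z} \<and> p \<in> {x, y, z} \<and> q \<in> {x, y, z}")
    case True
    then show ?thesis using d w by (elim conjE insertE emptyE disjE) (auto simp: elem_def)
  next
    case False
    then consider "h \<notin> {x, y, z}" | "p \<notin> {x, y, z}" | "q \<notin> {x, y, z}" by blast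
    then show ?thesis using w by cases (auto simp: elem_eq_0)
  qed
  ultimately show "elem x y z x - elem x y z z \<in> cocycles A L" "elem x y z y - elem x y z z \<in> cocycles A L"
    unfolding cocycles_def by blast+
qed

end

text \<open>
  Think of \<open>a, \<dots>, f\<close> as the edges 12, 13, 14, 23, 24, 34 of a complete graph whose triangles are lines. On
  such a configuration the values \<open>R v w x y = f (vw, wx, xy)\<close> of a cocycle that vanishes on the lines
  themselves have the symmetries of a curvature tensor, so there is one parameter for each of the three
  perfect matchings, and the first Bianchi identity makes their sum vanish. Below is the part belonging to
  the matching 12, 34; differences of two matchings are cocycles.
\<close>

definition matching :: "'a \<Rightarrow> 'a \<Rightarrow> 'a \<Rightarrow> 'a \<Rightarrow> 'a \<Rightarrow> 'a \<Rightarrow> 'a \<times> 'a \<times> 'a \<Rightarrow> complex" where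
  "matching a b c d e f = elem d f e a - elem b f c a + elem c a e f - elem b a d f"

lemma matching_eq_0:
  assumes "\<not> {h, p, q} \<subseteq> {a, b, c, d, e, f}"
  shows "matching a b c d e f (h, p, q) = 0"
proof -
  have "elem x y z w (h, p, q) = 0" if "{x, y, z, w} \<subseteq> {a, b, c, d, e, f}" for x y z w
    by (rule elem_eq_0) (use that assms in blast)
  then show ?thesis by (simp add: matching_def)
qed

lemma matching_other:
  assumes "h \<noteq> a" "h \<noteq> f"
  shows "matching a b c d e f (h, p, q) = 0"
  using assms by (simp add: matching_def elem_eq_0)

definition k4 :: "'a set set \<Rightarrow> 'a \<Rightarrow> 'a \<Rightarrow> 'a \<Rightarrow> 'a \<Rightarrow> 'a \<Rightarrow> 'a \<Rightarrow> bool" where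
  "k4 L a b c d e f \<longleftrightarrow> distinct [a, b, c, d, e, f] \<and>
     {a, b, d} \<in> L \<and> {a, c, e} \<in> L \<and> {b, c, f} \<in> L \<and> {d, e, f} \<in> L"

text \<open>The relabelling 2 -> 3 -> 4 -> 2 of the vertices, which permutes the three matchings
  cyclically: \<open>matching b c a f d e\<close> belongs to 13, 24 and
  \<open>matching c a b e f d\<close> to 14, 23.\<close>

lemma k4_rotate: "k4 L a b c d e f \<Longrightarrow> k4 L b c a f d e"
  unfolding k4_def by (auto simp: insert_commute)

lemma matching_diff_cyclic_sum:
  fixes a b c d e f :: 'a
  assumes d: "distinct [a, b, c, d, e, f]"
  defines "g \<equiv> matching a b c d e f - matching b c a f d e"
  shows "g (h, p, q) + g (p, q, h) + g (q, h, p) = 0"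
proof (cases "{h, p, q} \<subseteq> {a, b, c, d, e, f}")
  case True
  have D: "a \<noteq> b" "a \<noteq> c" "a \<noteq> d" "a \<noteq> e" "a \<noteq> f" "b \<noteq> c" "b \<noteq> d" "b \<noteq> e" "b \<noteq> f"
    "c \<noteq> d" "c \<noteq> e" "c \<noteq> f" "d \<noteq> e" "d \<noteq> f" "e \<noteq> f" using d by simp_all
  note D' = D D[symmetric]
  have "h \<in> {a, b, c, d, e, f}" "p \<in> {a, b, c, d, e, f}" "q \<in> {a, b, c, d, e, f}"
    using True by simp_all
  \<comment> \<open>Only equalities among six distinct points matter, so the 216 triples are
    evaluated one by one.\<close>
  then show ?thesis
    by (elim insertE emptyE; simp add: g_def matching_def elem_def D')
next
  case False
  have "x \<notin> {b, c, a, f, d, e}" if "x \<notin> {a, b, c, d, e, f}" for x using that by blast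
  then have "\<not> {u, v, w} \<subseteq> {a, b, c, d, e, f} \<and> \<not> {u, v, w} \<subseteq> {b, c, a, f, d, e}"
    if "{u, v, w} = {h, p, q}" for u v w
    unfolding that using False by blast
  then have "g (u, v, w) = 0" if "{u, v, w} = {h, p, q}" for u v w
    using that by (simp add: g_def matching_eq_0 del: insert_subset)
  then show ?thesis by (simp add: insert_commute)
qed

text \<open>A slice of a precocycle restricted to a line is a multiple of the boundary element of
  that line, so each pair of \<open>h\<close> and \<open>T\<close> carries one scalar; this says
  that the scalar is 0.\<close>

definition vanishes_on :: "('a \<times> 'a \<times> 'a \<Rightarrow> complex) \<Rightarrow> 'a \<Rightarrow> 'a set \<Rightarrow> bool" where
  "vanishes_on f h T \<longleftrightarrow> (\<forall>p\<in>T. \<forall>q\<in>T. f (h, p, q) = 0)"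

lemma vanishes_onD: "vanishes_on f h T \<Longrightarrow> p \<in> T \<Longrightarrow> q \<in> T \<Longrightarrow> f (h, p, q) = 0"
  by (simp add: vanishes_on_def)

lemma cocycles_sum_0: "f \<in> cocycles A L \<Longrightarrow> f (h, p, q) + f (p, q, h) + f (q, h, p) = 0"
  unfolding cocycles_def by blast

lemma cocyclesI:
  assumes "f \<in> precocycles A L" "\<And>h p q. f (h, p, q) + f (p, q, h) + f (q, h, p) = 0"
  shows "f \<in> cocycles A L"
  unfolding cocycles_def mem_Collect_eq using assms by (intro conjI allI)

lemma cocycles_precocycles: "f \<in> cocycles A L \<Longrightarrow> f \<in> precocycles A L"
  unfolding cocycles_def by blast

definition apart :: "'a set set \<Rightarrow> 'a \<Rightarrow> 'a \<Rightarrow> bool" where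
  "apart L p q \<longleftrightarrow> (\<forall>T\<in>L. \<not> {p, q} \<subseteq> T)"

lemma apart_commute: "apart L p q \<longleftrightarrow> apart L q p"
  unfolding apart_def by (simp add: insert_commute)

section \<open>Propagation of zeros through lines, complete graphs and quadrangles\<close>

context line_space
begin

lemma matching_precocycle:
  assumes "k4 L a b c d e f"
  shows "matching a b c d e f \<in> precocycles A L"
proof -
  have l: "{d, f, e} \<in> L" "{b, f, c} \<in> L" "{c, a, e} \<in> L" "{b, a, d} \<in> L"
    using assms by (simp_all add: k4_def insert_commute)
  then have "a \<in> A" "f \<in> A" using line_subset by blast+
  then show ?thesis unfolding matching_def
    by (intro cfun.subspace_diff cfun.subspace_add subspace_precocycles elem_precocycle l)
qed

lemma matching_diff_cocycle:
  assumes "k4 L a b c d e f"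
  shows "matching a b c d e f - matching b c a f d e \<in> cocycles A L"
proof -
  have "matching a b c d e f - matching b c a f d e \<in> precocycles A L"
    by (intro cfun.subspace_diff subspace_precocycles matching_precocycle assms k4_rotate[OF assms])
  moreover have "distinct [a, b, c, d, e, f]" using assms by (simp add: k4_def)
  ultimately show ?thesis by (intro cocyclesI matching_diff_cyclic_sum)
qed

lemma matching_diff_cocycle':
  assumes "k4 L a b c d e f"
  shows "matching c a b e f d - matching b c a f d e \<in> cocycles A L"
proof -
  have "- (matching b c a f d e - matching c a b e f d) \<in> cocycles A L"
    using matching_diff_cocycle[OF k4_rotate[OF assms]]
    by (intro cfun.subspace_neg subspace_cocycles)
  then show ?thesis by simp
qed

context
  fixes f assumes f: "f \<in> cocycles A L"
begin

lemmas pre = precocyclesD[OF cocycles_precocycles[OF f]]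

lemma diag_0: "f (h, p, p) = 0"
  using pre(2)[of h p p] by simp

text \<open>Cyclic invariance and antisymmetry equate, up to sign, the values at all pairs of
  distinct points of T, so a single zero suffices.\<close>

lemma vanishes_onI:
  assumes T: "T \<in> L" and pq: "p \<in> T" "q \<in> T" "p \<noteq> q" "f (h, p, q) = 0"
  shows "vanishes_on f h T"
proof -
  have "card (T - {p, q}) = 1" using card_line[OF T] pq by (simp add: card_Diff_subset)
  then obtain r where "T - {p, q} = {r}" by (auto simp: card_1_singleton_iff)
  then have r: "T = {p, q, r}" using pq by blast
  have "f (h, q, r) = f (h, p, q)" using pre(4)[of p q r h] T r by simp
  moreover have "f (h, r, p) = f (h, q, r)" using pre(4)[of q r p h] T r by (simp add: insert_commute)
  ultimately have "f (h, p, q) = 0" "f (h, q, r) = 0" "f (h, r, p) = 0" using pq by auto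
  moreover from this have "f (h, q, p) = 0" "f (h, r, q) = 0" "f (h, p, r) = 0"
    using pre(2)[of h q p] pre(2)[of h r q] pre(2)[of h p r] by auto
  ultimately show ?thesis unfolding r vanishes_on_def by (simp add: diag_0)
qed

lemma apart_0: "apart L p q \<Longrightarrow> f (h, p, q) = 0"
  unfolding apart_def by (rule pre(3))

text \<open>In the cyclic sum of h, p, q the other two terms carry the pairs (q, h) and (h, p),
  which lie on no line.\<close>

lemma vanishes_apart2:
  assumes "T \<in> L" "p \<in> T" "q \<in> T" "p \<noteq> q" "apart L h p" "apart L h q"
  shows "vanishes_on f h T"
proof -
  have "f (p, q, h) = 0" "f (q, h, p) = 0" using assms apart_0 apart_commute by metis+
  then show ?thesis using cocycles_sum_0[OF f, of h p q] assms by (auto intro: vanishes_onI)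
qed

text \<open>In the cyclic sum of d, d', x the term with the pair (d, d') is zero, so the scalars of
  (d, T) and (d', T') agree up to sign and a zero passes from one to the other.\<close>

lemma vanishes_apart:
  assumes "apart L d d'" "vanishes_on f d T" "x \<in> T" "d' \<in> T" "T' \<in> L" "x \<in> T'" "d \<in> T'" "x \<noteq> d"
  shows "vanishes_on f d' T'"
proof -
  have "f (d, d', x) = 0" "f (x, d, d') = 0" using assms vanishes_onD apart_0 by metis+
  then have "f (d', x, d) = 0" using cocycles_sum_0[OF f, of d d' x] by simp
  then show ?thesis using assms by (auto intro: vanishes_onI)
qed

text \<open>The relation for pairwise joined points x, y, d: each contributes one scalar, and two
  zeros force the third.\<close>

lemma vanishes_cyclic:
  assumes "vanishes_on f x T" "y \<in> T" "d \<in> T" "vanishes_on f d T2" "x \<in> T2" "y \<in> T2"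
    and "T' \<in> L" "x \<in> T'" "d \<in> T'" "x \<noteq> d"
  shows "vanishes_on f y T'"
proof -
  have "f (x, y, d) = 0" "f (d, x, y) = 0" using assms vanishes_onD by metis+
  then have "f (y, d, x) = 0" using cocycles_sum_0[OF f, of x y d] by simp
  then show ?thesis using assms by (auto intro: vanishes_onI)
qed

text \<open>Here x and y are opposite edges of a complete graph. The scalars of x on the two lines
  through y and of y on the two lines through x are linked in a cycle by
  \<open>vanishes_apart\<close>, so one zero travels round.\<close>

lemma matching_vanishes:
  assumes "apart L x y" "{x, p, p'} \<in> L" "{x, q, q'} \<in> L" "{y, p, q} \<in> L" "{y, p', q'} \<in> L"
    and "vanishes_on f x {y, p', q'}"
  shows "vanishes_on f x {y, p, q}" "vanishes_on f y {x, p, p'}" "vanishes_on f y {x, q, q'}"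
proof -
  note d = line_distinct[OF assms(2)] line_distinct[OF assms(3)] line_distinct[OF assms(4)]
    line_distinct[OF assms(5)]
  have a: "apart L y x" using assms(1) apart_commute by metis
  show 1: "vanishes_on f y {x, p, p'}"
    by (rule vanishes_apart[OF assms(1,6), of p']) (use assms(2) d in auto)
  show "vanishes_on f y {x, q, q'}"
    by (rule vanishes_apart[OF assms(1,6), of q']) (use assms(3) d in auto)
  show "vanishes_on f x {y, p, q}"
    by (rule vanishes_apart[OF a 1, of p]) (use assms(4) d in auto)
qed

text \<open>There are twelve pairs of an edge and a triangle not containing it, four for each
  matching. The two assumptions in \<open>0\<close> kill two matchings, and the Bianchi relation
  kills the third.\<close>

lemma k4_vanishes:
  assumes k: "k4 L a b c d e g" and ap: "apart L a g" "apart L b e" "apart L c d"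
    and 0: "f (a, d, g) = 0" "f (d, c, a) = 0"
  shows "vanishes_on f a {b, c, g}" "vanishes_on f a {d, e, g}"
    "vanishes_on f g {a, b, d}" "vanishes_on f g {a, c, e}"
    "vanishes_on f b {a, c, e}" "vanishes_on f b {d, e, g}"
    "vanishes_on f e {a, b, d}" "vanishes_on f e {b, c, g}"
    "vanishes_on f c {a, b, d}" "vanishes_on f c {d, e, g}"
    "vanishes_on f d {a, c, e}" "vanishes_on f d {b, c, g}"
proof -
  have D: "a \<noteq> b" "a \<noteq> c" "a \<noteq> d" "a \<noteq> e" "a \<noteq> g" "b \<noteq> c" "b \<noteq> d" "b \<noteq> e" "b \<noteq> g"
    "c \<noteq> d" "c \<noteq> e" "c \<noteq> g" "d \<noteq> e" "d \<noteq> g" "e \<noteq> g" using k by (simp_all add: k4_def)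
  have l: "{a, b, d} \<in> L" "{a, c, e} \<in> L" "{b, c, g} \<in> L" "{d, e, g} \<in> L"
    using k by (simp_all add: k4_def)
  have ap': "apart L d c" using ap apart_commute by metis
  have a1: "vanishes_on f a {g, d, e}"
    by (rule vanishes_onI[OF _ _ _ D(14) 0(1)]) (use l in \<open>simp_all add: insert_commute\<close>)
  note A = matching_vanishes[OF ap(1) _ _ _ _ a1, of b c]
  have A: "vanishes_on f a {b, c, g}" "vanishes_on f g {a, b, d}" "vanishes_on f g {a, c, e}"
    using A l by (simp_all add: insert_commute)
  have d1: "vanishes_on f d {c, a, e}"
    by (rule vanishes_onI[OF _ _ _ D(2)[symmetric] 0(2)]) (use l in \<open>simp_all add: insert_commute\<close>)
  note DD = matching_vanishes[OF ap' _ _ _ _ d1, of b g]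
  have DD: "vanishes_on f d {b, c, g}" "vanishes_on f c {a, b, d}" "vanishes_on f c {d, e, g}"
    using DD l by (simp_all add: insert_commute)
  \<comment> \<open>The edges a, b, c meet in vertex 1, and the three terms of their cyclic sum
    belong to the three different matchings.\<close>
  have "f (a, b, c) = 0" "f (c, a, b) = 0" using A(1) DD(2) by (simp_all add: vanishes_on_def)
  then have "f (b, c, a) = 0" using cocycles_sum_0[OF f, of a b c] by simp
  then have b1: "vanishes_on f b {e, a, c}"
    by (intro vanishes_onI[OF _ _ _ D(2)[symmetric]]) (use l in \<open>simp_all add: insert_commute\<close>)
  note B = matching_vanishes[OF ap(2) _ _ _ _ b1, of d g]
  have B: "vanishes_on f b {d, e, g}" "vanishes_on f e {a, b, d}" "vanishes_on f e {b, c, g}"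
    using B l by (simp_all add: insert_commute)
  show "vanishes_on f a {b, c, g}" "vanishes_on f a {d, e, g}"
    "vanishes_on f g {a, b, d}" "vanishes_on f g {a, c, e}"
    "vanishes_on f b {a, c, e}" "vanishes_on f b {d, e, g}"
    "vanishes_on f e {a, b, d}" "vanishes_on f e {b, c, g}"
    "vanishes_on f c {a, b, d}" "vanishes_on f c {d, e, g}"
    "vanishes_on f d {a, c, e}" "vanishes_on f d {b, c, g}"
    using A B DD a1 b1 d1 by (simp_all add: insert_commute)
qed

end

end

text \<open>
  A complete quadrangle \<open>z, a, c, e\<close> with its diagonal points \<open>p, q, r\<close>: this is the configuration formed by
  \<open>Z\<close> and the six hyperplanes on three indices.
\<close>

definition nonfano :: "'a set set \<Rightarrow> 'a \<Rightarrow> 'a \<Rightarrow> 'a \<Rightarrow> 'a \<Rightarrow> 'a \<Rightarrow> 'a \<Rightarrow> 'a \<Rightarrow> bool" where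
  "nonfano L z a c e p q r \<longleftrightarrow> distinct [z, a, c, e, p, q, r] \<and>
     {z, a, p} \<in> L \<and> {z, c, q} \<in> L \<and> {z, e, r} \<in> L \<and>
     {a, c, r} \<in> L \<and> {c, e, p} \<in> L \<and> {a, e, q} \<in> L \<and>
     apart L p q \<and> apart L p r \<and> apart L q r"

context line_space
begin

text \<open>The three scalars of a line at its own points satisfy the relation given by the cyclic
  sum, so two of them determine the third.\<close>

lemma local_vanishes:
  assumes f: "f \<in> cocycles A L" and T: "{x, y, z} \<in> L"
    and 0: "f (x, x, y) = 0" "f (y, x, y) = 0" and h: "h \<in> {x, y, z}"
  shows "vanishes_on f h {x, y, z}"
proof -
  have d: "x \<noteq> y" using line_distinct[OF T] by simp
  have 1: "vanishes_on f x {x, y, z}" by (rule vanishes_onI[OF f T _ _ d 0(1)]) auto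
  have 2: "vanishes_on f y {x, y, z}" by (rule vanishes_onI[OF f T _ _ d 0(2)]) auto
  have "f (x, y, z) = 0" "f (y, z, x) = 0" using 1 2 by (simp_all add: vanishes_on_def)
  then have "f (z, x, y) = 0" using cocycles_sum_0[OF f, of x y z] by simp
  then have "vanishes_on f z {x, y, z}" by (intro vanishes_onI[OF f T _ _ d]) auto
  then show ?thesis using 1 2 h by auto
qed

text \<open>The conclusion lists all 24 pairs of a point and a line not through it. Twelve start at
  a diagonal point and split into three cycles of four, one for each pair of diagonal points; the
  other twelve start at a vertex of the quadrangle. Three of the assumptions in \<open>0\<close>
  serve the cycles and two serve the vertex \<open>z\<close>.\<close>

lemma nonfano_vanishes:
  assumes f: "f \<in> cocycles A L" and n: "nonfano L z a c e p q r"
    and 0: "f (z, q, a) = 0" "f (q, r, z) = 0" "f (z, p, c) = 0" "f (p, r, z) = 0" "f (q, p, z) = 0"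
  shows "vanishes_on f q {z, e, r}" "vanishes_on f q {a, c, r}" "vanishes_on f q {z, a, p}"
    "vanishes_on f q {c, e, p}" "vanishes_on f p {z, e, r}" "vanishes_on f p {a, c, r}"
    "vanishes_on f p {z, c, q}" "vanishes_on f p {a, e, q}" "vanishes_on f r {z, a, p}"
    "vanishes_on f r {z, c, q}" "vanishes_on f r {c, e, p}" "vanishes_on f r {a, e, q}"
    "vanishes_on f z {a, e, q}" "vanishes_on f z {c, e, p}" "vanishes_on f z {a, c, r}"
    "vanishes_on f a {z, c, q}" "vanishes_on f a {c, e, p}" "vanishes_on f a {z, e, r}"
    "vanishes_on f c {a, e, q}" "vanishes_on f c {z, a, p}" "vanishes_on f c {z, e, r}"
    "vanishes_on f e {z, c, q}" "vanishes_on f e {z, a, p}" "vanishes_on f e {a, c, r}"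
proof -
  have D: "z \<noteq> a" "z \<noteq> c" "z \<noteq> e" "z \<noteq> p" "z \<noteq> q" "z \<noteq> r" "a \<noteq> c" "a \<noteq> e" "a \<noteq> p" "a \<noteq> q" "a \<noteq> r"
    "c \<noteq> e" "c \<noteq> p" "c \<noteq> q" "c \<noteq> r" "e \<noteq> p" "e \<noteq> q" "e \<noteq> r" "p \<noteq> q" "p \<noteq> r" "q \<noteq> r"
    using n by (simp_all add: nonfano_def)
  have l: "{z, a, p} \<in> L" "{z, c, q} \<in> L" "{z, e, r} \<in> L" "{a, c, r} \<in> L" "{c, e, p} \<in> L" "{a, e, q} \<in> L"
    using n by (simp_all add: nonfano_def)
  have ap: "apart L p q" "apart L p r" "apart L q r" using n by (simp_all add: nonfano_def)
  note ap' = ap ap[unfolded apart_commute[of L p] apart_commute[of L q r]]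
  note i = vanishes_onI[OF f] and va = vanishes_apart[OF f] and vc = vanishes_cyclic[OF f]
  show p1: "vanishes_on f q {z, e, r}" by (rule i[OF l(3) _ _ D(6)[symmetric] 0(2)]) auto
  show q1: "vanishes_on f p {z, e, r}" by (rule i[OF l(3) _ _ D(6)[symmetric] 0(4)]) auto
  show r1: "vanishes_on f q {z, a, p}" by (rule i[OF l(1) _ _ D(4)[symmetric] 0(5)]) auto
  show zq: "vanishes_on f z {a, e, q}" by (rule i[OF l(6) _ _ D(10)[symmetric] 0(1)]) auto
  show zp: "vanishes_on f z {c, e, p}" by (rule i[OF l(5) _ _ D(13)[symmetric] 0(3)]) auto
  \<comment> \<open>\<open>vanishes_apart\<close> now completes the three cycles: q with r, then p
    with r, then p with q.\<close>
  show p2: "vanishes_on f r {z, c, q}" by (rule va[OF ap'(3) p1 _ _ l(2), of z]) (use D in auto)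
  show p3: "vanishes_on f r {a, e, q}" by (rule va[OF ap'(3) p1 _ _ l(6), of e]) (use D in auto)
  show p4: "vanishes_on f q {a, c, r}" by (rule va[OF ap'(6) p3 _ _ l(4), of a]) (use D in auto)
  show q2: "vanishes_on f r {z, a, p}" by (rule va[OF ap'(2) q1 _ _ l(1), of z]) (use D in auto)
  show q3: "vanishes_on f r {c, e, p}" by (rule va[OF ap'(2) q1 _ _ l(5), of e]) (use D in auto)
  show q4: "vanishes_on f p {a, c, r}" by (rule va[OF ap'(5) q2 _ _ l(4), of a]) (use D in auto)
  show r2: "vanishes_on f p {z, c, q}" by (rule va[OF ap'(4) r1 _ _ l(2), of z]) (use D in auto)
  show r3: "vanishes_on f p {a, e, q}" by (rule va[OF ap'(4) r1 _ _ l(6), of a]) (use D in auto)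
  show r4: "vanishes_on f q {c, e, p}" by (rule va[OF ap'(1) r2 _ _ l(5), of c]) (use D in auto)
  \<comment> \<open>Two vertices of the quadrangle are always joined by a line, so from here zeros
    pass through relations in which two of three terms are known. The start is given by the two
    zeros at \<open>z\<close> and the completed cycles.\<close>
  show aq: "vanishes_on f a {z, c, q}" by (rule vc[OF zq _ _ r1 _ _ l(2)]) (use D in auto)
  show eq: "vanishes_on f e {z, c, q}" by (rule vc[OF zq _ _ p1 _ _ l(2)]) (use D in auto)
  show cq: "vanishes_on f c {a, e, q}" by (rule vc[OF aq _ _ p4 _ _ l(6)]) (use D in auto)
  show cp: "vanishes_on f c {z, a, p}" by (rule vc[OF zp _ _ r2 _ _ l(1)]) (use D in auto)
  show ep: "vanishes_on f e {z, a, p}" by (rule vc[OF zp _ _ q1 _ _ l(1)]) (use D in auto)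
  show "vanishes_on f a {c, e, p}" by (rule vc[OF cp _ _ q4 _ _ l(5)]) (use D in auto)
  have "f (a, c, z) = 0" "f (c, z, a) = 0" using aq cp by (simp_all add: vanishes_on_def)
  then have "f (z, a, c) = 0" using cocycles_sum_0[OF f, of z a c] by simp
  then show zr: "vanishes_on f z {a, c, r}" by (intro i[OF l(4) _ _ D(7)]) auto
  show ar: "vanishes_on f a {z, e, r}" by (rule vc[OF zr _ _ q2 _ _ l(3)]) (use D in auto)
  show "vanishes_on f c {z, e, r}" by (rule vc[OF zr _ _ p2 _ _ l(3)]) (use D in auto)
  show "vanishes_on f e {a, c, r}" by (rule vc[OF ar _ _ p3 _ _ l(4)]) (use D in auto)
qed

end

section \<open>The lines of the cone of the Shi arrangement\<close>

text \<open>
  \<open>Z\<close> stands for the hyperplane \<open>x\<^sub>0 = 0\<close> and \<open>E i j g\<close> for \<open>x\<^sub>i - x\<^sub>j = g x\<^sub>0\<close>, where \<open>i < j\<close> and \<open>g \<le> 1\<close>.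
  Lines are the dependent triples.
\<close>

datatype pt = Z | E nat nat nat

definition shi_points :: "nat \<Rightarrow> pt set" where
  "shi_points l = insert Z {E i j g | i j g. 1 \<le> i \<and> i < j \<and> j \<le> l \<and> g \<le> 1}"

definition shi_lines :: "nat \<Rightarrow> pt set set" where
  "shi_lines l = {{Z, E i j 0, E i j 1} | i j. 1 \<le> i \<and> i < j \<and> j \<le> l} \<union>
     {{E i j a, E j k b, E i k (a + b)} | i j k a b. 1 \<le> i \<and> i < j \<and> j < k \<and> k \<le> l \<and> a + b \<le> 1}"

lemma shi_lines_cases:
  assumes "T \<in> shi_lines l"
  obtains i j where "1 \<le> i" "i < j" "j \<le> l" "T = {Z, E i j 0, E i j 1}"
  | i j k a b where "1 \<le> i" "i < j" "j < k" "k \<le> l" "a + b \<le> 1" "T = {E i j a, E j k b, E i k (a + b)}"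
  using assms unfolding shi_lines_def by blast

lemma shi_line_parallel: "1 \<le> i \<Longrightarrow> i < j \<Longrightarrow> j \<le> l \<Longrightarrow> {Z, E i j 0, E i j 1} \<in> shi_lines l"
  unfolding shi_lines_def by blast

lemma shi_line_triangle: "1 \<le> i \<Longrightarrow> i < j \<Longrightarrow> j < k \<Longrightarrow> k \<le> l \<Longrightarrow> a + b \<le> 1 \<Longrightarrow>
    {E i j a, E j k b, E i k (a + b)} \<in> shi_lines l"
  unfolding shi_lines_def by blast

text \<open>Two distinct edges on a line are parallel, consecutive, or have a common smaller or a
  common larger end, and each position forces the third point. The asymmetric positions occur in
  both orders, which gives seven cases.\<close>

lemma edges_determine_line:
  assumes "T \<in> shi_lines l" "E i j g \<in> T" "E i' j' g' \<in> T" "E i j g \<noteq> E i' j' g'"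
  shows "i = i' \<and> j = j' \<and> T = {Z, E i j 0, E i j 1}
    \<or> j = i' \<and> g + g' \<le> 1 \<and> T = {E i j g, E i' j' g', E i j' (g + g')}
    \<or> j' = i \<and> g + g' \<le> 1 \<and> T = {E i' j' g', E i j g, E i' j (g + g')}
    \<or> i = i' \<and> j < j' \<and> g \<le> g' \<and> T = {E i j g, E j j' (g' - g), E i j' g'}
    \<or> i = i' \<and> j' < j \<and> g' \<le> g \<and> T = {E i j' g', E j' j (g - g'), E i j g}
    \<or> j = j' \<and> i < i' \<and> g' \<le> g \<and> T = {E i i' (g - g'), E i' j g', E i j g}
    \<or> j = j' \<and> i' < i \<and> g \<le> g' \<and> T = {E i' i (g' - g), E i j g, E i' j g'}"
  using assms(1)
proof (cases rule: shi_lines_cases)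
  case 1
  then show ?thesis using assms(2-4) by auto
next
  case (2 i0 j0 k0 a b)
  have "E i j g = E i0 j0 a \<or> E i j g = E j0 k0 b \<or> E i j g = E i0 k0 (a + b)"
    "E i' j' g' = E i0 j0 a \<or> E i' j' g' = E j0 k0 b \<or> E i' j' g' = E i0 k0 (a + b)"
    using assms(2,3) 2 by auto
  then show ?thesis using assms(4) 2(2,3) 2(5) unfolding 2(6)
    by (elim disjE) (simp_all add: add.commute)
qed

interpretation shi: line_space "shi_points l" "shi_lines l" for l
proof
  fix T assume "T \<in> shi_lines l"
  then show "T \<subseteq> shi_points l" by (cases rule: shi_lines_cases) (auto simp: shi_points_def)
  show "card T = 3" using \<open>T \<in> shi_lines l\<close> by (cases rule: shi_lines_cases) auto
next
  fix T T' p q assume T: "T \<in> shi_lines l" "T' \<in> shi_lines l" and ne: "p \<noteq> q" and pq: "{p, q} \<subseteq> T" "{p, q} \<subseteq> T'"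
  have ZT: "T = {Z, E i j 0, E i j 1}" if "T \<in> shi_lines l" "Z \<in> T" "E i j g \<in> T" for T i j g
    using that(1) by (cases rule: shi_lines_cases) (use that in auto)
  have ZE: "T = T'" if "Z \<in> T \<and> E i j g \<in> T \<and> Z \<in> T' \<and> E i j g \<in> T'" for i j g
    using ZT[OF T(1)] ZT[OF T(2)] that by metis
  show "T = T'"
  proof (cases p)
    case Z
    then obtain i j g where "q = E i j g" using ne by (cases q) auto
    then show ?thesis using ZE[of i j g] Z pq by simp
  next
    case p: (E i j g)
    show ?thesis
    proof (cases q)
      case Z
      then show ?thesis using ZE[of i j g] p pq by simp
    next
      case q: (E i' j' g')
      have ij: "i < j \<and> i' < j'" using T(1) by (cases rule: shi_lines_cases) (use p q pq in auto)
      have mem: "E i j g \<in> T" "E i' j' g' \<in> T" "E i j g \<in> T'" "E i' j' g' \<in> T'"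
        and ne': "E i j g \<noteq> E i' j' g'" using p q pq ne by auto
      show ?thesis
        using edges_determine_line[OF T(1) mem(1,2) ne'] edges_determine_line[OF T(2) mem(3,4) ne'] ij ne'
        by (elim disjE conjE; simp)
    qed
  qed
qed

text \<open>The position and gain conditions of \<open>edges_determine_line\<close> without the
  line. They are necessary for lying on a common line, so their failure proves
  \<open>apart\<close>.\<close>

definition compatible :: "nat \<Rightarrow> nat \<Rightarrow> nat \<Rightarrow> nat \<Rightarrow> nat \<Rightarrow> nat \<Rightarrow> bool" where
  "compatible i j g i' j' g' \<longleftrightarrow>
     i = i' \<and> j = j' \<or> j = i' \<and> g + g' \<le> 1 \<or> j' = i \<and> g + g' \<le> 1
     \<or> i = i' \<and> j < j' \<and> g \<le> g' \<or> i = i' \<and> j' < j \<and> g' \<le> g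
     \<or> j = j' \<and> i < i' \<and> g' \<le> g \<or> j = j' \<and> i' < i \<and> g \<le> g'"

lemma apart_edges:
  assumes "\<not> compatible i j g i' j' g'"
  shows "apart (shi_lines l) (E i j g) (E i' j' g')"
proof -
  have False if "T \<in> shi_lines l" "E i j g \<in> T" "E i' j' g' \<in> T" for T
  proof -
    have "E i j g \<noteq> E i' j' g'" using assms by (auto simp: compatible_def)
    from edges_determine_line[OF that this] assms show False unfolding compatible_def by metis
  qed
  then show ?thesis unfolding apart_def by blast
qed

text \<open>A triangle through two of the diagonal points would need a third edge of gain 2 or -1,
  so no line joins them.\<close>

lemma nonfano_shi:
  assumes "1 \<le> i" "i < j" "j < k" "k \<le> l"
  shows "nonfano (shi_lines l) Z (E i j 0) (E j k 0) (E i k 1) (E i j 1) (E j k 1) (E i k 0)"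
proof -
  have ln: "{Z, E i j 0, E i j 1} \<in> shi_lines l" "{Z, E j k 0, E j k 1} \<in> shi_lines l" "{Z, E i k 0, E i k 1} \<in> shi_lines l"
    "{E i j 0, E j k 0, E i k 0} \<in> shi_lines l" "{E i j 1, E j k 0, E i k 1} \<in> shi_lines l"
    "{E i j 0, E j k 1, E i k 1} \<in> shi_lines l"
    using assms shi_line_parallel[of i j l] shi_line_parallel[of j k l] shi_line_parallel[of i k l] shi_line_triangle[of i j k l 0 0]
      shi_line_triangle[of i j k l 1 0] shi_line_triangle[of i j k l 0 1] by auto
  have "apart (shi_lines l) (E i j 1) (E j k 1)" "apart (shi_lines l) (E i j 1) (E i k 0)"
    "apart (shi_lines l) (E j k 1) (E i k 0)"
    by (rule apart_edges; use assms in \<open>auto simp: compatible_def\<close>)+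
  then show ?thesis using ln assms unfolding nonfano_def by (simp add: insert_commute)
qed

text \<open>In a balanced graph the gains of three consecutive edges determine all six, and
  \<open>a + b + c \<le> 1\<close> is exactly the condition that each of them is at most 1.\<close>

lemma k4_shi:
  assumes "1 \<le> i" "i < j" "j < k" "k < m" "m \<le> l" "a + b + c \<le> 1"
  shows "k4 (shi_lines l) (E i j a) (E i k (a + b)) (E i m (a + b + c)) (E j k b) (E j m (b + c)) (E k m c)"
proof -
  have "{E i j a, E j k b, E i k (a + b)} \<in> shi_lines l" "{E i j a, E j m (b + c), E i m (a + (b + c))} \<in> shi_lines l"
    "{E i k (a + b), E k m c, E i m (a + b + c)} \<in> shi_lines l" "{E j k b, E k m c, E j m (b + c)} \<in> shi_lines l"
    using assms by (intro shi_line_triangle; simp)+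
  then show ?thesis unfolding k4_def using assms by (simp add: insert_commute add.assoc)
qed

text \<open>The assumptions are the zeros at \<open>coord\<close>. A pair of a point h and a line T
  is settled by the number of indices that h and T use together: \<open>local_vanishes\<close> and
  \<open>nonfano_vanishes\<close> for at most three, \<open>k4_vanishes\<close> or
  \<open>vanishes_apart2\<close> for four, and \<open>vanishes_apart2\<close> for five.\<close>

lemma shi_cocycle_eq_0:
  assumes f: "f \<in> cocycles (shi_points l) (shi_lines l)"
    and c1: "\<And>i j. 1 \<le> i \<Longrightarrow> i < j \<Longrightarrow> j \<le> l \<Longrightarrow>
      f (Z, Z, E i j 0) = 0 \<and> f (E i j 0, Z, E i j 0) = 0"
    and c2: "\<And>i j k a b. 1 \<le> i \<Longrightarrow> i < j \<Longrightarrow> j < k \<Longrightarrow> k \<le> l \<Longrightarrow> a + b \<le> 1 \<Longrightarrow>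
      f (E i j a, E i j a, E j k b) = 0 \<and> f (E j k b, E i j a, E j k b) = 0"
    and c3: "\<And>i j k. 1 \<le> i \<Longrightarrow> i < j \<Longrightarrow> j < k \<Longrightarrow> k \<le> l \<Longrightarrow>
      f (Z, E j k 1, E i j 0) = 0 \<and> f (E j k 1, E i k 0, Z) = 0 \<and> f (Z, E i j 1, E j k 0) = 0 \<and>
      f (E i j 1, E i k 0, Z) = 0 \<and> f (E j k 1, E i j 1, Z) = 0"
    and c4: "\<And>i j k m a b c. 1 \<le> i \<Longrightarrow> i < j \<Longrightarrow> j < k \<Longrightarrow> k < m \<Longrightarrow> m \<le> l \<Longrightarrow> a + b + c \<le> 1 \<Longrightarrow>
      f (E i j a, E j k b, E k m c) = 0 \<and> f (E j k b, E i m (a + b + c), E i j a) = 0"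
  shows "f = 0"
proof -
  have loc1: "vanishes_on f h {Z, E i j 0, E i j 1}"
    if "h \<in> {Z, E i j 0, E i j 1}" "1 \<le> i" "i < j" "j \<le> l" for h i j
    by (rule shi.local_vanishes[OF f shi_line_parallel _ _ that(1)]) (use that(2-) c1 in auto)
  have loc2: "vanishes_on f h {E i j a, E j k b, E i k (a + b)}"
    if "h \<in> {E i j a, E j k b, E i k (a + b)}" "1 \<le> i" "i < j" "j < k" "k \<le> l" "a + b \<le> 1" for h i j k a b
    by (rule shi.local_vanishes[OF f shi_line_triangle _ _ that(1)]) (use that(2-) c2 in auto)
  have three1: "vanishes_on f (E u v g) {Z, E s t 0, E s t 1}"
    if ijk: "1 \<le> i" "i < j" "j < k" "k \<le> l" and "(u, v) \<in> {(i, j), (j, k), (i, k)}"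
      "(s, t) \<in> {(i, j), (j, k), (i, k)}" "(u, v) \<noteq> (s, t)" "g \<le> 1" for i j k u v s t g
  proof -
    note N = shi.nonfano_vanishes[OF f nonfano_shi[OF ijk]]
    have "g = 0 \<or> g = 1" using that by auto
    then show ?thesis using N c3[OF ijk] that(5-7)
      by (elim disjE) (auto simp: insert_commute)
  qed
  have three2: "vanishes_on f h {E i j a, E j k b, E i k (a + b)}"
    if ijk: "1 \<le> i" "i < j" "j < k" "k \<le> l" and "a + b \<le> 1"
      "h \<in> {Z, E i j 0, E i j 1, E j k 0, E j k 1, E i k 0, E i k 1}" for i j k a b h
  proof (cases "h \<in> {E i j a, E j k b, E i k (a + b)}")
    case True
    then show ?thesis using loc2 that by blast
  next
    case False
    note N = shi.nonfano_vanishes[OF f nonfano_shi[OF ijk]]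
    have "a = 0 \<and> b = 0 \<or> a = 1 \<and> b = 0 \<or> a = 0 \<and> b = 1" using that by auto
    then show ?thesis using N c3[OF ijk] that(6) False
      by (elim disjE conjE) (auto simp: insert_commute)
  qed
  \<comment> \<open>Each triangle of a balanced complete graph is paired with the three edges at the
    vertex opposite to it.\<close>
  have four:
      "h \<in> {E i m (a + b + c), E j m (b + c), E k m c} \<Longrightarrow> vanishes_on f h {E i j a, E j k b, E i k (a + b)}"
      "h \<in> {E i k (a + b), E j k b, E k m c} \<Longrightarrow> vanishes_on f h {E i j a, E j m (b + c), E i m (a + b + c)}"
      "h \<in> {E i j a, E j k b, E j m (b + c)} \<Longrightarrow> vanishes_on f h {E i k (a + b), E k m c, E i m (a + b + c)}"
      "h \<in> {E i j a, E i k (a + b), E i m (a + b + c)} \<Longrightarrow> vanishes_on f h {E j k b, E k m c, E j m (b + c)}"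
    if "1 \<le> i" "i < j" "j < k" "k < m" "m \<le> l" "a + b + c \<le> 1" for i j k m a b c h
  proof -
    have ap: "apart (shi_lines l) (E i j a) (E k m c)" "apart (shi_lines l) (E i k (a + b)) (E j m (b + c))"
      "apart (shi_lines l) (E i m (a + b + c)) (E j k b)"
      by (rule apart_edges; use that in \<open>auto simp: compatible_def\<close>)+
    note V = shi.k4_vanishes[OF f k4_shi[OF that] ap c4[OF that, THEN conjunct1] c4[OF that, THEN conjunct2]]
    show "h \<in> {E i m (a + b + c), E j m (b + c), E k m c} \<Longrightarrow> vanishes_on f h {E i j a, E j k b, E i k (a + b)}"
      "h \<in> {E i k (a + b), E j k b, E k m c} \<Longrightarrow> vanishes_on f h {E i j a, E j m (b + c), E i m (a + b + c)}"
      "h \<in> {E i j a, E j k b, E j m (b + c)} \<Longrightarrow> vanishes_on f h {E i k (a + b), E k m c, E i m (a + b + c)}"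
      "h \<in> {E i j a, E i k (a + b), E i m (a + b + c)} \<Longrightarrow> vanishes_on f h {E j k b, E k m c, E j m (b + c)}"
      using V by (auto simp: insert_commute)
  qed
  have split: "vanishes_on f h T"
    if "T \<in> shi_lines l" "T = {x, y, w}" "apart (shi_lines l) h x" "apart (shi_lines l) h y \<or> apart (shi_lines l) h w \<or> vanishes_on f h T"
    for h T x y w
  proof -
    have "x \<noteq> y" "x \<noteq> w" using shi.line_distinct that by blast+
    then show ?thesis
      using that shi.vanishes_apart2[OF f that(1), of x y h] shi.vanishes_apart2[OF f that(1), of x w h] by auto
  qed
  have "vanishes_on f h T" if T: "T \<in> shi_lines l" and h: "h \<in> shi_points l" for h T
    using T
  proof (cases rule: shi_lines_cases)
    case (1 i j)
    show ?thesis
    proof (cases h)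
      case Z
      then show ?thesis using loc1 1 by blast
    next
      case (E u v g)
      then have uv: "1 \<le> u" "u < v" "v \<le> l" "g \<le> 1" using h by (auto simp: shi_points_def)
      \<comment> \<open>A single index shared with the parallel class leaves three indices in play,
        hence a quadrangle; with none shared, h is apart from both edges of the class.\<close>
      consider "u = i" "v = j" | "u = i" "v < j" | "u = i" "j < v" | "u = j" | "v = i"
        | "v = j" "i < u" | "v = j" "u < i" | "{u, v} \<inter> {i, j} = {}"
        by fastforce
      then show ?thesis
      proof cases
        case 1
        then have "h \<in> {Z, E i j 0, E i j 1}" using E uv by auto
        then show ?thesis using loc1 \<open>T = _\<close> \<open>1 \<le> i\<close> \<open>i < j\<close> \<open>j \<le> l\<close> by blast
      next
        case 2
        then show ?thesis using three1[of i v j u v i j g] E uv 1 by auto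
      next
        case 3
        then show ?thesis using three1[of i j v u v i j g] E uv 1 by auto
      next
        case 4
        then show ?thesis using three1[of i j v u v i j g] E uv 1 by auto
      next
        case 5
        then show ?thesis using three1[of u i j u v i j g] E uv 1 by auto
      next
        case 6
        then show ?thesis using three1[of i u j u v i j g] E uv 1 by auto
      next
        case 7
        then show ?thesis using three1[of u i j u v i j g] E uv 1 by auto
      next
        case 8
        have "apart (shi_lines l) h (E i j 0)" "apart (shi_lines l) h (E i j 1)"
          unfolding E by (rule apart_edges; use 8 in \<open>auto simp: compatible_def\<close>)+
        then show ?thesis using split[OF T, of "E i j 0" "E i j 1" Z h] 1 by (auto simp: insert_commute)
      qed
    qed
  next
    case (2 i j k a b)
    show ?thesis
    proof (cases h)
      case Z
      then show ?thesis using three2[of i j k a b Z] 2 by simp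
    next
      case (E u v g)
      then have uv: "1 \<le> u" "u < v" "v \<le> l" "g \<le> 1" using h by (auto simp: shi_points_def)
      \<comment> \<open>In the uses below \<open>x\<close> is the edge of the triangle disjoint from
        h, which is always apart from h, and \<open>P\<close> is the gain condition under which h
        and T lie in a balanced complete graph. If \<open>P\<close> fails, a second edge of T is
        apart from h as well.\<close>
      have one: ?thesis if "T = {x, y, w}" "apart (shi_lines l) h x" "\<not> P \<Longrightarrow> apart (shi_lines l) h y \<or> apart (shi_lines l) h w"
        "P \<Longrightarrow> vanishes_on f h T" for x y w P
        using split[OF T that(1,2)] that(3,4) by blast
      \<comment> \<open>The cases with exactly one shared index are ordered by where the fourth
        index falls among i, j, k.\<close>
      have "u = i \<and> v = j \<or>
          u = j \<and> v = k \<or>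
          u = i \<and> v = k \<or>
          {u, v} \<inter> {i, j, k} = {} \<or>
          v = i \<or>
          v = j \<and> u < i \<or>
          v = j \<and> i < u \<or>
          v = k \<and> u < i \<or>
          v = k \<and> i < u \<and> u < j \<or>
          v = k \<and> j < u \<or>
          u = i \<and> v < j \<or>
          u = i \<and> j < v \<and> v < k \<or>
          u = i \<and> k < v \<or>
          u = j \<and> v < k \<or>
          u = j \<and> k < v \<or>
          u = k"
        using uv(2) 2(2,3)
        by (cases "u = i"; cases "u = j"; cases "u = k"; cases "v = i"; cases "v = j"; cases "v = k"; simp; arith?)
      then consider "u = i" "v = j" | "u = j" "v = k" | "u = i" "v = k"
        | "{u, v} \<inter> {i, j, k} = {}"
        | "v = i"
        | "v = j" "u < i"
        | "v = j" "i < u"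
        | "v = k" "u < i"
        | "v = k" "i < u" "u < j"
        | "v = k" "j < u"
        | "u = i" "v < j"
        | "u = i" "j < v" "v < k"
        | "u = i" "k < v"
        | "u = j" "v < k"
        | "u = j" "k < v"
        | "u = k"
        by (elim disjE conjE)
      then show ?thesis
      proof cases
        case 1
        then show ?thesis using three2[of i j k a b h] 2 E uv by (auto simp: le_Suc_eq)
      next
        case ca: 2
        then show ?thesis using three2[of i j k a b h] 2 E uv by (auto simp: le_Suc_eq)
      next
        case 3
        then show ?thesis using three2[of i j k a b h] 2 E uv by (auto simp: le_Suc_eq)
      next
        case 4
        have "apart (shi_lines l) h (E i j a)" "apart (shi_lines l) h (E j k b)"
          unfolding E by (rule apart_edges; use 4 in \<open>auto simp: compatible_def\<close>)+
        then show ?thesis using split[OF T 2(6)] by blast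
      next
        case ca: 5
        show ?thesis
        proof (rule one[of "E j k b" "E i j a" "E i k (a + b)" "g + a + b \<le> 1"])
          show "T = {E j k b, E i j a, E i k (a + b)}" using 2(6) by blast
          show "apart (shi_lines l) h (E j k b)" unfolding E by (rule apart_edges) (use ca 2 uv in \<open>auto simp: compatible_def\<close>)
          show "apart (shi_lines l) h (E i j a) \<or> apart (shi_lines l) h (E i k (a + b))" if "\<not> (g + a + b \<le> 1)"
          proof -
            have "\<not> compatible u v g i j a \<or> \<not> compatible u v g i k (a + b)"
              unfolding compatible_def using that ca 2(2-5) uv by auto
            then show ?thesis unfolding E using apart_edges by blast
          qed
          show "vanishes_on f h T" if "g + a + b \<le> 1"
            using four(4)[of u i j k g a b h] that ca 2 uv E by auto
        qed
      next
        case ca: 6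
        show ?thesis
        proof (rule one[of "E i k (a + b)" "E i j a" "E j k b" "a \<le> g \<and> g + b \<le> 1"])
          show "T = {E i k (a + b), E i j a, E j k b}" using 2(6) by blast
          show "apart (shi_lines l) h (E i k (a + b))" unfolding E by (rule apart_edges) (use ca 2 uv in \<open>auto simp: compatible_def\<close>)
          show "apart (shi_lines l) h (E i j a) \<or> apart (shi_lines l) h (E j k b)" if "\<not> (a \<le> g \<and> g + b \<le> 1)"
          proof -
            have "\<not> compatible u v g i j a \<or> \<not> compatible u v g j k b"
              unfolding compatible_def using that ca 2(2-5) uv by auto
            then show ?thesis unfolding E using apart_edges by blast
          qed
          \<comment> \<open>Balance forces the gain \<open>g - a\<close> on the new edge from u to
            i, and \<open>a \<le> g\<close> keeps the subtraction of naturals exact. The differences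
            in the later cases arise in the same way.\<close>
          show "vanishes_on f h T" if "a \<le> g \<and> g + b \<le> 1"
            using four(4)[of u i j k "g - a" a b h] that ca 2 uv E by auto
        qed
      next
        case ca: 7
        show ?thesis
        proof (rule one[of "E i k (a + b)" "E i j a" "E j k b" "g \<le> a"])
          show "T = {E i k (a + b), E i j a, E j k b}" using 2(6) by blast
          show "apart (shi_lines l) h (E i k (a + b))" unfolding E by (rule apart_edges) (use ca 2 uv in \<open>auto simp: compatible_def\<close>)
          show "apart (shi_lines l) h (E i j a) \<or> apart (shi_lines l) h (E j k b)" if "\<not> (g \<le> a)"
          proof -
            have "\<not> compatible u v g i j a \<or> \<not> compatible u v g j k b"
              unfolding compatible_def using that ca 2(2-5) uv by auto
            then show ?thesis unfolding E using apart_edges by blast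
          qed
          show "vanishes_on f h T" if "g \<le> a"
            using four(3)[of i u j k "a - g" g b h] that ca 2 uv E by auto
        qed
      next
        case ca: 8
        show ?thesis
        proof (rule one[of "E i j a" "E i k (a + b)" "E j k b" "a + b \<le> g"])
          show "T = {E i j a, E i k (a + b), E j k b}" using 2(6) by blast
          show "apart (shi_lines l) h (E i j a)" unfolding E by (rule apart_edges) (use ca 2 uv in \<open>auto simp: compatible_def\<close>)
          show "apart (shi_lines l) h (E i k (a + b)) \<or> apart (shi_lines l) h (E j k b)" if "\<not> (a + b \<le> g)"
          proof -
            have "\<not> compatible u v g i k (a + b) \<or> \<not> compatible u v g j k b"
              unfolding compatible_def using that ca 2(2-5) uv by auto
            then show ?thesis unfolding E using apart_edges by blast
          qed
          show "vanishes_on f h T" if "a + b \<le> g"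
            using four(4)[of u i j k "g - (a + b)" a b h] that ca 2 uv E by auto
        qed
      next
        case ca: 9
        show ?thesis
        proof (rule one[of "E i j a" "E i k (a + b)" "E j k b" "g \<le> a + b \<and> b \<le> g"])
          show "T = {E i j a, E i k (a + b), E j k b}" using 2(6) by blast
          show "apart (shi_lines l) h (E i j a)" unfolding E by (rule apart_edges) (use ca 2 uv in \<open>auto simp: compatible_def\<close>)
          show "apart (shi_lines l) h (E i k (a + b)) \<or> apart (shi_lines l) h (E j k b)" if "\<not> (g \<le> a + b \<and> b \<le> g)"
          proof -
            have "\<not> compatible u v g i k (a + b) \<or> \<not> compatible u v g j k b"
              unfolding compatible_def using that ca 2(2-5) uv by auto
            then show ?thesis unfolding E using apart_edges by blast
          qed
          show "vanishes_on f h T" if "g \<le> a + b \<and> b \<le> g"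
            using four(3)[of i u j k "a + b - g" "g - b" b h] that ca 2 uv E by auto
        qed
      next
        case ca: 10
        show ?thesis
        proof (rule one[of "E i j a" "E i k (a + b)" "E j k b" "g \<le> b"])
          show "T = {E i j a, E i k (a + b), E j k b}" using 2(6) by blast
          show "apart (shi_lines l) h (E i j a)" unfolding E by (rule apart_edges) (use ca 2 uv in \<open>auto simp: compatible_def\<close>)
          show "apart (shi_lines l) h (E i k (a + b)) \<or> apart (shi_lines l) h (E j k b)" if "\<not> (g \<le> b)"
          proof -
            have "\<not> compatible u v g i k (a + b) \<or> \<not> compatible u v g j k b"
              unfolding compatible_def using that ca 2(2-5) uv by auto
            then show ?thesis unfolding E using apart_edges by blast
          qed
          show "vanishes_on f h T" if "g \<le> b"
            using four(2)[of i j u k a "b - g" g h] that ca 2 uv E by auto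
        qed
      next
        case ca: 11
        show ?thesis
        proof (rule one[of "E j k b" "E i j a" "E i k (a + b)" "g \<le> a"])
          show "T = {E j k b, E i j a, E i k (a + b)}" using 2(6) by blast
          show "apart (shi_lines l) h (E j k b)" unfolding E by (rule apart_edges) (use ca 2 uv in \<open>auto simp: compatible_def\<close>)
          show "apart (shi_lines l) h (E i j a) \<or> apart (shi_lines l) h (E i k (a + b))" if "\<not> (g \<le> a)"
          proof -
            have "\<not> compatible u v g i j a \<or> \<not> compatible u v g i k (a + b)"
              unfolding compatible_def using that ca 2(2-5) uv by auto
            then show ?thesis unfolding E using apart_edges by blast
          qed
          show "vanishes_on f h T" if "g \<le> a"
            using four(3)[of i v j k g "a - g" b h] that ca 2 uv E by auto
        qed
      next
        case ca: 12
        show ?thesis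
        proof (rule one[of "E j k b" "E i j a" "E i k (a + b)" "a \<le> g \<and> g \<le> a + b"])
          show "T = {E j k b, E i j a, E i k (a + b)}" using 2(6) by blast
          show "apart (shi_lines l) h (E j k b)" unfolding E by (rule apart_edges) (use ca 2 uv in \<open>auto simp: compatible_def\<close>)
          show "apart (shi_lines l) h (E i j a) \<or> apart (shi_lines l) h (E i k (a + b))" if "\<not> (a \<le> g \<and> g \<le> a + b)"
          proof -
            have "\<not> compatible u v g i j a \<or> \<not> compatible u v g i k (a + b)"
              unfolding compatible_def using that ca 2(2-5) uv by auto
            then show ?thesis unfolding E using apart_edges by blast
          qed
          show "vanishes_on f h T" if "a \<le> g \<and> g \<le> a + b"
            using four(2)[of i j v k a "g - a" "a + b - g" h] that ca 2 uv E by auto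
        qed
      next
        case ca: 13
        show ?thesis
        proof (rule one[of "E j k b" "E i j a" "E i k (a + b)" "a + b \<le> g"])
          show "T = {E j k b, E i j a, E i k (a + b)}" using 2(6) by blast
          show "apart (shi_lines l) h (E j k b)" unfolding E by (rule apart_edges) (use ca 2 uv in \<open>auto simp: compatible_def\<close>)
          show "apart (shi_lines l) h (E i j a) \<or> apart (shi_lines l) h (E i k (a + b))" if "\<not> (a + b \<le> g)"
          proof -
            have "\<not> compatible u v g i j a \<or> \<not> compatible u v g i k (a + b)"
              unfolding compatible_def using that ca 2(2-5) uv by auto
            then show ?thesis unfolding E using apart_edges by blast
          qed
          show "vanishes_on f h T" if "a + b \<le> g"
            using four(1)[of i j k v a b "g - (a + b)" h] that ca 2 uv E by auto
        qed
      next
        case ca: 14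
        show ?thesis
        proof (rule one[of "E i k (a + b)" "E i j a" "E j k b" "g \<le> b"])
          show "T = {E i k (a + b), E i j a, E j k b}" using 2(6) by blast
          show "apart (shi_lines l) h (E i k (a + b))" unfolding E by (rule apart_edges) (use ca 2 uv in \<open>auto simp: compatible_def\<close>)
          show "apart (shi_lines l) h (E i j a) \<or> apart (shi_lines l) h (E j k b)" if "\<not> (g \<le> b)"
          proof -
            have "\<not> compatible u v g i j a \<or> \<not> compatible u v g j k b"
              unfolding compatible_def using that ca 2(2-5) uv by auto
            then show ?thesis unfolding E using apart_edges by blast
          qed
          show "vanishes_on f h T" if "g \<le> b"
            using four(2)[of i j v k a g "b - g" h] that ca 2 uv E by auto
        qed
      next
        case ca: 15
        show ?thesis
        proof (rule one[of "E i k (a + b)" "E i j a" "E j k b" "b \<le> g \<and> a + g \<le> 1"])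
          show "T = {E i k (a + b), E i j a, E j k b}" using 2(6) by blast
          show "apart (shi_lines l) h (E i k (a + b))" unfolding E by (rule apart_edges) (use ca 2 uv in \<open>auto simp: compatible_def\<close>)
          show "apart (shi_lines l) h (E i j a) \<or> apart (shi_lines l) h (E j k b)" if "\<not> (b \<le> g \<and> a + g \<le> 1)"
          proof -
            have "\<not> compatible u v g i j a \<or> \<not> compatible u v g j k b"
              unfolding compatible_def using that ca 2(2-5) uv by auto
            then show ?thesis unfolding E using apart_edges by blast
          qed
          show "vanishes_on f h T" if "b \<le> g \<and> a + g \<le> 1"
            using four(1)[of i j k v a b "g - b" h] that ca 2 uv E by auto
        qed
      next
        case ca: 16
        show ?thesis
        proof (rule one[of "E i j a" "E i k (a + b)" "E j k b" "a + b + g \<le> 1"])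
          show "T = {E i j a, E i k (a + b), E j k b}" using 2(6) by blast
          show "apart (shi_lines l) h (E i j a)" unfolding E by (rule apart_edges) (use ca 2 uv in \<open>auto simp: compatible_def\<close>)
          show "apart (shi_lines l) h (E i k (a + b)) \<or> apart (shi_lines l) h (E j k b)" if "\<not> (a + b + g \<le> 1)"
          proof -
            have "\<not> compatible u v g i k (a + b) \<or> \<not> compatible u v g j k b"
              unfolding compatible_def using that ca 2(2-5) uv by auto
            then show ?thesis unfolding E using apart_edges by blast
          qed
          show "vanishes_on f h T" if "a + b + g \<le> 1"
            using four(1)[of i j k v a b g h] that ca 2 uv E by auto
        qed
      qed
    qed
  qed
  then have "f (h, p, q) = 0" for h p q
    using precocyclesD(1)[OF cocycles_precocycles[OF f], of h p q]
      precocyclesD(3)[OF cocycles_precocycles[OF f], of p q h] vanishes_onD[of f h _ p q]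
    by (metis insert_subset)
  then show ?thesis by (auto simp: fun_eq_iff)
qed

section \<open>The basis of cocycles for the Shi arrangement\<close>

datatype conf = Loc pt pt pt | Quad pt pt pt pt pt pt

text \<open>
  The cocycles \<open>basis s\<close> and the positions \<open>coord s\<close> are dual to each other. \<open>Loc\<close> is a line, \<open>Quad\<close> a complete
  graph as in \<open>matching\<close>.
\<close>

fun basis :: "conf \<times> bool \<Rightarrow> pt \<times> pt \<times> pt \<Rightarrow> complex" where
  "basis (Loc x y z, t) = (if t then elem x y z x else elem x y z y) - elem x y z z"
| "basis (Quad a b c d e f, t) =
    (if t then matching a b c d e f else matching c a b e f d) - matching b c a f d e"

fun coord :: "conf \<times> bool \<Rightarrow> pt \<times> pt \<times> pt" where
  "coord (Loc x y z, t) = (if t then x else y, x, y)"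
| "coord (Quad a b c d e f, t) = (if t then (a, d, f) else (d, c, a))"

definition pairs :: "nat \<Rightarrow> (nat \<times> nat) set" where
  "pairs l = {(i, j). 1 \<le> i \<and> i < j \<and> j \<le> l}"

definition triples :: "nat \<Rightarrow> (nat \<times> nat \<times> nat) set" where
  "triples l = {(i, j, k). 1 \<le> i \<and> i < j \<and> j < k \<and> k \<le> l}"

definition quads :: "nat \<Rightarrow> (nat \<times> nat \<times> nat \<times> nat) set" where
  "quads l = {(i, j, k, m). 1 \<le> i \<and> i < j \<and> j < k \<and> k < m \<and> m \<le> l}"

text \<open>
  Omitting a diagonal point of the quadrangle on \<open>i < j < k\<close> leaves a complete graph; this gives \<open>tri1\<close>,
  \<open>tri2\<close> and \<open>tri3\<close>. Their six cocycles satisfy one relation, so only one of the two on \<open>tri3\<close> is kept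
  in \<open>indices\<close>.
\<close>

fun loc2 :: "nat \<times> nat \<Rightarrow> conf" where
  "loc2 (i, j) = Loc Z (E i j 0) (E i j 1)"

fun loc3 :: "(nat \<times> nat \<times> nat) \<times> nat \<times> nat \<Rightarrow> conf" where
  "loc3 ((i, j, k), (a, b)) = Loc (E i j a) (E j k b) (E i k (a + b))"

fun tri1 :: "nat \<times> nat \<times> nat \<Rightarrow> conf" where
  "tri1 (i, j, k) = Quad Z (E j k 0) (E i k 0) (E j k 1) (E i k 1) (E i j 0)"

fun tri2 :: "nat \<times> nat \<times> nat \<Rightarrow> conf" where
  "tri2 (i, j, k) = Quad Z (E i j 0) (E i k 0) (E i j 1) (E i k 1) (E j k 0)"

fun tri3 :: "nat \<times> nat \<times> nat \<Rightarrow> conf" where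
  "tri3 (i, j, k) = Quad Z (E j k 0) (E i j 1) (E j k 1) (E i j 0) (E i k 1)"

fun quad4 :: "(nat \<times> nat \<times> nat \<times> nat) \<times> nat \<times> nat \<times> nat \<Rightarrow> conf" where
  "quad4 ((i, j, k, m), (a, b, c)) =
    Quad (E i j a) (E i k (a + b)) (E i m (a + b + c)) (E j k b) (E j m (b + c)) (E k m c)"

definition gains2 :: "(nat \<times> nat) set" where "gains2 = {(0, 0), (1, 0), (0, 1)}"
definition gains3 :: "(nat \<times> nat \<times> nat) set" where "gains3 = {(0, 0, 0), (1, 0, 0), (0, 1, 0), (0, 0, 1)}"

lemma mem_gains2: "(a, b) \<in> gains2 \<longleftrightarrow> a + b \<le> 1"
  by (auto simp: gains2_def)

lemma mem_gains3: "(a, b, c) \<in> gains3 \<longleftrightarrow> a + b + c \<le> 1"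
  by (auto simp: gains3_def)

definition locs :: "nat \<Rightarrow> conf set" where
  "locs l = loc2 ` pairs l \<union> loc3 ` (triples l \<times> gains2)"

definition indices :: "nat \<Rightarrow> (conf \<times> bool) set" where
  "indices l = locs l \<times> UNIV \<union> tri1 ` triples l \<times> UNIV \<union> tri2 ` triples l \<times> UNIV
     \<union> tri3 ` triples l \<times> {False} \<union> quad4 ` (quads l \<times> gains3) \<times> UNIV"

lemma locs_cases:
  assumes "C \<in> locs l"
  obtains i j where "1 \<le> i" "i < j" "j \<le> l" "C = Loc Z (E i j 0) (E i j 1)"
  | i j k a b where "1 \<le> i" "i < j" "j < k" "k \<le> l" "a + b \<le> 1" "C = Loc (E i j a) (E j k b) (E i k (a + b))"
  using assms unfolding locs_def by (auto simp: pairs_def triples_def mem_gains2)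

lemma indices_cases:
  assumes "s \<in> indices l"
  obtains (loc) C t where "s = (C, t)" "C \<in> locs l"
  | (tri1) i j k t where "s = (tri1 (i, j, k), t)" "1 \<le> i" "i < j" "j < k" "k \<le> l"
  | (tri2) i j k t where "s = (tri2 (i, j, k), t)" "1 \<le> i" "i < j" "j < k" "k \<le> l"
  | (tri3) i j k where "s = (tri3 (i, j, k), False)" "1 \<le> i" "i < j" "j < k" "k \<le> l"
  | (quad) i j k m a b c t where "s = (quad4 ((i, j, k, m), (a, b, c)), t)"
      "1 \<le> i" "i < j" "j < k" "k < m" "m \<le> l" "a + b + c \<le> 1"
  using assms unfolding indices_def triples_def quads_def by (auto simp: mem_gains3 simp del: tri1.simps tri2.simps tri3.simps quad4.simps)

lemma locs_line: "C \<in> locs l \<Longrightarrow> \<exists>x y z. C = Loc x y z \<and> {x, y, z} \<in> shi_lines l"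
  by (erule locs_cases) (auto intro: shi_line_parallel[simplified] shi_line_triangle[simplified])

lemma k4_tri:
  assumes "1 \<le> i" "i < j" "j < k" "k \<le> l"
  shows "k4 (shi_lines l) Z (E j k 0) (E i k 0) (E j k 1) (E i k 1) (E i j 0)"
    and "k4 (shi_lines l) Z (E i j 0) (E i k 0) (E i j 1) (E i k 1) (E j k 0)"
    and "k4 (shi_lines l) Z (E j k 0) (E i j 1) (E j k 1) (E i j 0) (E i k 1)"
  using nonfano_shi[OF assms] assms unfolding nonfano_def k4_def by (auto simp: insert_commute)

lemma indices_not_loc:
  assumes "s \<in> indices l" "fst s \<notin> locs l"
  shows "\<exists>a b c d e f. fst s = Quad a b c d e f \<and> k4 (shi_lines l) a b c d e f"
  using assms(1)
proof (cases rule: indices_cases)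
  case loc
  then show ?thesis using assms(2) by simp
next
  case (quad i j k m a b c t)
  then show ?thesis using k4_shi[of i j k m l a b c] by simp
qed (use k4_tri in auto)

lemma basis_cocycle: "s \<in> indices l \<Longrightarrow> basis s \<in> cocycles (shi_points l) (shi_lines l)"
proof (cases "fst s \<in> locs l")
  case True
  then obtain x y z t where "s = (Loc x y z, t)" "{x, y, z} \<in> shi_lines l"
    using locs_line by (metis prod.collapse)
  then show ?thesis using shi.local_cocycle[of x y z l] by simp
next
  case False
  assume "s \<in> indices l"
  then obtain a b c d e f t where "s = (Quad a b c d e f, t)" "k4 (shi_lines l) a b c d e f"
    using indices_not_loc False by (metis prod.collapse)
  then show ?thesis
    using shi.matching_diff_cocycle[of l a b c d e f] shi.matching_diff_cocycle'[of l a b c d e f] by simp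
qed

section \<open>Counting the index set\<close>

lemma card_pairs: "real (card (pairs l)) = real l * (real l - 1) / 2"
  and finite_pairs: "finite (pairs l)"
proof -
  show "finite (pairs l)" by (rule finite_subset[of _ "{..l} \<times> {..l}"]) (auto simp: pairs_def)
  show "real (card (pairs l)) = real l * (real l - 1) / 2"
  \<comment> \<open>The induction step adds the tuples that end in the new largest index. Over the
    reals the closed form also holds for small l.\<close>
  proof (induction l)
    case 0
    have "pairs 0 = {}" by (auto simp: pairs_def)
    then show ?case by simp
  next
    case (Suc l)
    have "pairs (Suc l) = pairs l \<union> (\<lambda>i. (i, Suc l)) ` {1..l}" by (auto simp: pairs_def)
    moreover have "finite (pairs l)" by (rule finite_subset[of _ "{..l} \<times> {..l}"]) (auto simp: pairs_def)
    moreover have "pairs l \<inter> (\<lambda>i. (i, Suc l)) ` {1..l} = {}" by (auto simp: pairs_def)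
    ultimately have "card (pairs (Suc l)) = card (pairs l) + l"
      by (simp add: card_Un_disjoint card_image inj_on_def)
    then show ?case using Suc by (simp add: field_simps)
  qed
qed

lemma card_triples: "real (card (triples l)) = real l * (real l - 1) * (real l - 2) / 6"
  and finite_triples: "finite (triples l)"
proof -
  have fin: "finite (triples l)" for l
    by (rule finite_subset[of _ "{..l} \<times> {..l} \<times> {..l}"]) (auto simp: triples_def)
  then show "finite (triples l)" .
  show "real (card (triples l)) = real l * (real l - 1) * (real l - 2) / 6"
  proof (induction l)
    case 0
    have "triples 0 = {}" by (auto simp: triples_def)
    then show ?case by simp
  next
    case (Suc l)
    have "triples (Suc l) = triples l \<union> (\<lambda>(i, j). (i, j, Suc l)) ` pairs l"
      by (auto simp: pairs_def triples_def image_iff le_Suc_eq)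
    moreover have "triples l \<inter> (\<lambda>(i, j). (i, j, Suc l)) ` pairs l = {}" by (auto simp: triples_def)
    moreover have "inj_on (\<lambda>(i, j). (i, j, Suc l)) (pairs l)" by (auto simp: inj_on_def)
    ultimately have "card (triples (Suc l)) = card (triples l) + card (pairs l)"
      using fin[of l] finite_pairs[of l] by (simp add: card_Un_disjoint card_image)
    then show ?case using Suc card_pairs[of l] by (simp add: field_simps)
  qed
qed

lemma card_quads: "real (card (quads l)) = real l * (real l - 1) * (real l - 2) * (real l - 3) / 24"
  and finite_quads: "finite (quads l)"
proof -
  have fin: "finite (quads l)" for l
    by (rule finite_subset[of _ "{..l} \<times> {..l} \<times> {..l} \<times> {..l}"]) (auto simp: quads_def)
  then show "finite (quads l)" .
  show "real (card (quads l)) = real l * (real l - 1) * (real l - 2) * (real l - 3) / 24"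
  proof (induction l)
    case 0
    have "quads 0 = {}" by (auto simp: quads_def)
    then show ?case by simp
  next
    case (Suc l)
    have "quads (Suc l) = quads l \<union> (\<lambda>(i, j, k). (i, j, k, Suc l)) ` triples l"
      by (auto simp: triples_def quads_def image_iff le_Suc_eq)
    moreover have "quads l \<inter> (\<lambda>(i, j, k). (i, j, k, Suc l)) ` triples l = {}" by (auto simp: quads_def)
    moreover have "inj_on (\<lambda>(i, j, k). (i, j, k, Suc l)) (triples l)" by (auto simp: inj_on_def)
    ultimately have "card (quads (Suc l)) = card (quads l) + card (triples l)"
      using fin[of l] finite_triples[of l] by (simp add: card_Un_disjoint card_image)
    then show ?case using Suc card_triples[of l] by (simp add: field_simps)
  qed
qed

lemma card_indices:
  "real (card (indices l)) = real l * (real l - 1) * (2 * (real l)\<^sup>2 + real l - 4) / 6"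
  and finite_indices: "finite (indices l)"
proof -
  have fl: "finite (loc2 ` pairs l)" "finite (loc3 ` (triples l \<times> gains2))" "finite (quad4 ` (quads l \<times> gains3))"
    "finite (tri1 ` triples l)" "finite (tri2 ` triples l)" "finite (tri3 ` triples l)"
    using finite_pairs finite_triples finite_quads by (simp_all add: gains2_def gains3_def)
  then show "finite (indices l)" by (simp add: indices_def locs_def)
  have g: "card gains2 = 3" "card gains3 = 4" by (simp_all add: gains2_def gains3_def)
  have "inj_on loc2 (pairs l)" "inj_on loc3 (triples l \<times> gains2)" "inj_on quad4 (quads l \<times> gains3)"
    "inj_on tri1 (triples l)" "inj_on tri2 (triples l)" "inj_on tri3 (triples l)"
    by (auto simp: inj_on_def)
  then have c: "card (loc2 ` pairs l) = card (pairs l)" "card (loc3 ` (triples l \<times> gains2)) = card (triples l) * 3"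
    "card (quad4 ` (quads l \<times> gains3)) = card (quads l) * 4" "card (tri1 ` triples l) = card (triples l)"
    "card (tri2 ` triples l) = card (triples l)" "card (tri3 ` triples l) = card (triples l)"
    by (simp_all add: card_image card_cartesian_product g)
  have "loc2 ` pairs l \<inter> loc3 ` (triples l \<times> gains2) = {}" by auto
  then have cl: "card (locs l) = card (pairs l) + card (triples l) * 3"
    unfolding locs_def using fl c by (simp add: card_Un_disjoint)
  have fL: "finite (locs l)" using fl by (simp add: locs_def)
  have "card (indices l) = card (locs l) * 2 + card (triples l) * 2 + card (triples l) * 2 + card (triples l)
      + card (quads l) * 4 * 2"
    unfolding indices_def
    by (subst card_Un_disjoint, use fl fL in simp, use fl fL in simp,
        (auto simp: locs_def triples_def)[1])+
      (simp add: card_cartesian_product c)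
  \<comment> \<open>The 11 is 2 for each of the three triangle lines on three indices plus 2 + 2 + 1
    for \<open>tri1\<close>, \<open>tri2\<close> and \<open>tri3\<close>; the 8 is 2 for each of the
    four choices of gains.\<close>
  then have "real (card (indices l)) = 2 * real (card (pairs l)) + 11 * real (card (triples l)) + 8 * real (card (quads l))"
    unfolding cl by simp
  then show "real (card (indices l)) = real l * (real l - 1) * (2 * (real l)\<^sup>2 + real l - 4) / 6"
    unfolding card_pairs card_triples card_quads by (simp add: field_simps power2_eq_square)
qed


section \<open>Duality of \<open>basis\<close> and \<open>coord\<close>\<close>

lemma basis_loc_0: "\<not> {h, p, q} \<subseteq> {x, y, z} \<Longrightarrow> basis (Loc x y z, t) (h, p, q) = 0"
proof -
  assume "\<not> {h, p, q} \<subseteq> {x, y, z}"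
  then have "elem x y z w (h, p, q) = 0" if "w \<in> {x, y, z}" for w
    by (intro elem_eq_0) (use that in blast)
  then show ?thesis by simp
qed

text \<open>For \<open>t = False\<close> the cocycle involves only the matchings of b with e and of
  c with d, so it is zero when the first point is a. This alternative serves \<open>tri3\<close>,
  whose points include the coordinates of \<open>tri1\<close> and \<open>tri2\<close> that start at
  \<open>Z\<close>.\<close>

lemma basis_quad_0:
  assumes "\<not> {h, p, q} \<subseteq> {a, b, c, d, e, f} \<or> t = False \<and> h = a \<and> distinct [a, b, c, d, e, f]"
  shows "basis (Quad a b c d e f, t) (h, p, q) = 0"
  using assms
proof
  assume *: "\<not> {h, p, q} \<subseteq> {a, b, c, d, e, f}"
  have "{c, a, b, e, f, d} = {a, b, c, d, e, f}" "{b, c, a, f, d, e} = {a, b, c, d, e, f}" by blast+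
  then have "matching a b c d e f (h, p, q) = 0" "matching c a b e f d (h, p, q) = 0" "matching b c a f d e (h, p, q) = 0"
    using * by (simp_all only: matching_eq_0 not_False_eq_True)
  then show ?thesis by simp
next
  assume "t = False \<and> h = a \<and> distinct [a, b, c, d, e, f]"
  then show ?thesis by (auto simp: matching_other)
qed

text \<open>In each summand of \<open>matching\<close> the first factor is off the line of the
  second, whereas a coordinate of a \<open>Loc\<close> repeats its first point.\<close>

lemma matching_local_0:
  assumes "distinct [a, b, c, d, e, f]" "h = p \<or> h = q"
  shows "matching a b c d e f (h, p, q) = 0"
proof -
  have "elem x y z w (h, p, q) = 0" if "w \<notin> {x, y, z}" for x y z w
    by (rule elem_eq_0) (use that assms in blast)
  then have "elem d f e a (h, p, q) = 0" "elem b f c a (h, p, q) = 0" "elem c a e f (h, p, q) = 0"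
    "elem b a d f (h, p, q) = 0" using assms(1) by auto
  then show ?thesis by (simp add: matching_def)
qed

text \<open>A coordinate of a line contains two of its points and so fits into no other line. Equal
  lines have equal \<open>Loc\<close> terms because their points are listed in a fixed
  order.\<close>

lemma basis_coord_loc_loc:
  assumes C: "C \<in> locs l" and C': "C' \<in> locs l"
  shows "basis (C, t) (coord (C', t')) = (if (C, t) = (C', t') then 1 else 0)"
proof -
  obtain x y z where x: "C = Loc x y z" "{x, y, z} \<in> shi_lines l" using locs_line[OF C] by blast
  obtain x' y' z' where x': "C' = Loc x' y' z'" "{x', y', z'} \<in> shi_lines l" using locs_line[OF C'] by blast
  note d = shi.line_distinct[OF x(2)] and d' = shi.line_distinct[OF x'(2)]
  show ?thesis
  proof (cases "{x', y'} \<subseteq> {x, y, z}")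
    case True
    then have eq: "{x, y, z} = {x', y', z'}"
      using shi.line_unique[OF x(2) x'(2), of x' y'] d' by blast
    have mem: "x' \<in> {x, y, z}" "y' \<in> {x, y, z}" "z' \<in> {x, y, z}" "x \<in> {x', y', z'}"
      using eq by blast+
    have CC: "C = C'"
      using C
    proof (cases rule: locs_cases)
      case (1 i j)
      then have xyz: "x = Z" "y = E i j 0" "z = E i j 1" using x by auto
      from C' show ?thesis
      proof (cases rule: locs_cases)
        case c: (1 i' j')
        then have "x' = Z" "y' = E i' j' 0" "z' = E i' j' 1" using x' by auto
        then show ?thesis using mem(2) x x' xyz by simp
      next
        case (2 i' j' k' a' b')
        then show ?thesis using mem(4) x'(1) xyz by simp
      qed
    next
      case (2 i j k a b)
      then have xyz: "x = E i j a" "y = E j k b" "z = E i k (a + b)" using x by auto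
      from C' show ?thesis
      proof (cases rule: locs_cases)
        case (1 i' j')
        then show ?thesis using mem(1) x'(1) xyz by simp
      next
        case c: (2 i' j' k' a' b')
        then have xyz': "x' = E i' j' a'" "y' = E j' k' b'" "z' = E i' k' (a' + b')" using x' by auto
        show ?thesis using mem(1-3) x(1) x'(1) 2(2,3) c(2,3) unfolding xyz xyz'
          by (simp only: insert_iff empty_iff simp_thms pt.inject) (elim disjE conjE; simp)
      qed
    qed
    show ?thesis unfolding CC[symmetric] x(1) using d by (cases t; cases t') (simp_all add: elem_def)
  next
    case False
    then have "basis (C, t) (coord (C', t')) = 0" unfolding x x' by (cases t') (auto intro!: basis_loc_0 simp del: basis.simps)
    moreover have "C \<noteq> C'" using False x x' by auto
    ultimately show ?thesis by simp
  qed
qed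

text \<open>Either coordinate of a \<open>quad4\<close> names three edges that form a path through
  all four indices, and such a path determines the indices and, by balance, all gains.\<close>

lemma quad4_unique:
  assumes o: "i < j" "j < k" "k < m" and o': "i' < j'" "j' < k'" "k' < m'"
    and X: "X = {E i j a, E i k (a + b), E i m (a + b + c), E j k b, E j m (b + c), E k m c}"
    and mem: "E i' j' a' \<in> X" "E j' k' b' \<in> X" "E k' m' c' \<in> X \<or> E i' m' (a' + b' + c') \<in> X"
  shows "i = i' \<and> j = j' \<and> k = k' \<and> m = m' \<and> a = a' \<and> b = b' \<and> c = c'"
proof -
  have vert: "u \<in> {i, j, k, m} \<and> v \<in> {i, j, k, m}" if "E u v g \<in> X" for u v g
    using that unfolding X by auto
  have "i' \<in> {i, j, k, m}" "j' \<in> {i, j, k, m}" "k' \<in> {i, j, k, m}" "m' \<in> {i, j, k, m}"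
    using vert mem by blast+
  then have eq: "i' = i" "j' = j" "k' = k" "m' = m" using o o' by auto
  have "a' = a" "b' = b" "c' = c \<or> a' + b' + c' = a + b + c"
    using mem o unfolding eq X by auto
  then show ?thesis using eq by auto
qed

text \<open>Usually some point of the coordinate is missing from the other configuration; on equal
  indices, \<open>tri1\<close>, \<open>tri2\<close> and \<open>tri3\<close> omit
  \<open>E i j 1\<close>, \<open>E j k 1\<close> and \<open>E i k 0\<close>. The exception is
  \<open>tri3\<close> at the coordinates of \<open>tri1\<close> and \<open>tri2\<close> that start
  at \<open>Z\<close>: there the value is 0 for the index \<open>False\<close>, which is why that
  index is the one kept.\<close>

lemma basis_coord_quad_quad:
  assumes s: "s \<in> indices l" "fst s \<notin> locs l" and t: "t \<in> indices l" "fst t \<notin> locs l"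
    and ne: "fst s \<noteq> fst t"
  shows "basis s (coord t) = 0"
proof -
  have *: "basis (Quad a b c d e f, t) u = 0"
    if "\<not> {fst u, fst (snd u), snd (snd u)} \<subseteq> {a, b, c, d, e, f} \<or>
      t = False \<and> fst u = a \<and> distinct [a, b, c, d, e, f]" for a b c d e f t u
    using basis_quad_0[of "fst u" "fst (snd u)" "snd (snd u)"] that by simp
  from s(1) show ?thesis
  proof (cases rule: indices_cases)
    case loc
    then show ?thesis using s(2) by simp
  next
    case S: tri1
    from t(1) show ?thesis
      by (cases rule: indices_cases; use S t(2) ne in \<open>(simp only: fst_conv tri1.simps; intro *; auto split: if_splits)?\<close>)
  next
    case S: tri2
    from t(1) show ?thesis
      by (cases rule: indices_cases; use S t(2) ne in \<open>(simp only: fst_conv tri2.simps; intro *; auto split: if_splits)?\<close>)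
  next
    case S: tri3
    from t(1) show ?thesis
      by (cases rule: indices_cases; use S t(2) ne in \<open>(simp only: fst_conv tri3.simps; intro *; auto split: if_splits)?\<close>)
  next
    case S: (quad i j k m a b c u)
    from t(1) show ?thesis
    proof (cases rule: indices_cases)
      case loc
      then show ?thesis using t(2) by simp
    next
      case R: (quad i' j' k' m' a' b' c' u')
      define X where "X = {E i j a, E i k (a + b), E i m (a + b + c), E j k b, E j m (b + c), E k m c}"
      have "\<not> (E i' j' a' \<in> X \<and> E j' k' b' \<in> X \<and> (E k' m' c' \<in> X \<or> E i' m' (a' + b' + c') \<in> X))"
      proof
        assume *: "E i' j' a' \<in> X \<and> E j' k' b' \<in> X \<and> (E k' m' c' \<in> X \<or> E i' m' (a' + b' + c') \<in> X)"
        have "i = i' \<and> j = j' \<and> k = k' \<and> m = m' \<and> a = a' \<and> b = b' \<and> c = c'"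
          by (rule quad4_unique[OF S(3-5) R(3-5) X_def *[THEN conjunct1]
                *[THEN conjunct2, THEN conjunct1] *[THEN conjunct2, THEN conjunct2]])
        then show False using ne S(1) R(1) by simp
      qed
      then have "\<not> {E i' j' a', E j' k' b', E k' m' c'} \<subseteq> X"
        "\<not> {E j' k' b', E i' m' (a' + b' + c'), E i' j' a'} \<subseteq> X"
        by (simp_all only: insert_subset) blast+
      then show ?thesis unfolding X_def S R quad4.simps
        by (cases u') (simp_all only: coord.simps if_True if_False basis_quad_0 simp_thms)
    next
      case (tri1 i' j' k' t)
      then show ?thesis unfolding S quad4.simps by (intro *) simp
    next
      case (tri2 i' j' k' t)
      then show ?thesis unfolding S quad4.simps by (intro *) simp
    next
      case (tri3 i' j' k')
      then show ?thesis unfolding S quad4.simps by (intro *) simp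
    qed
  qed
qed

lemma basis_coord:
  assumes s: "s \<in> indices l" and t: "t \<in> indices l"
  shows "basis s (coord t) = (if s = t then 1 else 0)"
proof -
  obtain C u where su: "s = (C, u)" by (cases s)
  obtain C' u' where tu: "t = (C', u')" by (cases t)
  consider "C \<in> locs l" "C' \<in> locs l" | "C \<in> locs l" "C' \<notin> locs l" | "C \<notin> locs l" "C' \<in> locs l"
    | "C \<notin> locs l" "C' \<notin> locs l" by blast
  then show ?thesis
  proof cases
    case 1
    then show ?thesis unfolding su tu by (rule basis_coord_loc_loc)
  next
    case 2
    obtain x y z where C: "C = Loc x y z" "{x, y, z} \<in> shi_lines l" using locs_line[OF 2(1)] by blast
    obtain a b c d e f where C': "C' = Quad a b c d e f" "k4 (shi_lines l) a b c d e f"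
      using indices_not_loc[OF t] 2 tu by auto
    have D: "distinct [a, b, c, d, e, f]" and l: "{d, e, f} \<in> shi_lines l" "{a, c, e} \<in> shi_lines l"
      using C'(2) by (simp_all add: k4_def)
    \<comment> \<open>The points of a \<open>Quad\<close> coordinate are not collinear: the line
      through two of them is a triangle of the graph that misses the third.\<close>
    have "\<not> {a, d, f} \<subseteq> {x, y, z}"
    proof
      assume *: "{a, d, f} \<subseteq> {x, y, z}"
      have "{x, y, z} = {d, e, f}" by (rule shi.line_unique[OF C(2) l(1), of d f]) (use D * in simp_all)
      then have "a \<in> {d, e, f}" using * by blast
      then show False using D by simp
    qed
    moreover have "\<not> {d, c, a} \<subseteq> {x, y, z}"
    proof
      assume *: "{d, c, a} \<subseteq> {x, y, z}"
      have "{x, y, z} = {a, c, e}" by (rule shi.line_unique[OF C(2) l(2), of a c]) (use D * in simp_all)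
      then have "d \<in> {a, c, e}" using * by blast
      then show False using D by auto
    qed
    ultimately have "basis s (coord t) = 0"
      unfolding su tu C C' by (cases u') (simp_all only: coord.simps if_True if_False basis_loc_0 simp_thms)
    then show ?thesis using C C' su tu by simp
  next
    case 3
    obtain x y z where C': "C' = Loc x y z" using locs_line[OF 3(2)] by blast
    obtain a b c d e f where C: "C = Quad a b c d e f" "k4 (shi_lines l) a b c d e f"
      using indices_not_loc[OF s] 3 su by auto
    have D: "distinct [a, b, c, d, e, f]" "distinct [c, a, b, e, f, d]" "distinct [b, c, a, f, d, e]"
      using C(2) by (auto simp: k4_def)
    have "basis s (coord t) = 0"
      unfolding su tu C C' using matching_local_0[OF D(1)] matching_local_0[OF D(2)] matching_local_0[OF D(3)]
      by simp
    then show ?thesis using C C' su tu by simp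
  next
    case 4
    obtain a b c d e f where C: "C = Quad a b c d e f" "k4 (shi_lines l) a b c d e f"
      using indices_not_loc[OF s] 4 su by auto
    show ?thesis
    proof (cases "C = C'")
      case True
      have D: "a \<noteq> b" "a \<noteq> c" "a \<noteq> d" "a \<noteq> e" "a \<noteq> f" "b \<noteq> c" "b \<noteq> d" "b \<noteq> e" "b \<noteq> f"
        "c \<noteq> d" "c \<noteq> e" "c \<noteq> f" "d \<noteq> e" "d \<noteq> f" "e \<noteq> f" using C(2) by (simp_all add: k4_def)
      note D' = D D[symmetric]
      \<comment> \<open>The first point of a coordinate lies in just one of the three matchings, so
        only that matching contributes.\<close>
      have "matching a b c d e f (a, d, f) = 1" "matching c a b e f d (d, c, a) = 1"
        by (simp_all add: matching_def elem_def D')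
      then show ?thesis unfolding su tu True[symmetric] C
        by (cases u; cases u') (simp_all add: matching_other D')
    next
      case False
      then show ?thesis using basis_coord_quad_quad[OF s _ t] 4 su tu by simp
    qed
  qed
qed

lemma shi_cocycle_coord_0:
  assumes f: "f \<in> cocycles (shi_points l) (shi_lines l)" and c: "\<And>s. s \<in> indices l \<Longrightarrow> f (coord s) = 0"
  shows "f = 0"
proof (rule shi_cocycle_eq_0[OF f])
  fix i j assume "1 \<le> i" "i < j" "j \<le> l"
  then have "loc2 (i, j) \<in> locs l" unfolding locs_def pairs_def by blast
  then have "(loc2 (i, j), t) \<in> indices l" for t unfolding indices_def by blast
  from c[OF this[of True]] c[OF this[of False]]
  show "f (Z, Z, E i j 0) = 0 \<and> f (E i j 0, Z, E i j 0) = 0" by simp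
next
  fix i j k a b assume *: "1 \<le> i" "i < j" "j < k" "k \<le> l" "a + b \<le> (1 :: nat)"
  then have "((i, j, k), (a, b)) \<in> triples l \<times> gains2" by (simp add: triples_def mem_gains2)
  then have "loc3 ((i, j, k), (a, b)) \<in> locs l" unfolding locs_def by blast
  then have "(loc3 ((i, j, k), (a, b)), t) \<in> indices l" for t unfolding indices_def by blast
  from c[OF this[of True]] c[OF this[of False]]
  show "f (E i j a, E i j a, E j k b) = 0 \<and> f (E j k b, E i j a, E j k b) = 0" by simp
next
  fix i j k assume *: "1 \<le> i" "i < j" "j < k" "k \<le> l"
  then have "(i, j, k) \<in> triples l" by (simp add: triples_def)
  then have "(tri1 (i, j, k), t) \<in> indices l" "(tri2 (i, j, k), t) \<in> indices l" "(tri3 (i, j, k), False) \<in> indices l" for t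
    unfolding indices_def by blast+
  from c[OF this(1)[of True]] c[OF this(1)[of False]] c[OF this(2)[of True]] c[OF this(2)[of False]] c[OF this(3)]
  show "f (Z, E j k 1, E i j 0) = 0 \<and> f (E j k 1, E i k 0, Z) = 0 \<and> f (Z, E i j 1, E j k 0) = 0 \<and>
      f (E i j 1, E i k 0, Z) = 0 \<and> f (E j k 1, E i j 1, Z) = 0" by simp
next
  fix i j k m a b c' assume *: "1 \<le> i" "i < j" "j < k" "k < m" "m \<le> l" "a + b + c' \<le> (1 :: nat)"
  then have "((i, j, k, m), (a, b, c')) \<in> quads l \<times> gains3" by (simp add: quads_def mem_gains3)
  then have "(quad4 ((i, j, k, m), (a, b, c')), t) \<in> indices l" for t unfolding indices_def by blast
  from c[OF this[of True]] c[OF this[of False]]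
  show "f (E i j a, E j k b, E k m c') = 0 \<and> f (E j k b, E i m (a + b + c'), E i j a) = 0" by simp
qed

lemma dim_image_shi_cocycles:
  assumes "Vector_Spaces.linear cscale cscale F" and "inj_on F (cocycles (shi_points l) (shi_lines l))"
  shows "cfun.dim (F ` cocycles (shi_points l) (shi_lines l)) = card (indices l)"
proof (rule dim_image_dual_basis[where b = basis and x = coord])
  show "cfun.subspace (cocycles (shi_points l) (shi_lines l))" by (rule subspace_cocycles)
  show "finite (indices l)" by (rule finite_indices)
  show "basis s \<in> cocycles (shi_points l) (shi_lines l)" if "s \<in> indices l" for s using that by (rule basis_cocycle)
  show "basis s (coord t) = (if s = t then 1 else 0)" if "s \<in> indices l" "t \<in> indices l" for s t
    using that by (rule basis_coord)
  show "v = 0" if "v \<in> cocycles (shi_points l) (shi_lines l)" "\<And>s. s \<in> indices l \<Longrightarrow> v (coord s) = 0" for v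
    using that by (rule shi_cocycle_coord_0)
qed (fact assms)+

section \<open>Transport of cocycles along a numbering of the points\<close>

definition pull :: "('b \<Rightarrow> 'a) \<Rightarrow> 'b set \<Rightarrow> ('a \<times> 'a \<times> 'a \<Rightarrow> complex) \<Rightarrow> 'b \<times> 'b \<times> 'b \<Rightarrow> complex" where
  "pull \<pi> B f = (\<lambda>(h, p, q). if h \<in> B \<and> p \<in> B \<and> q \<in> B then f (\<pi> h, \<pi> p, \<pi> q) else 0)"

lemma linear_pull: "Vector_Spaces.linear cscale cscale (pull \<pi> B)"
  by unfold_locales (auto simp: pull_def cscale_def fun_eq_iff algebra_simps)

lemma pull_cocycle:
  assumes b: "bij_betw \<pi> B A" and L: "\<And>T. T \<in> L \<Longrightarrow> T \<subseteq> A" and f: "f \<in> cocycles A L"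
  shows "pull \<pi> B f \<in> cocycles B {S. S \<subseteq> B \<and> \<pi> ` S \<in> L}"
proof (intro cocyclesI precocyclesI)
  note pre = precocyclesD[OF cocycles_precocycles[OF f]]
  show "h \<in> B \<and> p \<in> B \<and> q \<in> B" if "pull \<pi> B f (h, p, q) \<noteq> 0" for h p q
    using that by (simp add: pull_def split: if_splits)
  show "pull \<pi> B f (h, q, p) = - pull \<pi> B f (h, p, q)" for h p q
    using pre(2)[of "\<pi> h" "\<pi> q" "\<pi> p"] by (simp add: pull_def)
  show "pull \<pi> B f (h, p, q) = pull \<pi> B f (h, q, r)" if "{p, q, r} \<in> {S. S \<subseteq> B \<and> \<pi> ` S \<in> L}" for h p q r
    using pre(4)[of "\<pi> p" "\<pi> q" "\<pi> r" "\<pi> h"] that by (simp add: pull_def)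
  show "pull \<pi> B f (h, p, q) = 0" if none: "\<forall>T\<in>{S. S \<subseteq> B \<and> \<pi> ` S \<in> L}. \<not> {p, q} \<subseteq> T" for h p q
  proof (cases "h \<in> B \<and> p \<in> B \<and> q \<in> B")
    case True
    have "\<not> {\<pi> p, \<pi> q} \<subseteq> T" if T: "T \<in> L" for T
    proof
      assume *: "{\<pi> p, \<pi> q} \<subseteq> T"
      let ?S = "{x \<in> B. \<pi> x \<in> T}"
      have "\<pi> ` ?S = T" using L[OF T] bij_betw_imp_surj_on[OF b] by auto
      then have "?S \<in> {S. S \<subseteq> B \<and> \<pi> ` S \<in> L}" using T by auto
      from bspec[OF none this] show False using True * by simp
    qed
    then show ?thesis using pre(3)[of "\<pi> p" "\<pi> q" "\<pi> h"] by (simp add: pull_def)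
  qed (auto simp: pull_def)
  show "pull \<pi> B f (h, p, q) + pull \<pi> B f (p, q, h) + pull \<pi> B f (q, h, p) = 0" for h p q
    using cocycles_sum_0[OF f, of "\<pi> h" "\<pi> p" "\<pi> q"] by (auto simp: pull_def)
qed

text \<open>The inverse bijection pulls back in the other direction, and both composites are
  identities because cocycles vanish off the point set.\<close>

lemma pull_image_cocycles:
  assumes b: "bij_betw \<pi> B A" and L: "\<And>T. T \<in> L \<Longrightarrow> T \<subseteq> A"
  shows "pull \<pi> B ` cocycles A L = cocycles B {S. S \<subseteq> B \<and> \<pi> ` S \<in> L}" (is "_ = cocycles B ?L")
    and "inj_on (pull \<pi> B) (cocycles A L)"
proof -
  let ?\<rho> = "inv_into B \<pi>"
  have b': "bij_betw ?\<rho> A B" using b by (rule bij_betw_inv_into)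
  have \<rho>: "?\<rho> (\<pi> x) = x" if "x \<in> B" for x using b that by (simp add: bij_betw_inv_into_left)
  have \<pi>: "\<pi> (?\<rho> x) = x" if "x \<in> A" for x using b that by (simp add: bij_betw_inv_into_right)
  have \<pi>B: "\<pi> x \<in> A" if "x \<in> B" for x using b that by (auto simp: bij_betw_def)
  have \<rho>A: "?\<rho> x \<in> B" if "x \<in> A" for x using b' that by (auto simp: bij_betw_def)
  have LL: "{S. S \<subseteq> A \<and> ?\<rho> ` S \<in> ?L} = L"
  proof -
    have "\<pi> ` ?\<rho> ` S = S" if "S \<subseteq> A" for S using \<pi> that by (force simp: image_image)
    moreover have "?\<rho> ` S \<subseteq> B" if "S \<subseteq> A" for S using \<rho>A that by blast
    ultimately have "S \<in> {S. S \<subseteq> A \<and> ?\<rho> ` S \<in> ?L} \<longleftrightarrow> S \<in> L" for S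
      using L[of S] by (cases "S \<subseteq> A") auto
    then show ?thesis by blast
  qed
  have supp: "g x = 0" if "g \<in> cocycles X M" "x \<notin> X \<times> X \<times> X" for g :: "'c \<times> 'c \<times> 'c \<Rightarrow> complex" and x X M
    using precocyclesD(1)[OF cocycles_precocycles[OF that(1)], of "fst x" "fst (snd x)" "snd (snd x)"] that(2)
    by (cases x) auto
  have 1: "pull \<pi> B (pull ?\<rho> A g) = g" if "g \<in> cocycles B ?L" for g
  proof
    fix x show "pull \<pi> B (pull ?\<rho> A g) x = g x"
      using supp[OF that, of x] \<rho> \<pi>B by (cases x) (auto simp: pull_def)
  qed
  have 2: "pull ?\<rho> A (pull \<pi> B f) = f" if "f \<in> cocycles A L" for f
  proof
    fix x show "pull ?\<rho> A (pull \<pi> B f) x = f x"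
      using supp[OF that, of x] \<pi> \<rho>A by (cases x) (auto simp: pull_def)
  qed
  have 3: "pull ?\<rho> A g \<in> cocycles A L" if "g \<in> cocycles B ?L" for g
    using pull_cocycle[OF b' _ that] unfolding LL by blast
  show "inj_on (pull \<pi> B) (cocycles A L)" by (intro inj_onI) (metis 2)
  show "pull \<pi> B ` cocycles A L = cocycles B ?L"
  proof
    show "pull \<pi> B ` cocycles A L \<subseteq> cocycles B ?L" using pull_cocycle[OF b L] by blast
    show "cocycles B ?L \<subseteq> pull \<pi> B ` cocycles A L" 
    proof
      fix g assume g: "g \<in> cocycles B ?L"
      show "g \<in> pull \<pi> B ` cocycles A L" 
        by (rule image_eqI[where x = "pull ?\<rho> A g"]) (use 1[OF g] 3[OF g] in simp_all)
    qed
  qed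
qed

section \<open>The quadratic part of the Orlik--Solomon ideal\<close>

text \<open>
  The antisymmetric coordinate of a 2-form, independent of the ordering of the hyperplanes.
\<close>

definition alt :: "(nat set \<Rightarrow> complex) \<Rightarrow> nat \<Rightarrow> nat \<Rightarrow> complex" where
  "alt f p q = (if p < q then f {p, q} else if q < p then - f {p, q} else 0)"

lemma alt_swap: "alt f q p = - alt f p q"
  by (simp add: alt_def insert_commute)

lemma alt_add: "alt (f + g) p q = alt f p q + alt g p q"
  by (simp add: alt_def)

lemma alt_cscale: "alt (cscale c f) p q = c * alt f p q"
  by (simp add: alt_def cscale_def)

lemma alt_zero: "alt 0 p q = 0"
  by (simp add: alt_def)

text \<open>These are the conditions on a slice in \<open>precocycles\<close>. They concern only the
  degree 2 part of f, so they make sense for the inhomogeneous elements of an ideal.\<close>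

definition quadratic_cond :: "nat set set \<Rightarrow> (nat set \<Rightarrow> complex) \<Rightarrow> bool" where
  "quadratic_cond L f \<longleftrightarrow> (\<forall>p q. (\<forall>T\<in>L. \<not> {p, q} \<subseteq> T) \<longrightarrow> alt f p q = 0) \<and>
     (\<forall>p q r. {p, q, r} \<in> L \<longrightarrow> alt f p q = alt f q r)"

lemma quadratic_condD:
  assumes "quadratic_cond L f"
  shows "\<forall>T\<in>L. \<not> {p, q} \<subseteq> T \<Longrightarrow> alt f p q = 0" and "{p, q, r} \<in> L \<Longrightarrow> alt f p q = alt f q r"
  using assms[unfolded quadratic_cond_def, THEN conjunct1, rule_format, of p q]
    assms[unfolded quadratic_cond_def, THEN conjunct2, rule_format, of p q r] by simp_all

lemma quadratic_cond_scale:
  assumes "quadratic_cond L f" "\<And>p q. alt g p q = c * alt f p q"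
  shows "quadratic_cond L g"
  using assms unfolding quadratic_cond_def by simp

lemma quadratic_cond_add:
  assumes "quadratic_cond L f" "quadratic_cond L g"
  shows "quadratic_cond L (f + g)"
  using assms unfolding quadratic_cond_def by (simp add: alt_add)

lemma boundary_ebasis:
  assumes "s \<in> S" "S \<subseteq> {..n}"
  shows "ext_boundary n (ebasis S) (S - {s}) = (-1) ^ card {t \<in> S - {s}. t < s}"
proof -
  have "ext_boundary n (ebasis S) (S - {s}) =
      (\<Sum>u\<in>{..n} - (S - {s}). if u = s then (-1) ^ card {t \<in> S - {s}. t < s} else 0)"
    unfolding ext_boundary_def
  proof (rule sum.cong[OF refl])
    fix u assume "u \<in> {..n} - (S - {s})"
    then have "insert u (S - {s}) = S \<longleftrightarrow> u = s" using assms(1) by blast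
    then show "(-1) ^ card {t \<in> S - {s}. t < u} * ebasis S (insert u (S - {s})) =
        (if u = s then (-1) ^ card {t \<in> S - {s}. t < s} else 0)" by (simp add: ebasis_def)
  qed
  also have "\<dots> = (-1) ^ card {t \<in> S - {s}. t < s}" using assms by (subst sum.delta) auto
  finally show ?thesis .
qed

lemma boundary_ebasis_0:
  assumes "\<And>s. s \<in> S \<Longrightarrow> T \<noteq> S - {s}"
  shows "ext_boundary n (ebasis S) T = 0"
  unfolding ext_boundary_def
proof (rule sum.neutral, rule ballI)
  fix s assume s: "s \<in> {..n} - T"
  have "insert s T \<noteq> S"
  proof
    assume *: "insert s T = S"
    then have "s \<in> S" "T = S - {s}" using s by blast+
    then show False using assms by blast
  qed
  then show "(-1) ^ card {t \<in> T. t < s} * ebasis S (insert s T) = 0" by (simp add: ebasis_def)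
qed

lemma alt_boundary_triple:
  assumes o: "a < b" "b < c" "c \<le> n"
  shows "alt (ext_boundary n (ebasis {a, b, c})) p q = elem a b c h (h, p, q)"
proof -
  let ?f = "ext_boundary n (ebasis {a, b, c})"
  have S: "{a, b, c} \<subseteq> {..n}" using o by auto
  have d: "{a, b, c} - {a} = {b, c}" "{a, b, c} - {b} = {a, c}" "{a, b, c} - {c} = {a, b}" using o by auto
  have e: "{t \<in> {b, c}. t < a} = {}" "{t \<in> {a, c}. t < b} = {a}" "{t \<in> {a, b}. t < c} = {a, b}" using o by auto
  have v: "?f {b, c} = 1" "?f {a, c} = -1" "?f {a, b} = 1"
    using boundary_ebasis[OF _ S, of a] boundary_ebasis[OF _ S, of b] boundary_ebasis[OF _ S, of c] o
    unfolding d e by simp_all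
  have lt: "alt ?f p q = elem a b c h (h, p, q)" if pq: "p < q" for p q
  proof (cases "{p, q} \<subseteq> {a, b, c}")
    case True
    then consider "p = a" "q = b" | "p = a" "q = c" | "p = b" "q = c" using pq o by auto
    then show ?thesis using v o by cases (simp_all add: alt_def elem_def)
  next
    case False
    then have "?f {p, q} = 0" by (intro boundary_ebasis_0) blast
    then show ?thesis using False pq by (simp add: alt_def elem_eq_0 del: insert_subset)
  qed
  show ?thesis
  proof (cases p q rule: linorder_cases)
    case less
    then show ?thesis by (rule lt)
  next
    case equal
    then show ?thesis using elem_swap[of a b c h h p p] by (simp add: alt_def)
  next
    case greater
    have "alt ?f p q = - alt ?f q p" by (rule alt_swap)
    also have "\<dots> = - elem a b c h (h, q, p)" using lt[OF greater] by simp
    also have "\<dots> = elem a b c h (h, p, q)" by (rule elem_swap[symmetric])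
    finally show ?thesis .
  qed
qed

lemma card3_obtain:
  assumes "card S = 3"
  obtains a b c :: nat where "a < b" "b < c" "S = {a, b, c}"
proof -
  obtain x y z where S: "S = {x, y, z}" "x \<noteq> y" "y \<noteq> z" "x \<noteq> z" using assms by (auto simp: card_3_iff)
  then consider "x < y" "y < z" | "x < z" "z < y" | "y < x" "x < z" | "y < z" "z < x" | "z < x" "x < y" | "z < y" "y < x"
    by linarith
  then show ?thesis using that S by cases (metis insert_commute)+
qed

lemma card2_obtain:
  assumes "card S = 2"
  obtains a b :: nat where "a < b" "S = {a, b}"
proof -
  obtain x y where "S = {x, y}" "x \<noteq> y" using assms by (auto simp: card_2_iff)
  then show ?thesis using that[of x y] that[of y x] by (cases "x < y") (auto simp: insert_commute)
qed

lemma boundary_ebasis_nonzero: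
  assumes "ext_boundary n (ebasis S) T \<noteq> 0"
  obtains s where "s \<in> S" "T = S - {s}"
  using assms boundary_ebasis_0[of S T n] by metis

lemma ext_sign_empty: "ext_sign {} S = 1" "ext_sign S {} = 1"
  by (simp_all add: ext_sign_def)

text \<open>An element without parts of degree below 2 reaches degree 2 of a product only against
  the constant term of the other factor.\<close>

lemma wedge_low_deg:
  assumes x: "\<And>S. x S \<noteq> 0 \<Longrightarrow> 2 \<le> card S" and U: "card U = 2"
  shows "wedge a x U = a {} * x U" and "wedge x a U = a {} * x U"
proof -
  have fin: "finite U" using U by (cases "finite U") auto
  have *: "x (U - S) = 0" if "S \<subseteq> U" "S \<noteq> {}" for S
  proof -
    have "U - S \<subset> U" using that by blast
    then have "card (U - S) < 2" using psubset_card_mono[OF fin] U by simp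
    then show ?thesis using x[of "U - S"] by fastforce
  qed
  have **: "x S = 0" if "S \<subseteq> U" "S \<noteq> U" for S
  proof -
    have "S \<subset> U" using that by blast
    then have "card S < 2" using psubset_card_mono[OF fin] U by simp
    then show ?thesis using x[of S] by fastforce
  qed
  have "wedge a x U = (\<Sum>S\<in>Pow U. if S = {} then a {} * x U else 0)"
    unfolding wedge_def by (rule sum.cong) (auto simp: * ext_sign_empty)
  then show "wedge a x U = a {} * x U" using fin by simp
  have "wedge x a U = (\<Sum>S\<in>Pow U. if S = U then a {} * x U else 0)"
    unfolding wedge_def by (rule sum.cong) (auto simp: ** ext_sign_empty)
  then show "wedge x a U = a {} * x U" using fin by simp
qed

lemma wedge_nonzero:
  assumes "wedge f g U \<noteq> 0"
  obtains S where "S \<subseteq> U" "finite U" "f S \<noteq> 0" "g (U - S) \<noteq> 0"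
proof -
  have "\<exists>S\<in>Pow U. ext_sign S (U - S) * f S * g (U - S) \<noteq> 0"
  proof (rule ccontr)
    assume "\<not> ?thesis"
    then have "wedge f g U = 0" unfolding wedge_def by (intro sum.neutral) blast
    then show False using assms by simp
  qed
  moreover have "finite U" using assms wedge_infinite[of U f g] by metis
  ultimately show ?thesis using that by auto
qed

text \<open>Multiplication only rescales the degree 2 part, so the condition survives. This ideal
  contains everything of degree at least 3 and serves as an upper bound for the Orlik-Solomon
  ideal.\<close>

lemma ext_ideal_quadratic:
  "ext_ideal n {f \<in> ext_alg n. (\<forall>S. f S \<noteq> 0 \<longrightarrow> 2 \<le> card S) \<and> quadratic_cond L f}" (is "ext_ideal n ?J")
  unfolding ext_ideal_def
proof (intro conjI ballI)
  show "?J \<subseteq> ext_alg n" by blast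
  show "cfun.subspace ?J"
    unfolding cfun.subspace_def
  proof (intro conjI ballI allI)
    show "0 \<in> ?J" by (simp add: ext_alg_def quadratic_cond_def alt_zero)
  next
    fix f g assume f: "f \<in> ?J" and g: "g \<in> ?J"
    have "S \<subseteq> {..n} \<and> 2 \<le> card S" if "(f + g) S \<noteq> 0" for S
    proof -
      have "f S \<noteq> 0 \<or> g S \<noteq> 0" using that by auto
      then show ?thesis using f g unfolding ext_alg_def by blast
    qed
    moreover have "quadratic_cond L (f + g)" using f g by (blast intro: quadratic_cond_add)
    ultimately show "f + g \<in> ?J" by (simp add: ext_alg_def del: plus_fun_apply)
  next
    fix c f assume f: "f \<in> ?J"
    then have "quadratic_cond L (cscale c f)" by (auto intro: quadratic_cond_scale simp: alt_cscale)
    then show "cscale c f \<in> ?J" using f by (simp add: ext_alg_def cscale_def)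
  qed
next
  fix a x assume a: "a \<in> ext_alg n" and x: "x \<in> ?J"
  have x2: "2 \<le> card S" if "x S \<noteq> 0" for S using x that by blast
  have q: "quadratic_cond L x" using x by blast
  have s: "wedge a x U = a {} * x U" "wedge x a U = a {} * x U" if "card U = 2" for U
    using wedge_low_deg[OF x2 that] by auto
  have as: "alt (wedge a x) p r = a {} * alt x p r" "alt (wedge x a) p r = a {} * alt x p r" for p r
    by (cases p r rule: linorder_cases; simp add: alt_def s)+
  have sub: "U \<subseteq> {..n} \<and> 2 \<le> card U" if "wedge a x U \<noteq> 0 \<or> wedge x a U \<noteq> 0" for U
  proof -
    from that obtain S where S: "S \<subseteq> U" "finite U" "a S \<noteq> 0 \<and> x (U - S) \<noteq> 0 \<or> x S \<noteq> 0 \<and> a (U - S) \<noteq> 0"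
    proof
      assume "wedge a x U \<noteq> 0"
      then obtain S where "S \<subseteq> U" "finite U" "a S \<noteq> 0" "x (U - S) \<noteq> 0" by (rule wedge_nonzero)
      then show ?thesis using that by simp
    next
      assume "wedge x a U \<noteq> 0"
      then obtain S where "S \<subseteq> U" "finite U" "x S \<noteq> 0" "a (U - S) \<noteq> 0" by (rule wedge_nonzero)
      then show ?thesis using that by simp
    qed
    have "S \<subseteq> {..n}" "U - S \<subseteq> {..n}" using S(3) a x by (auto simp: ext_alg_def)
    moreover have "2 \<le> card S \<or> 2 \<le> card (U - S)" using S(3) x2 by blast
    moreover have "card S \<le> card U" "card (U - S) \<le> card U" using S by (auto intro: card_mono)
    ultimately show ?thesis by auto
  qed
  show "wedge a x \<in> ?J" using sub quadratic_cond_scale[OF q as(1)] by (simp add: ext_alg_def)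
  show "wedge x a \<in> ?J" using sub quadratic_cond_scale[OF q as(2)] by (simp add: ext_alg_def)
qed

definition quadratic :: "nat \<Rightarrow> nat set set \<Rightarrow> (nat set \<Rightarrow> complex) set" where
  "quadratic n L = {f \<in> ext_deg n 2. quadratic_cond L f}"

lemma ext_deg_nonzero: "f \<in> ext_deg n p \<Longrightarrow> f S \<noteq> 0 \<Longrightarrow> S \<subseteq> {..n} \<and> card S = p"
  by (simp add: ext_deg_def ext_alg_def)

lemma ext_degI: "(\<And>S. f S \<noteq> 0 \<Longrightarrow> S \<subseteq> {..n} \<and> card S = p) \<Longrightarrow> f \<in> ext_deg n p"
  by (simp add: ext_deg_def ext_alg_def)

lemma subspace_ext_deg: "cfun.subspace (ext_deg n p)"
  unfolding cfun.subspace_def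
proof (intro conjI ballI allI)
  show "0 \<in> ext_deg n p" by (rule ext_degI) simp
next
  fix f g assume f: "f \<in> ext_deg n p" and g: "g \<in> ext_deg n p"
  show "f + g \<in> ext_deg n p"
  proof (rule ext_degI)
    fix S assume "(f + g) S \<noteq> 0"
    then have "f S \<noteq> 0 \<or> g S \<noteq> 0" by auto
    then show "S \<subseteq> {..n} \<and> card S = p" using ext_deg_nonzero[OF f] ext_deg_nonzero[OF g] by blast
  qed
next
  fix c f assume f: "f \<in> ext_deg n p"
  show "cscale c f \<in> ext_deg n p"
    by (rule ext_degI, rule ext_deg_nonzero[OF f]) (simp add: cscale_def)
qed

lemma quadratic_eq_Int:
  "quadratic n L = {f \<in> ext_alg n. (\<forall>S. f S \<noteq> 0 \<longrightarrow> 2 \<le> card S) \<and> quadratic_cond L f} \<inter> ext_deg n 2"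
  unfolding quadratic_def ext_deg_def by auto

lemma subspace_quadratic: "cfun.subspace (quadratic n L)"
  unfolding quadratic_eq_Int using ext_ideal_quadratic[of n L]
  by (intro cfun.subspace_inter subspace_ext_deg) (simp add: ext_ideal_def)

context
  fixes n :: nat and \<alpha> :: "nat \<Rightarrow> nat \<Rightarrow> complex" and L :: "nat set set"
  assumes low: "\<And>S. S \<subseteq> {..n} \<Longrightarrow> card S \<le> 2 \<Longrightarrow> cfun.independent (\<alpha> ` S)"
    and L_def: "L = {S. S \<subseteq> {..n} \<and> card S = 3 \<and> cfun.dependent (\<alpha> ` S)}"
    and ls: "line_space {..n} L"
begin

text \<open>A triple gives an \<open>elem\<close>, which is a precocycle. For a larger set the
  boundary has degree at least 3, so its degree 2 part is zero.\<close>

lemma boundary_quadratic_cond: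
  assumes S: "S \<subseteq> {..n}" "cfun.dependent (\<alpha> ` S)"
  shows "quadratic_cond L (ext_boundary n (ebasis S))"
proof -
  have c3: "3 \<le> card S" using low[OF S(1)] S(2) by (cases "card S \<le> 2") auto
  show ?thesis
  proof (cases "card S = 3")
    case True
    then obtain a b c where abc: "a < b" "b < c" "S = {a, b, c}" by (rule card3_obtain)
    then have l: "{a, b, c} \<in> L" "c \<le> n" using S True unfolding L_def by auto
    have e: "elem a b c 0 \<in> precocycles {..n} L" by (rule line_space.elem_precocycle[OF ls l(1)]) simp
    show ?thesis
      unfolding quadratic_cond_def abc(3) alt_boundary_triple[OF abc(1,2) \<open>c \<le> n\<close>, where h = 0]
      using precocyclesD(3)[OF e, of _ _ 0] precocyclesD(4)[OF e, of _ _ _ 0] by (intro conjI allI impI)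
  next
    case False
    have "ext_boundary n (ebasis S) {p, q} = 0" for p q
    proof (rule ccontr)
      assume "ext_boundary n (ebasis S) {p, q} \<noteq> 0"
      then obtain s where s: "s \<in> S" "{p, q} = S - {s}" by (rule boundary_ebasis_nonzero)
      have "finite S" using S(1) finite_subset by blast
      then have "card S = Suc (card {p, q})" unfolding s(2) using s(1) by (rule card.remove)
      moreover have "card {p, q} \<le> 2" by (simp add: card_insert_if)
      ultimately show False using c3 False by simp
    qed
    then have "alt (ext_boundary n (ebasis S)) p q = 0" for p q by (simp add: alt_def)
    then show ?thesis by (simp add: quadratic_cond_def)
  qed
qed

text \<open>Two hyperplanes are on at most one line, so boundaries of different lines have disjoint
  supports and each coefficient can be read off at one pair. Removing the minimum gives a pair where
  the boundary has value 1.\<close>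

lemma quadratic_decompose:
  assumes f: "f \<in> quadratic n L"
  shows "f = (\<Sum>S\<in>L. cscale (f (S - {Min S})) (ext_boundary n (ebasis S)))"
proof
  fix T
  interpret line_space "{..n}" L by (fact ls)
  have finL: "finite L" unfolding L_def by simp
  have fd: "f \<in> ext_deg n 2" and q: "quadratic_cond L f" using f by (auto simp: quadratic_def)
  have "f T = (\<Sum>S\<in>L. f (S - {Min S}) * ext_boundary n (ebasis S) T)"
  proof (cases "\<exists>S\<in>L. \<exists>s\<in>S. T = S - {s}")
    case True
    then obtain S s where S: "S \<in> L" "s \<in> S" "T = S - {s}" by blast
    obtain a b c where abc: "a < b" "b < c" "S = {a, b, c}" using card_line[OF S(1)] by (rule card3_obtain)
    have cn: "c \<le> n" using line_subset[OF S(1)] abc by auto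
    have other: "ext_boundary n (ebasis S') T = 0" if S': "S' \<in> L" "S' \<noteq> S" for S'
    proof (rule ccontr)
      assume "ext_boundary n (ebasis S') T \<noteq> 0"
      then obtain s' where s': "s' \<in> S'" "T = S' - {s'}" by (rule boundary_ebasis_nonzero)
      have "card T = 2" using card_line[OF S(1)] S(2,3) by simp
      then obtain p r where pr: "p < r" "T = {p, r}" by (rule card2_obtain)
      have "S' = S" by (rule line_unique[OF S'(1) S(1), of p r]) (use pr S(3) s'(2) in auto)
      then show False using S'(2) by simp
    qed
    have "(\<Sum>S'\<in>L. f (S' - {Min S'}) * ext_boundary n (ebasis S') T) =
        (\<Sum>S'\<in>{S}. f (S' - {Min S'}) * ext_boundary n (ebasis S') T)"
      by (rule sum.mono_neutral_right) (use finL S(1) other in auto)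
    also have "\<dots> = f {b, c} * ext_boundary n (ebasis S) T"
    proof -
      have "Min S = a" using abc by simp
      moreover have "S - {a} = {b, c}" using abc by auto
      ultimately show ?thesis by simp
    qed
    also have "\<dots> = f T"
    proof -
      have l: "{a, b, c} \<in> L" "{b, c, a} \<in> L" using S(1) abc(3) by (simp_all add: insert_commute)
      have e: "alt f a b = alt f b c" "alt f b c = alt f c a"
        using quadratic_condD(2)[OF q l(1)] quadratic_condD(2)[OF q l(2)] by simp_all
      then have fv: "f {a, b} = f {b, c}" "f {b, c} = - f {a, c}"
        using abc by (simp_all add: alt_def insert_commute)
      note B = alt_boundary_triple[OF abc(1,2) cn, where h = 0]
      have bv: "ext_boundary n (ebasis S) {a, b} = 1" "ext_boundary n (ebasis S) {a, c} = - 1"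
        "ext_boundary n (ebasis S) {b, c} = 1"
        using B[of a b] B[of a c] B[of b c] abc by (simp_all add: alt_def elem_def)
      have "T = {a, b} \<or> T = {a, c} \<or> T = {b, c}" using S(2,3) abc by auto
      then show ?thesis using fv bv by auto
    qed
    finally show ?thesis by simp
  next
    case False
    have "ext_boundary n (ebasis S) T = 0" if "S \<in> L" for S
      by (rule boundary_ebasis_0) (use False that in blast)
    then have "(\<Sum>S\<in>L. f (S - {Min S}) * ext_boundary n (ebasis S) T) = 0" by simp
    moreover have "f T = 0"
    proof (rule ccontr)
      assume T: "f T \<noteq> 0"
      then have "card T = 2" using ext_deg_nonzero[OF fd] by blast
      then obtain p r where pr: "p < r" "T = {p, r}" by (rule card2_obtain)
      then have "alt f p r \<noteq> 0" using T by (simp add: alt_def)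
      then obtain S where S: "S \<in> L" "{p, r} \<subseteq> S" using quadratic_condD(1)[OF q, of p r] by metis
      have "card (S - {p, r}) = 1" using card_line[OF S(1)] S(2) pr by (simp add: card_Diff_subset)
      then obtain s where "S - {p, r} = {s}" by (auto simp: card_1_singleton_iff)
      then have "s \<in> S" "T = S - {s}" using S(2) pr by auto
      then show False using False S(1) by blast
    qed
    ultimately show ?thesis by simp
  qed
  then show "f T = (\<Sum>S\<in>L. cscale (f (S - {Min S})) (ext_boundary n (ebasis S))) T"
    by (simp add: sum_cscale_apply)
qed

text \<open>The ideal of \<open>ext_ideal_quadratic\<close> contains all generators, which gives one
  inclusion. Conversely every ideal containing the generators contains the sums of
  \<open>quadratic_decompose\<close>.\<close>

lemma os_ideal_deg2: "os_ideal n \<alpha> \<inter> ext_deg n 2 = quadratic n L"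
proof
  let ?J = "{f \<in> ext_alg n. (\<forall>S. f S \<noteq> 0 \<longrightarrow> 2 \<le> card S) \<and> quadratic_cond L f}"
  let ?G = "{ext_boundary n (ebasis S) | S. S \<subseteq> {..n} \<and> cfun.dependent (\<alpha> ` S)}"
  have "?G \<subseteq> ?J"
  proof
    fix f assume "f \<in> ?G"
    then obtain S where S: "f = ext_boundary n (ebasis S)" "S \<subseteq> {..n}" "cfun.dependent (\<alpha> ` S)" by blast
    have c3: "3 \<le> card S" using low[OF S(2)] S(3) by (cases "card S \<le> 2") auto
    have "T \<subseteq> {..n} \<and> 2 \<le> card T" if nz: "f T \<noteq> 0" for T
    proof -
      obtain s where "s \<in> S" "T = S - {s}" using nz unfolding S(1) by (rule boundary_ebasis_nonzero)
      then show ?thesis using S(2) c3 by auto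
    qed
    then show "f \<in> ?J" using boundary_quadratic_cond[OF S(2,3)] S(1) by (simp add: ext_alg_def)
  qed
  then have "os_ideal n \<alpha> \<subseteq> ?J"
    unfolding os_ideal_def by (rule hull_minimal) (rule ext_ideal_quadratic)
  then show "os_ideal n \<alpha> \<inter> ext_deg n 2 \<subseteq> quadratic n L" unfolding quadratic_eq_Int by blast
  show "quadratic n L \<subseteq> os_ideal n \<alpha> \<inter> ext_deg n 2"
  proof
    fix f assume f: "f \<in> quadratic n L"
    have "f \<in> J" if J: "ext_ideal n J" "?G \<subseteq> J" for J
    proof -
      have sub: "cfun.subspace J" using J(1) by (simp add: ext_ideal_def)
      have "ext_boundary n (ebasis S) \<in> J" if "S \<in> L" for S
        using J(2) that unfolding L_def by blast
      then have "(\<Sum>S\<in>L. cscale (f (S - {Min S})) (ext_boundary n (ebasis S))) \<in> J"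
        by (intro cfun.subspace_sum cfun.subspace_scale sub)
      then show ?thesis using quadratic_decompose[OF f] by simp
    qed
    then have "f \<in> os_ideal n \<alpha>" unfolding os_ideal_def hull_def by blast
    then show "f \<in> os_ideal n \<alpha> \<inter> ext_deg n 2" using f by (simp add: quadratic_def)
  qed
qed

end

section \<open>The kernel of the multiplication map\<close>

text \<open>The elements \<open>ebasis {h}\<close> form a basis of degree 1, so a tensor is a list
  of n + 1 slices in Q.\<close>

lemma tensor_space_deg1:
  fixes Q :: "('a \<Rightarrow> complex) set"
  assumes Q: "cfun.subspace Q"
  shows "tensor_space (ext_deg n 1) Q =
    {t. (\<forall>S T. t (S, T) \<noteq> 0 \<longrightarrow> S \<subseteq> {..n} \<and> card S = 1) \<and> (\<forall>h. (\<lambda>T. t ({h}, T)) \<in> Q)}" (is "_ = ?W")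
proof
  have "cfun.subspace ?W"
    unfolding cfun.subspace_def
  proof (intro conjI ballI allI)
    show "0 \<in> ?W" using cfun.subspace_0[OF Q] by (simp add: zero_fun_def)
  next
    fix s t assume s: "s \<in> ?W" and t: "t \<in> ?W"
    have "S \<subseteq> {..n} \<and> card S = 1" if "(s + t) (S, T) \<noteq> 0" for S T
    proof -
      have "s (S, T) \<noteq> 0 \<or> t (S, T) \<noteq> 0" using that by auto
      then show ?thesis using s t by blast
    qed
    moreover have "(\<lambda>T. (s + t) ({h}, T)) \<in> Q" for h
      using cfun.subspace_add[OF Q, of "\<lambda>T. s ({h}, T)" "\<lambda>T. t ({h}, T)"] s t by (simp add: plus_fun_def)
    ultimately show "s + t \<in> ?W" by blast
  next
    fix c t assume t: "t \<in> ?W"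
    have "(\<lambda>T. cscale c t ({h}, T)) \<in> Q" for h
      using cfun.subspace_scale[OF Q, of "\<lambda>T. t ({h}, T)" c] t by (simp add: cscale_def)
    then show "cscale c t \<in> ?W" using t by (simp add: cscale_def)
  qed
  moreover have "tensor a b \<in> ?W" if "a \<in> ext_deg n 1" "b \<in> Q" for a b
  proof -
    have "(\<lambda>T. tensor a b ({h}, T)) \<in> Q" for h
      using cfun.subspace_scale[OF Q that(2), of "a {h}"] by (simp add: cscale_def tensor_def)
    moreover have "S \<subseteq> {..n} \<and> card S = 1" if "tensor a b (S, T) \<noteq> 0" for S T
      using \<open>a \<in> ext_deg n 1\<close> that by (simp add: tensor_def ext_deg_def ext_alg_def)
    ultimately show ?thesis by blast
  qed
  ultimately show "tensor_space (ext_deg n 1) Q \<subseteq> ?W"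
    unfolding tensor_space_def by (intro cfun.span_minimal) blast
  show "?W \<subseteq> tensor_space (ext_deg n 1) Q"
  proof
    fix t assume t: "t \<in> ?W"
    have "t = (\<Sum>h\<le>n. tensor (ebasis {h}) (\<lambda>T. t ({h}, T)))"
    proof
      fix x :: "nat set \<times> 'a"
      obtain S T where x: "x = (S, T)" by (cases x)
      have ap: "(\<Sum>h\<in>H. tensor (ebasis {h}) (\<lambda>T. t ({h}, T))) x = (\<Sum>h\<in>H. if S = {h} then t ({h}, T) else 0)" for H
        by (induction H rule: infinite_finite_induct) (auto simp: x tensor_def ebasis_def)
      show "t x = (\<Sum>h\<le>n. tensor (ebasis {h}) (\<lambda>T. t ({h}, T))) x"
      proof (cases "\<exists>h\<le>n. S = {h}")
        case True
        then obtain h where h: "h \<le> n" "S = {h}" by blast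
        have "(\<Sum>h'\<le>n. if S = {h'} then t ({h'}, T) else 0) = (\<Sum>h'\<le>n. if h' = h then t ({h}, T) else 0)"
          unfolding h(2) by (rule sum.cong) auto
        then show ?thesis unfolding ap using h x by simp
      next
        case False
        then have "t x = 0" using t unfolding x by (force simp: card_1_singleton_iff)
        moreover have "(\<Sum>h\<le>n. if S = {h} then t ({h}, T) else 0) = 0"
          by (rule sum.neutral) (use False in auto)
        ultimately show ?thesis unfolding ap by simp
      qed
    qed
    moreover have "tensor (ebasis {h}) (\<lambda>T. t ({h}, T)) \<in> tensor_space (ext_deg n 1) Q" if "h \<le> n" for h
    proof -
      have "ebasis {h} \<in> ext_deg n 1" using that by (simp add: ext_deg_def ext_alg_def ebasis_def)
      then show ?thesis unfolding tensor_space_def using t by (intro cfun.span_base) blast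
    qed
    then have "(\<Sum>h\<le>n. tensor (ebasis {h}) (\<lambda>T. t ({h}, T))) \<in> tensor_space (ext_deg n 1) Q"
      unfolding tensor_space_def by (intro cfun.span_sum) simp
    ultimately show "t \<in> tensor_space (ext_deg n 1) Q" by simp
  qed
qed

text \<open>Only singletons contribute. The sign -1 of the middle term is absorbed by reading
  \<open>alt\<close> at c, a, which turns the coefficient into the cyclic sum of
  \<open>cocycles\<close>.\<close>

lemma wedge_map_triple:
  assumes t: "\<And>S T. t (S, T) \<noteq> 0 \<Longrightarrow> card S = 1" and o: "a < b" "b < c"
  shows "wedge_map t {a, b, c} =
    alt (\<lambda>T. t ({a}, T)) b c + alt (\<lambda>T. t ({b}, T)) c a + alt (\<lambda>T. t ({c}, T)) a b"
proof -
  let ?U = "{a, b, c}" and ?F = "\<lambda>S. ext_sign S ({a, b, c} - S) * t (S, {a, b, c} - S)"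
  have z: "?F S = 0" if "S \<in> Pow ?U - {{a}, {b}, {c}}" for S
  proof -
    have "card S \<noteq> 1"
    proof
      assume "card S = 1"
      then obtain x where "S = {x}" by (auto simp: card_1_singleton_iff)
      then show False using that by auto
    qed
    then show ?thesis using t[of S "{a, b, c} - S"] by auto
  qed
  have "wedge_map t ?U = sum ?F {{a}, {b}, {c}}"
    unfolding wedge_map_def by (rule sum.mono_neutral_right) (use z in auto)
  also have "\<dots> = ?F {a} + ?F {b} + ?F {c}" using o by auto
  also have "{a, b, c} - {a} = {b, c}" using o by auto
  also have "{a, b, c} - {b} = {a, c}" using o by auto
  also have "{a, b, c} - {c} = {a, b}" using o by auto
  also have "ext_sign {a} {b, c} = 1"
  proof -
    have e: "{(s, t). s \<in> {a} \<and> t \<in> {b, c} \<and> t < s} = {}" using o by auto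
    show ?thesis unfolding ext_sign_def e by simp
  qed
  also have "ext_sign {b} {a, c} = - 1"
  proof -
    have e: "{(s, t). s \<in> {b} \<and> t \<in> {a, c} \<and> t < s} = {(b, a)}" using o by auto
    show ?thesis unfolding ext_sign_def e by simp
  qed
  also have "ext_sign {c} {a, b} = 1"
  proof -
    have e: "{(s, t). s \<in> {c} \<and> t \<in> {a, b} \<and> t < s} = {(c, a), (c, b)}" using o by auto
    have "card {(c, a), (c, b)} = 2" using o by simp
    then show ?thesis unfolding ext_sign_def e by simp
  qed
  finally show ?thesis using o by (simp add: alt_def insert_commute)
qed

lemma wedge_map_not3:
  assumes t: "\<And>S T. t (S, T) \<noteq> 0 \<Longrightarrow> card S = 1 \<and> card T = 2" and U: "card U \<noteq> 3"
  shows "wedge_map t U = 0"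
proof (cases "finite U")
  case True
  have "t (S, U - S) = 0" if "S \<subseteq> U" for S
  proof (rule ccontr)
    assume "t (S, U - S) \<noteq> 0"
    then have "card S = 1" "card (U - S) = 2" using t by blast+
    moreover have "finite S" using True that finite_subset by blast
    ultimately have "card U = 3" using card_Diff_subset[OF _ that] card_mono[OF True that] by simp
    then show False using U by simp
  qed
  then show ?thesis unfolding wedge_map_def by (intro sum.neutral) auto
next
  case False
  then show ?thesis by (simp add: wedge_map_def)
qed

text \<open>Inverse to taking the \<open>alt\<close> coordinates of all slices: \<open>Min\<close>
  and \<open>Max\<close> pick the order of a pair in which \<open>alt\<close> has sign +.\<close>

definition cocycle_tensor :: "nat \<Rightarrow> (nat \<times> nat \<times> nat \<Rightarrow> complex) \<Rightarrow> nat set \<times> nat set \<Rightarrow> complex" where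
  "cocycle_tensor n g = (\<lambda>(S, T). if S \<subseteq> {..n} \<and> T \<subseteq> {..n} \<and> card S = 1 \<and> card T = 2
     then g (Min S, Min T, Max T) else 0)"

lemma linear_cocycle_tensor: "Vector_Spaces.linear cscale cscale (cocycle_tensor n)"
  by unfold_locales (auto simp: cocycle_tensor_def cscale_def fun_eq_iff algebra_simps)

lemma cocycle_tensor_apply:
  "p < q \<Longrightarrow> cocycle_tensor n g ({h}, {p, q}) = (if h \<le> n \<and> p \<le> n \<and> q \<le> n then g (h, p, q) else 0)"
  by (simp add: cocycle_tensor_def)

lemma alt_cocycle_tensor:
  assumes g: "g \<in> precocycles {..n} L"
  shows "alt (\<lambda>T. cocycle_tensor n g ({h}, T)) p q = g (h, p, q)"
proof -
  have lt: "cocycle_tensor n g ({h}, {p, q}) = g (h, p, q)" if "p < q" for p q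
    using precocyclesD(1)[OF g, of h p q] that by (auto simp: cocycle_tensor_apply)
  show ?thesis
  proof (cases p q rule: linorder_cases)
    case less
    then show ?thesis using lt by (simp add: alt_def)
  next
    case equal
    then show ?thesis using precocyclesD(2)[OF g, of h p p] by (simp add: alt_def)
  next
    case greater
    then show ?thesis using lt[OF greater] precocyclesD(2)[OF g, of h p q] by (simp add: alt_def insert_commute)
  qed
qed

lemma inj_on_cocycle_tensor: "inj_on (cocycle_tensor n) (precocycles {..n} L)"
proof (rule inj_onI)
  fix f g assume fg: "f \<in> precocycles {..n} L" "g \<in> precocycles {..n} L" "cocycle_tensor n f = cocycle_tensor n g"
  show "f = g"
  proof
    fix x :: "nat \<times> nat \<times> nat"
    obtain h p q where x: "x = (h, p, q)" by (cases x)
    show "f x = g x" unfolding x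
      using alt_cocycle_tensor[OF fg(1), of h p q] alt_cocycle_tensor[OF fg(2), of h p q] fg(3) by simp
  qed
qed

lemma kernel_eq_cocycles:
  "{t \<in> tensor_space (ext_deg n 1) (quadratic n L). wedge_map t = 0} = cocycle_tensor n ` cocycles {..n} L"
proof (intro equalityI subsetI)
  fix t assume "t \<in> cocycle_tensor n ` cocycles {..n} L"
  then obtain g where g: "g \<in> cocycles {..n} L" "t = cocycle_tensor n g" by blast
  note pre = cocycles_precocycles[OF g(1)]
  have alt_t: "alt (\<lambda>T. t ({h}, T)) p q = g (h, p, q)" for h p q
    unfolding g(2) by (rule alt_cocycle_tensor[OF pre])
  have supp: "S \<subseteq> {..n} \<and> T \<subseteq> {..n} \<and> card S = 1 \<and> card T = 2" if "t (S, T) \<noteq> 0" for S T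
    using that unfolding g(2) cocycle_tensor_def by (simp split: if_splits)
  have "(\<lambda>T. t ({h}, T)) \<in> quadratic n L" for h
  proof -
    have "(\<lambda>T. t ({h}, T)) \<in> ext_deg n 2" by (rule ext_degI) (use supp in blast)
    moreover have "quadratic_cond L (\<lambda>T. t ({h}, T))"
      unfolding quadratic_cond_def alt_t using precocyclesD(3,4)[OF pre] by (intro conjI allI impI)
    ultimately show ?thesis by (simp add: quadratic_def)
  qed
  then have "t \<in> tensor_space (ext_deg n 1) (quadratic n L)"
    unfolding tensor_space_deg1[OF subspace_quadratic] using supp by blast
  moreover have "wedge_map t U = 0" for U
  proof (cases "card U = 3")
    case True
    then obtain a b c where abc: "a < b" "b < c" "U = {a, b, c}" by (rule card3_obtain)
    have "wedge_map t U = g (a, b, c) + g (b, c, a) + g (c, a, b)"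
      unfolding abc(3) alt_t[symmetric] by (rule wedge_map_triple[OF _ abc(1,2)]) (use supp in blast)
    then show ?thesis using cocycles_sum_0[OF g(1), of a b c] by simp
  next
    case False
    show ?thesis by (rule wedge_map_not3[OF _ False]) (use supp in blast)
  qed
  ultimately show "t \<in> {t \<in> tensor_space (ext_deg n 1) (quadratic n L). wedge_map t = 0}"
    by (simp add: fun_eq_iff)
next
  fix t assume "t \<in> {t \<in> tensor_space (ext_deg n 1) (quadratic n L). wedge_map t = 0}"
  then have t: "\<And>S T. t (S, T) \<noteq> 0 \<Longrightarrow> S \<subseteq> {..n} \<and> card S = 1"
      "\<And>h. (\<lambda>T. t ({h}, T)) \<in> quadratic n L" and w: "wedge_map t = 0"
    unfolding tensor_space_deg1[OF subspace_quadratic] by blast+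
  define g where "g = (\<lambda>(h, p, q). alt (\<lambda>T. t ({h}, T)) p q)"
  have g: "g (h, p, q) = alt (\<lambda>T. t ({h}, T)) p q" for h p q by (simp add: g_def)
  have swap: "g (h, q, p) = - g (h, p, q)" for h p q unfolding g by (rule alt_swap)
  have q: "quadratic_cond L (\<lambda>T. t ({h}, T))" and d2: "(\<lambda>T. t ({h}, T)) \<in> ext_deg n 2" for h
    using t(2)[of h] by (simp_all add: quadratic_def)
  have supp: "S \<subseteq> {..n} \<and> card S = 1 \<and> T \<subseteq> {..n} \<and> card T = 2" if "t (S, T) \<noteq> 0" for S T
  proof -
    have 1: "S \<subseteq> {..n} \<and> card S = 1" using that by (rule t(1))
    then obtain h where h: "S = {h}" by (auto simp: card_1_singleton_iff)
    show ?thesis using 1 ext_deg_nonzero[OF d2, of h T] that h by simp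
  qed
  have "g \<in> precocycles {..n} L"
  proof (rule precocyclesI)
    show "g (h, q, p) = - g (h, p, q)" for h p q by (rule swap)
    show "g (h, p, q) = 0" if "\<forall>T\<in>L. \<not> {p, q} \<subseteq> T" for h p q
      unfolding g using q that by (rule quadratic_condD(1))
    show "g (h, p, q) = g (h, q, r)" if "{p, q, r} \<in> L" for h p q r
      unfolding g using q that by (rule quadratic_condD(2))
    show "h \<in> {..n} \<and> p \<in> {..n} \<and> q \<in> {..n}" if "g (h, p, q) \<noteq> 0" for h p q
    proof -
      have "t ({h}, {p, q}) \<noteq> 0" using that unfolding g alt_def by (simp split: if_splits)
      then show ?thesis using supp[of "{h}" "{p, q}"] by simp
    qed
  qed
  \<comment> \<open>\<open>wedge_map\<close> yields the relation for increasing triples. Other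
    orders follow by rotation and antisymmetry, and a repeated index makes the sum cancel.\<close>
  moreover have "g (h, p, q) + g (p, q, h) + g (q, h, p) = 0" for h p q
  proof -
    have sorted: "g (a, b, c) + g (b, c, a) + g (c, a, b) = 0" if "a < b" "b < c" for a b c
    proof -
      have "wedge_map t {a, b, c} = g (a, b, c) + g (b, c, a) + g (c, a, b)"
        unfolding g by (rule wedge_map_triple[OF _ that]) (use t(1) in blast)
      then show ?thesis using w by simp
    qed
    have diag: "g (x, y, y) = 0" for x y using swap[of x y y] by simp
    consider "h = p" | "p = q" | "h = q" | "h < p" "p < q" | "p < q" "q < h" | "q < h" "h < p"
      | "h < q" "q < p" | "q < p" "p < h" | "p < h" "h < q" by linarith
    then show ?thesis
    proof cases
      case 1
      then show ?thesis using swap[of h q h] diag by simp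
    next
      case 2
      then show ?thesis using swap[of p p h] diag by simp
    next
      case 3
      then show ?thesis using swap[of h p h] diag by simp
    next
      case 4
      then show ?thesis using sorted[of h p q] by simp
    next
      case 5
      then show ?thesis using sorted[of p q h] by (simp add: algebra_simps)
    next
      case 6
      then show ?thesis using sorted[of q h p] by (simp add: algebra_simps)
    next
      case 7
      then show ?thesis using sorted[of h q p] swap[of h q p] swap[of p h q] swap[of q p h]
        by (simp add: algebra_simps add_eq_0_iff)
    next
      case 8
      then show ?thesis using sorted[of q p h] swap[of h q p] swap[of p h q] swap[of q p h]
        by (simp add: algebra_simps add_eq_0_iff)
    next
      case 9
      then show ?thesis using sorted[of p h q] swap[of h q p] swap[of p h q] swap[of q p h]
        by (simp add: algebra_simps add_eq_0_iff)
    qed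
  qed
  ultimately have "g \<in> cocycles {..n} L" by (rule cocyclesI)
  moreover have "t = cocycle_tensor n g"
  proof
    fix x :: "nat set \<times> nat set"
    obtain S T where x: "x = (S, T)" by (cases x)
    show "t x = cocycle_tensor n g x"
    proof (cases "S \<subseteq> {..n} \<and> T \<subseteq> {..n} \<and> card S = 1 \<and> card T = 2")
      case True
      obtain h where h: "S = {h}" using True by (auto simp: card_1_singleton_iff)
      obtain p q where pq: "p < q" "T = {p, q}" using True card2_obtain by metis
      show ?thesis using True pq(1) unfolding x h pq(2) by (simp add: cocycle_tensor_apply g alt_def)
    next
      case False
      then have "t x = 0" using supp unfolding x by blast
      then show ?thesis using False unfolding x cocycle_tensor_def by auto
    qed
  qed
  ultimately show "t \<in> cocycle_tensor n ` cocycles {..n} L" by blast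
qed

section \<open>Dependent triples of the defining forms\<close>

fun form :: "pt \<Rightarrow> nat \<Rightarrow> complex" where
  "form Z = (\<lambda>k. of_bool (k = 0))"
| "form (E i j g) = (\<lambda>k. of_bool (k = i) - of_bool (k = j) - of_nat g * of_bool (k = 0))"

lemma E_in_shi_points: "E i j g \<in> shi_points l \<longleftrightarrow> 1 \<le> i \<and> i < j \<and> j \<le> l \<and> g \<le> 1"
  by (auto simp: shi_points_def)

lemma forms_pair_independent:
  assumes P: "P \<in> shi_points l" "Q \<in> shi_points l" "P \<noteq> Q" and eq: "\<And>m. u * form P m + v * form Q m = 0"
  shows "u = 0 \<and> v = 0"
proof -
  have ZE: "u = 0 \<and> v = 0" if "E i j g \<in> shi_points l" "\<And>m. u * form Z m + v * form (E i j g) m = 0" for u v i j g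
    using that(1) that(2)[of i] that(2)[of 0] by (auto simp: E_in_shi_points)
  show ?thesis
  proof (cases P)
    case Z
    then obtain i j g where "Q = E i j g" using P by (cases Q) auto
    then show ?thesis using ZE[of i j g u v] Z P eq by simp
  next
    case p: (E i j g)
    show ?thesis
    proof (cases Q)
      case Z
      then show ?thesis using ZE[of i j g v u] p P eq by (simp add: add.commute)
    next
      case q: (E i' j' g')
      have o: "1 \<le> i" "i < j" "g \<le> 1" "1 \<le> i'" "i' < j'" "g' \<le> 1" using P p q by (simp_all add: E_in_shi_points)
      note e = eq[of i] eq[of j] eq[of i'] eq[of j'] eq[of 0]
      show ?thesis
      proof (cases "i = i' \<and> j = j'")
        case True
        then have "g \<noteq> g'" using P(3) p q by simp
        then have "g = 0 \<and> g' = 1 \<or> g = 1 \<and> g' = 0" using o by auto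
        then show ?thesis using e True o unfolding p q by auto
      next
        case False
        \<comment> \<open>Since the edges have different pairs of ends, both in increasing order,
          some end of the first is not an end of the second, and its coordinate isolates u.\<close>
        then consider "i \<noteq> i'" "i \<noteq> j'" | "j \<noteq> i'" "j \<noteq> j'" using o by linarith
        then show ?thesis
        proof cases
          case 1
          then have "u = 0" using e(1) o unfolding p q by auto
          then show ?thesis using e(3) o unfolding p q by auto
        next
          case 2
          then have "u = 0" using e(2) o unfolding p q by auto
          then show ?thesis using e(3) o unfolding p q by auto
        qed
      qed
    qed
  qed
qed

text \<open>The coordinates p and r give x = y = -z, and coordinate 0 then compares the
  gains.\<close>

lemma triangle_form_line:
  assumes o: "1 \<le> p" "p < q" "q < r" "r \<le> l" "c \<le> 1"
    and eq: "\<And>m. x * form (E p q a) m + y * form (E q r b) m + z * form (E p r c) m = 0"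
    and z: "z \<noteq> 0"
  shows "{E p q a, E q r b, E p r c} \<in> shi_lines l"
proof -
  have "x = - z" using eq[of p] o by (auto simp: add_eq_0_iff2)
  moreover have "y = - z" using eq[of r] o by (auto simp: add_eq_0_iff2 algebra_simps)
  ultimately have "z * (of_nat a + of_nat b - of_nat c) = 0" using eq[of 0] o by (simp add: algebra_simps)
  then have "of_nat (a + b) = (of_nat c :: complex)" using z by simp
  then have "c = a + b" by (simp only: of_nat_eq_iff)
  then show ?thesis using shi_line_triangle[of p q r l a b] o by simp
qed

text \<open>With nonzero coefficients every index lies on at least two of the three edges, so the
  edges form a triangle or are all parallel. Three parallel edges cannot have distinct gains in {0,
  1}.\<close>

lemma forms_edges_dependent:
  assumes P: "P = E i j g" "Q = E i' j' g'" "R = E i'' j'' g''" "P \<in> shi_points l" "Q \<in> shi_points l" "R \<in> shi_points l"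
    and ne: "P \<noteq> Q" "P \<noteq> R" "Q \<noteq> R"
    and eq: "\<And>m. u * form P m + v * form Q m + w * form R m = 0"
    and nz: "u \<noteq> 0" "v \<noteq> 0" "w \<noteq> 0"
  shows "{P, Q, R} \<in> shi_lines l"
proof -
  have o: "1 \<le> i" "i < j" "j \<le> l" "g \<le> 1" "1 \<le> i'" "i' < j'" "j' \<le> l" "g' \<le> 1" "1 \<le> i''" "i'' < j''" "j'' \<le> l" "g'' \<le> 1"
    using P by (simp_all add: E_in_shi_points)
  have e: "u * (of_bool (m = i) - of_bool (m = j) - of_nat g * of_bool (m = 0))
      + v * (of_bool (m = i') - of_bool (m = j') - of_nat g' * of_bool (m = 0))
      + w * (of_bool (m = i'') - of_bool (m = j'') - of_nat g'' * of_bool (m = 0)) = 0" for m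
    using eq[of m] unfolding P(1-3) by simp
  have deg1: "m \<in> {i', j', i'', j''}" if "m \<in> {i, j}" for m
    using e[of m] that o nz by (auto simp: of_bool_def split: if_splits)
  have deg2: "m \<in> {i, j, i'', j''}" if "m \<in> {i', j'}" for m
    using e[of m] that o nz by (auto simp: of_bool_def split: if_splits)
  have deg3: "m \<in> {i, j, i', j'}" if "m \<in> {i'', j''}" for m
    using e[of m] that o nz by (auto simp: of_bool_def split: if_splits)
  have deg: "i \<in> {i', j', i'', j''}" "j \<in> {i', j', i'', j''}" "i' \<in> {i, j, i'', j''}" "j' \<in> {i, j, i'', j''}"
    "i'' \<in> {i, j, i', j'}" "j'' \<in> {i, j, i', j'}"
    using deg1 deg2 deg3 by auto
  have par: "(i, j) \<noteq> (i', j')" "(i, j) \<noteq> (i'', j'')" "(i', j') \<noteq> (i'', j'')"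
  proof -
    have "\<not> ((i, j) = (i', j') \<and> (i, j) = (i'', j''))" using ne o unfolding P(1-3) by auto
    moreover have "(i, j) = (i'', j'')" if "(i, j) = (i', j')" using that deg(5,6) o by auto
    moreover have "(i, j) = (i', j')" if "(i, j) = (i'', j'')" using that deg(3,4) o by auto
    moreover have "(i, j) = (i', j')" if "(i', j') = (i'', j'')" using that deg(1,2) o by auto
    ultimately show "(i, j) \<noteq> (i', j')" "(i, j) \<noteq> (i'', j'')" "(i', j') \<noteq> (i'', j'')" by metis+
  qed
  have "j = i' \<and> i'' = i \<and> j'' = j' \<or> j = i'' \<and> i' = i \<and> j' = j'' \<or> j' = i \<and> i'' = i' \<and> j'' = j \<or>
    j' = i'' \<and> i = i' \<and> j = j'' \<or> j'' = i \<and> i' = i'' \<and> j' = j \<or> j'' = i' \<and> i = i'' \<and> j = j'"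
  proof -
    have d: "i = i' \<or> i = j' \<or> i = i'' \<or> i = j''" "j = i' \<or> j = j' \<or> j = i'' \<or> j = j''"
      "i' = i \<or> i' = j \<or> i' = i'' \<or> i' = j''" "j' = i \<or> j' = j \<or> j' = i'' \<or> j' = j''"
      "i'' = i \<or> i'' = j \<or> i'' = i' \<or> i'' = j'" "j'' = i \<or> j'' = j \<or> j'' = i' \<or> j'' = j'"
      using deg by simp_all
    have o': "i < j" "i' < j'" "i'' < j''" by (fact o)+
    show ?thesis using d(1,2) by (elim disjE; use d(3-6) par o' in \<open>simp; linarith?\<close>)
  qed
  then consider "j = i'" "i'' = i" "j'' = j'" | "j = i''" "i' = i" "j' = j''" | "j' = i" "i'' = i'" "j'' = j"
    | "j' = i''" "i = i'" "j = j''" | "j'' = i" "i' = i''" "j' = j" | "j'' = i'" "i = i''" "j = j'"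
    by (elim disjE conjE)
  then show ?thesis
  proof cases
    case 1
    then show ?thesis using triangle_form_line[of i j j' l g'' u g v g' w] eq o nz P by simp
  next
    case 2
    then show ?thesis using triangle_form_line[of i j j'' l g' u g w g'' v] eq o nz P
      by (simp add: insert_commute algebra_simps)
  next
    case 3
    then show ?thesis using triangle_form_line[of i' i j l g'' v g' u g w] eq o nz P
      by (simp add: insert_commute algebra_simps)
  next
    case 4
    then show ?thesis using triangle_form_line[of i j' j l g v g' w g'' u] eq o nz P
      by (simp add: insert_commute algebra_simps)
  next
    case 5
    then show ?thesis using triangle_form_line[of i' i j l g' w g'' u g v] eq o nz P
      by (simp add: insert_commute algebra_simps)
  next
    case 6
    then show ?thesis using triangle_form_line[of i i' j l g w g'' v g' u] eq o nz P
      by (simp add: insert_commute algebra_simps)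
  qed
qed

text \<open>Coefficients are indexed by points instead of vectors, so that relations between
  rescaled forms can be compared index by index.\<close>

definition forms_dependent :: "pt set \<Rightarrow> bool" where
  "forms_dependent S \<longleftrightarrow> (\<exists>c :: pt \<Rightarrow> complex. (\<exists>P\<in>S. c P \<noteq> 0) \<and> (\<forall>m. (\<Sum>P\<in>S. c P * form P m) = 0))"

lemma form_nonzero: "P \<in> shi_points l \<Longrightarrow> \<exists>k. form P k \<noteq> 0"
proof (cases P)
  case Z
  then show ?thesis by (intro exI[of _ 0]) simp
next
  case (E i j g)
  assume "P \<in> shi_points l"
  then show ?thesis unfolding E by (intro exI[of _ i]) (auto simp: E_in_shi_points)
qed

lemma forms_independent_le2:
  assumes S: "S \<subseteq> shi_points l" "finite S" "card S \<le> 2"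
  shows "\<not> forms_dependent S"
proof
  assume "forms_dependent S"
  then obtain c where c: "\<exists>P\<in>S. c P \<noteq> 0" "\<And>m. (\<Sum>P\<in>S. c P * form P m) = 0"
    unfolding forms_dependent_def by blast
  then have "card S \<noteq> 0" using S(2) by auto
  then consider "card S = 1" | "card S = 2" using S(3) by linarith
  then show False
  proof cases
    case 1
    then obtain P where P: "S = {P}" by (auto simp: card_1_singleton_iff)
    then obtain k where "form P k \<noteq> 0" using S(1) form_nonzero by blast
    then show False using c(1) c(2)[of k] P by simp
  next
    case 2
    then obtain P Q where PQ: "S = {P, Q}" "P \<noteq> Q" by (auto simp: card_2_iff)
    then have "c P * form P m + c Q * form Q m = 0" for m using c(2)[of m] by simp
    then have "c P = 0 \<and> c Q = 0" using forms_pair_independent[of P l Q "c P" "c Q"] S(1) PQ by simp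
    then show False using c(1) PQ by simp
  qed
qed

lemma forms_Z_dependent:
  assumes P: "E i j g \<in> shi_points l" "E i' j' g' \<in> shi_points l" "E i j g \<noteq> E i' j' g'"
    and eq: "\<And>m. u * form Z m + v * form (E i j g) m + w * form (E i' j' g') m = 0" and nz: "v \<noteq> 0" "w \<noteq> 0"
  shows "{Z, E i j g, E i' j' g'} \<in> shi_lines l"
proof -
  have o: "1 \<le> i" "i < j" "j \<le> l" "g \<le> 1" "1 \<le> i'" "i' < j'" "g' \<le> 1" using P by (simp_all add: E_in_shi_points)
  have "i = i' \<or> i = j'" using eq[of i] o nz by (cases "i = i'"; cases "i = j'") auto
  moreover have "j = i' \<or> j = j'" using eq[of j] o nz by (cases "j = i'"; cases "j = j'") auto
  ultimately have ij: "i' = i" "j' = j" using o by auto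
  then have "g \<noteq> g'" using P(3) by simp
  then have "g = 0 \<and> g' = 1 \<or> g = 1 \<and> g' = 0" using o by auto
  then show ?thesis using shi_line_parallel[of i j l] o ij by (auto simp: insert_commute)
qed

lemma forms_dependent_iff_line:
  assumes S: "S \<subseteq> shi_points l" "card S = 3"
  shows "forms_dependent S \<longleftrightarrow> S \<in> shi_lines l"
proof
  assume "forms_dependent S"
  then obtain c where c: "\<exists>P\<in>S. c P \<noteq> 0" "\<And>m. (\<Sum>P\<in>S. c P * form P m) = 0"
    unfolding forms_dependent_def by blast
  obtain P Q R where PQR: "S = {P, Q, R}" "P \<noteq> Q" "Q \<noteq> R" "P \<noteq> R" using S(2) by (auto simp: card_3_iff)
  have mem: "P \<in> shi_points l" "Q \<in> shi_points l" "R \<in> shi_points l" using S(1) PQR(1) by auto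
  have eq: "c P * form P m + c Q * form Q m + c R * form R m = 0" for m
    using c(2)[of m] PQR by (simp add: add.assoc)
  \<comment> \<open>A zero coefficient would leave a nontrivial relation between two of the
    forms.\<close>
  have nz: "c P \<noteq> 0 \<and> c Q \<noteq> 0 \<and> c R \<noteq> 0"
  proof (rule ccontr)
    assume "\<not> ?thesis"
    then consider "c P = 0" | "c Q = 0" | "c R = 0" by blast
    then have "c P = 0 \<and> c Q = 0 \<and> c R = 0"
    proof cases
      case 1
      then show ?thesis using forms_pair_independent[OF mem(2,3) PQR(3), of "c Q" "c R"] eq by simp
    next
      case 2
      then show ?thesis using forms_pair_independent[OF mem(1,3) PQR(4), of "c P" "c R"] eq by simp
    next
      case 3
      then show ?thesis using forms_pair_independent[OF mem(1,2) PQR(2), of "c P" "c Q"] eq by simp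
    qed
    then show False using c(1) PQR(1) by auto
  qed
  show "S \<in> shi_lines l"
  proof (cases P)
    case Z
    obtain i j g where Q: "Q = E i j g" using PQR Z by (cases Q) auto
    obtain i' j' g' where R: "R = E i' j' g'" using PQR Z by (cases R) auto
    show ?thesis using forms_Z_dependent[of i j g l i' j' g' "c P" "c Q" "c R"] mem PQR eq nz
      unfolding Z Q R by simp
  next
    case P: (E i j g)
    show ?thesis
    proof (cases Q)
      case Z
      obtain i' j' g' where R: "R = E i' j' g'" using PQR Z by (cases R) auto
      have "c Q * form Z m + c P * form P m + c R * form R m = 0" for m
        using eq[of m] unfolding Z by (simp only: add.commute add.left_commute)
      then show ?thesis using forms_Z_dependent[of i j g l i' j' g' "c Q" "c P" "c R"] mem PQR nz
        unfolding Z P R by (simp add: insert_commute)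
    next
      case Q: (E i' j' g')
      show ?thesis
      proof (cases R)
        case Z
        have "c R * form Z m + c P * form P m + c Q * form Q m = 0" for m
          using eq[of m] unfolding Z by (simp only: add.commute add.left_commute)
        then show ?thesis using forms_Z_dependent[of i j g l i' j' g' "c R" "c P" "c Q"] mem PQR nz
          unfolding Z P Q by (simp add: insert_commute)
      next
        case R: (E i'' j'' g'')
        show ?thesis unfolding PQR(1)
          using forms_edges_dependent[OF P Q R mem PQR(2,4,3) eq] nz by blast
      qed
    qed
  qed
next
  assume "S \<in> shi_lines l"
  then show "forms_dependent S"
  proof (cases rule: shi_lines_cases)
    case (1 i j)
    show ?thesis unfolding forms_dependent_def 1(4)
      by (intro exI[of _ "\<lambda>P. if P = E i j 0 then 1 else - 1"]) simp
  next
    case (2 i j k a b)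
    show ?thesis unfolding forms_dependent_def 2(6) using 2(2,3)
      by (intro exI[of _ "\<lambda>P. if P = E i k (a + b) then - 1 else 1"]) (simp add: algebra_simps)
  qed
qed

section \<open>From linear forms to hyperplanes\<close>

lemma dependent_image_iff:
  assumes "finite S" "inj_on \<alpha> S"
  shows "cfun.dependent (\<alpha> ` S) \<longleftrightarrow> (\<exists>c. (\<exists>i\<in>S. c i \<noteq> 0) \<and> (\<forall>m. (\<Sum>i\<in>S. c i * \<alpha> i m) = 0))"
proof
  assume "cfun.dependent (\<alpha> ` S)"
  then obtain u where u: "\<exists>v\<in>\<alpha> ` S. u v \<noteq> 0" "(\<Sum>v\<in>\<alpha> ` S. cscale (u v) v) = 0"
    using cfun.dependent_finite[of "\<alpha> ` S"] assms(1) by auto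
  have "(\<Sum>i\<in>S. u (\<alpha> i) * \<alpha> i m) = (\<Sum>v\<in>\<alpha> ` S. cscale (u v) v) m" for m
    by (simp add: sum.reindex[OF assms(2)] sum_cscale_apply)
  then show "\<exists>c. (\<exists>i\<in>S. c i \<noteq> 0) \<and> (\<forall>m. (\<Sum>i\<in>S. c i * \<alpha> i m) = 0)"
    using u by (intro exI[of _ "\<lambda>i. u (\<alpha> i)"]) auto
next
  assume "\<exists>c. (\<exists>i\<in>S. c i \<noteq> 0) \<and> (\<forall>m. (\<Sum>i\<in>S. c i * \<alpha> i m) = 0)"
  then obtain c where c: "\<exists>i\<in>S. c i \<noteq> 0" "\<And>m. (\<Sum>i\<in>S. c i * \<alpha> i m) = 0" by blast
  let ?u = "\<lambda>v. c (inv_into S \<alpha> v)"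
  have "(\<Sum>v\<in>\<alpha> ` S. cscale (?u v) v) = (\<Sum>i\<in>S. cscale (c i) (\<alpha> i))"
    by (simp add: sum.reindex[OF assms(2)] assms(2))
  also have "\<dots> = 0" by (rule ext) (simp add: sum_cscale_apply c(2))
  finally have "(\<Sum>v\<in>\<alpha> ` S. cscale (?u v) v) = 0" .
  moreover have "\<exists>v\<in>\<alpha> ` S. ?u v \<noteq> 0" using c(1) assms(2) by (metis image_eqI inv_into_f_f)
  ultimately show "cfun.dependent (\<alpha> ` S)" using cfun.dependent_finite[of "\<alpha> ` S"] assms(1) by auto
qed

lemma sum_of_bool_mult: "(m :: nat) \<le> l \<Longrightarrow> (\<Sum>k\<le>l. of_bool (k = m) * x k) = (x m :: complex)"
proof -
  assume "m \<le> l"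
  have "(\<Sum>k\<le>l. of_bool (k = m) * x k) = (\<Sum>k\<le>l. if k = m then x k else 0)" by (rule sum.cong) auto
  then show ?thesis using \<open>m \<le> l\<close> by simp
qed

lemma hyperplane_proportional:
  assumes ab: "a \<in> coord_space l" "b \<in> coord_space l" and k: "b k \<noteq> 0" and H: "hyperplane l a = hyperplane l b"
  shows "\<exists>c. c \<noteq> 0 \<and> a = cscale c b"
proof -
  have kl: "k \<le> l" using ab(2) k by (auto simp: coord_space_def not_less[symmetric])
  have m: "a m * b k = a k * b m" if "m \<le> l" for m
  proof -
    \<comment> \<open>The vector b_k e_m - b_m e_k lies on the hyperplane of b; evaluating a on it
      yields the proportionality.\<close>
    let ?x = "\<lambda>i. b k * of_bool (i = m) - b m * of_bool (i = k)"
    have s: "(\<Sum>i\<le>l. c i * ?x i) = c m * b k - c k * b m" for c :: "nat \<Rightarrow> complex"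
    proof -
      have "(\<Sum>i\<le>l. c i * ?x i) = (\<Sum>i\<le>l. of_bool (i = m) * (c i * b k) - of_bool (i = k) * (c i * b m))"
        by (rule sum.cong) (auto simp: algebra_simps)
      also have "\<dots> = c m * b k - c k * b m"
        by (simp only: sum_subtractf sum_of_bool_mult[OF that] sum_of_bool_mult[OF kl])
      finally show ?thesis .
    qed
    have "?x \<in> hyperplane l b" using kl that s[of b] by (simp add: hyperplane_def coord_space_def)
    then have "?x \<in> hyperplane l a" unfolding H .
    then have "(\<Sum>i\<le>l. a i * ?x i) = 0" by (simp add: hyperplane_def)
    then show ?thesis using s[of a] by simp
  qed
  have eq: "a = cscale (a k / b k) b"
  proof
    fix i show "a i = cscale (a k / b k) b i"
    proof (cases "i \<le> l")
      case True
      then show ?thesis using m[of i] k by (simp add: cscale_def field_simps)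
    next
      case False
      then show ?thesis using ab by (simp add: cscale_def coord_space_def)
    qed
  qed
  moreover have "a k / b k \<noteq> 0"
  proof
    assume z: "a k / b k = 0"
    have "a i = 0" for i using fun_cong[OF eq, of i] unfolding z by (simp add: cscale_def)
    then have "a = 0" by (simp add: fun_eq_iff)
    \<comment> \<open>If a were zero its hyperplane would be the whole space, but the k-th unit
      vector is not on the hyperplane of b.\<close>
    moreover let ?d = "\<lambda>i. of_bool (i = k) :: complex"
    have "?d \<in> coord_space l" using kl by (simp add: coord_space_def)
    ultimately have "?d \<in> hyperplane l b" using H by (auto simp: hyperplane_def)
    then have "(\<Sum>i\<le>l. ?d i * b i) = 0" by (simp add: hyperplane_def mult.commute)
    then show False using k sum_of_bool_mult[OF kl, of b] by simp
  qed
  ultimately show ?thesis by blast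
qed

lemma form_coord_space: "P \<in> shi_points l \<Longrightarrow> form P \<in> coord_space l"
  by (cases P) (auto simp: coord_space_def E_in_shi_points)

lemma hyperplane_form_Z: "hyperplane l (form Z) = {x \<in> coord_space l. x 0 = 0}"
  using sum_of_bool_mult[of 0 l] by (simp add: hyperplane_def)

lemma hyperplane_form_E:
  assumes "1 \<le> i" "i < j" "j \<le> l"
  shows "hyperplane l (form (E i j g)) = {x \<in> coord_space l. x i - x j - of_nat g * x 0 = 0}"
proof -
  have "(\<Sum>k\<le>l. form (E i j g) k * x k) = x i - x j - of_nat g * x 0" for x
  proof -
    have "(\<Sum>k\<le>l. form (E i j g) k * x k) =
        (\<Sum>k\<le>l. of_bool (k = i) * x k - of_bool (k = j) * x k - of_bool (k = 0) * (of_nat g * x k))"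
      by (rule sum.cong) (auto simp: algebra_simps)
    also have "\<dots> = x i - x j - of_nat g * x 0"
      using assms by (simp only: sum_subtractf sum_of_bool_mult)
    finally show ?thesis .
  qed
  then show ?thesis by (simp add: hyperplane_def del: form.simps)
qed

lemma shi_cone_eq_image: "shi_cone l = (\<lambda>P. hyperplane l (form P)) ` shi_points l"
proof -
  have shi_points: "shi_points l = {Z} \<union> {E i j 0 | i j. 1 \<le> i \<and> i < j \<and> j \<le> l} \<union> {E i j 1 | i j. 1 \<le> i \<and> i < j \<and> j \<le> l}"
    by (auto simp: shi_points_def le_Suc_eq)
  have img: "(\<lambda>P. hyperplane l (form P)) ` {E i j g | i j. 1 \<le> i \<and> i < j \<and> j \<le> l} =
      {{x \<in> coord_space l. x i - x j - of_nat g * x 0 = 0} | i j. 1 \<le> i \<and> i < j \<and> j \<le> l}" for g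
  proof (intro equalityI subsetI)
    fix H assume "H \<in> (\<lambda>P. hyperplane l (form P)) ` {E i j g | i j. 1 \<le> i \<and> i < j \<and> j \<le> l}"
    then obtain i j where "H = hyperplane l (form (E i j g))" "1 \<le> i" "i < j" "j \<le> l" by blast
    then show "H \<in> {{x \<in> coord_space l. x i - x j - of_nat g * x 0 = 0} | i j. 1 \<le> i \<and> i < j \<and> j \<le> l}"
      using hyperplane_form_E[of i j l g] by blast
  next
    fix H assume "H \<in> {{x \<in> coord_space l. x i - x j - of_nat g * x 0 = 0} | i j. 1 \<le> i \<and> i < j \<and> j \<le> l}"
    then obtain i j where "H = {x \<in> coord_space l. x i - x j - of_nat g * x 0 = 0}" "1 \<le> i" "i < j" "j \<le> l"
      by blast
    then show "H \<in> (\<lambda>P. hyperplane l (form P)) ` {E i j g | i j. 1 \<le> i \<and> i < j \<and> j \<le> l}"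
      using hyperplane_form_E[of i j l g] by blast
  qed
  show ?thesis
    unfolding shi_cone_def shi_points image_Un img by (simp add: hyperplane_form_Z del: form.simps)
qed

lemma inj_on_hyperplane_form: "inj_on (\<lambda>P. hyperplane l (form P)) (shi_points l)"
proof (rule inj_onI, rule ccontr)
  fix P Q assume P: "P \<in> shi_points l" "Q \<in> shi_points l" "hyperplane l (form P) = hyperplane l (form Q)" "P \<noteq> Q"
  obtain k where k: "form Q k \<noteq> 0" using form_nonzero[OF P(2)] by blast
  obtain c where "form P = cscale c (form Q)"
    using hyperplane_proportional[OF form_coord_space[OF P(1)] form_coord_space[OF P(2)] k P(3)] by blast
  then have "1 * form P m + (- c) * form Q m = 0" for m by (simp add: cscale_def)
  then show False using forms_pair_independent[OF P(1,2,4), of 1 "- c"] by simp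
qed

theorem theorem6p2:
  fixes l n :: nat and \<alpha> :: "nat \<Rightarrow> nat \<Rightarrow> complex"
  assumes "l \<ge> 1"
    and "defining_forms l (shi_cone l) n \<alpha>"
  shows "real (falk_invariant n \<alpha>) =
    real l * (real l - 1) * (2 * (real l)\<^sup>2 + real l - 4) / 6"
proof -
  have co: "\<alpha> i \<in> coord_space l" if "i \<le> n" for i using assms(2) that by (simp add: defining_forms_def)
  have bij: "bij_betw (\<lambda>i. hyperplane l (\<alpha> i)) {..n} (shi_cone l)"
    using assms(2) by (simp add: defining_forms_def)
  let ?hp = "\<lambda>P. hyperplane l (form P)"
  have hp: "bij_betw ?hp (shi_points l) (shi_cone l)"
    unfolding bij_betw_def using inj_on_hyperplane_form shi_cone_eq_image by blast
  \<comment> \<open>Numbers and points are matched through their common hyperplanes, so each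
    \<open>\<alpha> i\<close> is a nonzero multiple of the form of \<open>\<pi> i\<close>.\<close>
  define \<pi> where "\<pi> = inv_into (shi_points l) ?hp \<circ> (\<lambda>i. hyperplane l (\<alpha> i))"
  have \<pi>: "bij_betw \<pi> {..n} (shi_points l)"
    unfolding \<pi>_def using bij bij_betw_inv_into[OF hp] by (rule bij_betw_trans)
  have inj\<pi>: "inj_on \<pi> {..n}" using \<pi> by (simp add: bij_betw_def)
  have \<pi>p: "\<pi> i \<in> shi_points l" if "i \<le> n" for i using \<pi> that by (auto simp: bij_betw_def)
  have hp\<pi>: "?hp (\<pi> i) = hyperplane l (\<alpha> i)" if "i \<le> n" for i
  proof -
    have "hyperplane l (\<alpha> i) \<in> shi_cone l" using bij that by (auto simp: bij_betw_def)
    then show ?thesis unfolding \<pi>_def using bij_betw_inv_into_right[OF hp] by simp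
  qed
  have "\<exists>c. c \<noteq> 0 \<and> \<alpha> i = cscale c (form (\<pi> i))" if i: "i \<le> n" for i
  proof -
    obtain k where "form (\<pi> i) k \<noteq> 0" using form_nonzero[OF \<pi>p[OF i]] by blast
    then show ?thesis
      by (rule hyperplane_proportional[OF co[OF i] form_coord_space[OF \<pi>p[OF i]] _ hp\<pi>[OF i, symmetric]])
  qed
  then obtain c where c: "\<And>i. i \<le> n \<Longrightarrow> c i \<noteq> 0 \<and> \<alpha> i = cscale (c i) (form (\<pi> i))" by metis
  have inj\<alpha>: "inj_on \<alpha> {..n}" using bij unfolding bij_betw_def inj_on_def by metis
  \<comment> \<open>The nonzero factors \<open>c i\<close> can be moved between the forms and the
    coefficients of a relation.\<close>
  have dep: "cfun.dependent (\<alpha> ` S) \<longleftrightarrow> forms_dependent (\<pi> ` S)" if S: "S \<subseteq> {..n}" for S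
  proof -
    have fin: "finite S" using S finite_subset by blast
    have i\<alpha>: "inj_on \<alpha> S" and i\<pi>: "inj_on \<pi> S" using S inj\<alpha> inj\<pi> inj_on_subset by blast+
    have c': "c i \<noteq> 0" "\<alpha> i = cscale (c i) (form (\<pi> i))" if "i \<in> S" for i using c[of i] S that by auto
    have sum: "(\<Sum>i\<in>S. d i * \<alpha> i m) = (\<Sum>i\<in>S. (d i * c i) * form (\<pi> i) m)" for d m
      by (rule sum.cong) (use c'(2) in \<open>auto simp: cscale_def\<close>)
    show ?thesis
    proof
      assume "cfun.dependent (\<alpha> ` S)"
      then obtain d where d: "\<exists>i\<in>S. d i \<noteq> 0" "\<And>m. (\<Sum>i\<in>S. d i * \<alpha> i m) = 0"
        unfolding dependent_image_iff[OF fin i\<alpha>] by blast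
      let ?e = "\<lambda>P. d (inv_into S \<pi> P) * c (inv_into S \<pi> P)"
      have "(\<Sum>P\<in>\<pi> ` S. ?e P * form P m) = 0" for m
        using d(2)[of m] unfolding sum by (simp add: sum.reindex[OF i\<pi>] i\<pi>)
      moreover have "\<exists>P\<in>\<pi> ` S. ?e P \<noteq> 0" using d(1) c'(1) i\<pi> by (auto simp: inv_into_f_f)
      ultimately show "forms_dependent (\<pi> ` S)" unfolding forms_dependent_def by (intro exI[of _ ?e]) blast
    next
      assume "forms_dependent (\<pi> ` S)"
      then obtain e where e: "\<exists>P\<in>\<pi> ` S. e P \<noteq> 0" "\<And>m. (\<Sum>P\<in>\<pi> ` S. e P * form P m) = 0"
        unfolding forms_dependent_def by blast
      let ?d = "\<lambda>i. e (\<pi> i) / c i"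
      have "(\<Sum>i\<in>S. ?d i * \<alpha> i m) = (\<Sum>P\<in>\<pi> ` S. e P * form P m)" for m
        unfolding sum sum.reindex[OF i\<pi>] by (rule sum.cong) (use c'(1) in auto)
      moreover have "\<exists>i\<in>S. ?d i \<noteq> 0" using e(1) c'(1) by auto
      ultimately show "cfun.dependent (\<alpha> ` S)"
        unfolding dependent_image_iff[OF fin i\<alpha>] using e(2) by (intro exI[of _ ?d]) simp
    qed
  qed
  have sub: "\<pi> ` S \<subseteq> shi_points l" "finite (\<pi> ` S)" "card (\<pi> ` S) = card S" if "S \<subseteq> {..n}" for S
    using that \<pi>p finite_subset[OF that] card_image[OF inj_on_subset[OF inj\<pi> that]] by auto
  have low: "cfun.independent (\<alpha> ` S)" if "S \<subseteq> {..n}" "card S \<le> 2" for S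
    using dep[OF that(1)] forms_independent_le2[OF sub(1,2)[OF that(1)]] sub(3)[OF that(1)] that(2) by simp
  let ?L = "{S. S \<subseteq> {..n} \<and> \<pi> ` S \<in> shi_lines l}"
  have L: "?L = {S. S \<subseteq> {..n} \<and> card S = 3 \<and> cfun.dependent (\<alpha> ` S)}"
  proof -
    have "\<pi> ` S \<in> shi_lines l \<longleftrightarrow> card S = 3 \<and> cfun.dependent (\<alpha> ` S)" if S: "S \<subseteq> {..n}" for S
      using dep[OF S] forms_dependent_iff_line[OF sub(1)[OF S]] sub(3)[OF S] shi.card_line[of "\<pi> ` S" l] by auto
    then show ?thesis by blast
  qed
  have ls: "line_space {..n} ?L"
  proof
    fix T assume "T \<in> ?L"
    then show "T \<subseteq> {..n}" "card T = 3" unfolding L by blast+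
  next
    fix T T' p q assume T: "T \<in> ?L" "T' \<in> ?L" "p \<noteq> q" "{p, q} \<subseteq> T" "{p, q} \<subseteq> T'"
    have "\<pi> p \<noteq> \<pi> q" using T inj_onD[OF inj\<pi>, of p q] by blast
    then have "\<pi> ` T = \<pi> ` T'"
      using shi.line_unique[of "\<pi> ` T" l "\<pi> ` T'" "\<pi> p" "\<pi> q"] T by blast
    then show "T = T'" using inj_on_image_eq_iff[OF inj\<pi>] T by blast
  qed
  \<comment> \<open>Cocycles on the abstract points are renumbered by \<open>pull\<close> and then
    written as tensors; the image is the kernel that defines the Falk invariant.\<close>
  let ?F = "cocycle_tensor n \<circ> pull \<pi> {..n}"
  have sub_points: "T \<subseteq> shi_points l" if "T \<in> shi_lines l" for T using that by (rule shi.line_subset)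
  have P: "pull \<pi> {..n} ` cocycles (shi_points l) (shi_lines l) = cocycles {..n} ?L"
    by (rule pull_image_cocycles(1)[OF \<pi> sub_points])
  have inj: "inj_on (pull \<pi> {..n}) (cocycles (shi_points l) (shi_lines l))"
    by (rule pull_image_cocycles(2)[OF \<pi> sub_points])
  have "cfun.dim (?F ` cocycles (shi_points l) (shi_lines l)) = card (indices l)"
  proof (rule dim_image_shi_cocycles)
    show "Vector_Spaces.linear cscale cscale ?F"
      by (rule Vector_Spaces.linear_compose[OF linear_pull linear_cocycle_tensor])
    show "inj_on ?F (cocycles (shi_points l) (shi_lines l))"
    proof (rule comp_inj_on[OF inj])
      show "inj_on (cocycle_tensor n) (pull \<pi> {..n} ` cocycles (shi_points l) (shi_lines l))"
        unfolding P by (rule inj_on_subset[OF inj_on_cocycle_tensor[of n ?L]]) (auto intro: cocycles_precocycles)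
    qed
  qed
  moreover have "?F ` cocycles (shi_points l) (shi_lines l) =
      {t \<in> tensor_space (ext_deg n 1) (os_ideal n \<alpha> \<inter> ext_deg n 2). wedge_map t = 0}"
  proof -
    have "os_ideal n \<alpha> \<inter> ext_deg n 2 = quadratic n ?L"
      by (rule os_ideal_deg2[OF _ L ls]) (rule low)
    then show ?thesis by (simp only: kernel_eq_cocycles P image_comp[symmetric])
  qed
  ultimately have "falk_invariant n \<alpha> = card (indices l)" unfolding falk_invariant_def by simp
  then show ?thesis using card_indices[of l] by simp
qed

end
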